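(* Consider the closed-loop system (CL) described in the context, under the standing assumptions listed there, and let $\phi_1,\phi_2\in\mathcal K_\infty$ be functions with $\phi_1(\|\tilde x\|_{\tilde X})\le\tilde E(\tilde x)\le\phi_2(\|\tilde x\|_{\tilde X})$ for all $\tilde x\in\tilde X$. Suppose in addition the following. (A) Assumptions on the port-Hamiltonian system: (A1) there exists $\kappa>0$ such that for all $x\in D(\mathcal A)$ $$\kappa\left(|(\mathcal Hx)(0)|^2+|(\mathcal Hx)'(0)|^2+|(\mathcal Hx)(1)|^2\right)\le|\mathcal Bx|^2+|\mathcal Cx|^2;$$ (A2) $\mathcal H',\mathcal H,P_0,P_1$ are such that $$2>\left\|(\zeta-1)\left(\mathcal H'(\zeta)\mathcal H^{-1}(\zeta)+P_2^{-1}P_1\right)\right\|_{L^\infty((0,1);\mathbb R^{n\times n})}+\frac1{\sqrt2}\left|P_0^\top P_2^{-1}+P_2^{-1}P_0P_1P_2^{-1}P_1P_2^{-1}\right|+\frac12\left|(P_2^{-1}P_0)^\top P_2^{-1}P_0\right|.$$ (B) Assumptions on the controller: (B1) there exist constants $\overline c_1,\underline c_1>0$ such that $\overline c_1\,v_1^\top\nabla\mathcal P(v_1)\ge\mathcal P(v_1)\ge\underline c_1|v_1|^2$ for all $v_1\in\mathbb R^{n_c}$; (B2) there exist constants $\overline c_2,\underline c_2>0$ such that $\overline c_2\,v_2^\top\mathcal R(v_2)\ge|v_2|^2\ge\underline c_2|\mathcal R(v_2)|^2$ for all $v_2\in\mathbb R^{n_c}$. Then the closed-loop system (CL) is input-to-state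 stable, i.e. there exist a time $T_0>0$, $\beta_0\in(0,1)$ and $C_1,C_2>0$ such that for all $\tilde x_0\in\tilde X$ and all $d,d_c\in L^2_{\mathrm{loc}}([0,\infty);\mathbb R^m)$ the generalized solution $\tilde x_{ext}$ of (CL) with $\tilde x_{ext}(0)=\tilde x_0$ satisfies $$\|\tilde x_{ext}(t)\|_{\tilde X}\le\beta\left(\|\tilde x_0\|_{\tilde X},t\right)+\gamma_1\left(\|d_{|[0,t]}\|_{L^2}\right)+\gamma_2\left(\|d_{c|[0,t]}\|_{L^2}\right),\qquad t>0,$$ where $$\beta(r,t)=\phi_1^{-1}\left(3\beta_0^{t/T_0}\phi_2(r)\right),\qquad\gamma_1(r)=\phi_1^{-1}(3C_1r^2),\qquad\gamma_2(r)=\phi_1^{-1}(3C_2r^2),$$ and $\beta\in\mathcal{KL}$, $\gamma_1,\gamma_2\in\mathcal K_\infty$.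
   Context: Comparison functions, with $\mathbb R^+=[0,\infty)$: $\mathcal K$ is the set of continuous strictly increasing $\gamma:\mathbb R^+\to\mathbb R^+$ with $\gamma(0)=0$; $\mathcal K_\infty$ is the set of unbounded $\gamma\in\mathcal K$; $\mathcal L$ is the set of continuous strictly decreasing $\gamma:\mathbb R^+\to\mathbb R^+$ with $\lim_{r\to\infty}\gamma(r)=0$; $\mathcal{KL}$ is the set of continuous $\beta:\mathbb R^+\times\mathbb R^+\to\mathbb R^+$ with $\beta(\cdot,t)\in\mathcal K$ for all $t\ge0$ and $\beta(r,\cdot)\in\mathcal L$ for all $r>0$. $|\cdot|$ is the Euclidean norm for vectors; for matrices, $|\cdot|$ and $\|\cdot\|$ are the induced operator norm. Port-Hamiltonian system. Let $n,m$ be positive integers with $0<m\le2n$. Let $P_0,P_1,P_2\in\mathbb R^{n\times n}$ with $P_2$ skew-symmetric and invertible, $P_1$ symmetric and $\mathrm{Re}\,P_0=\frac12(P_0+P_0^\top)\le0$. Let $\mathcal H\in W^{1,\infty}((0,1);\mathbb R^{n\times n})$ with $\mathcal H(\zeta)$ self-adjoint and $m_-I\le\mathcal H(\zeta)\le m_+I$ for all $\zeta\in[0,1]$, for some constants $m_-,m_+>0$. Let $W_{B,1},W_C\in\mathbb R^{m\times4n}$ and $W_{B,2}\in\mathbb R^{(2n-m)\times4n}$ be such that the stacked matrix with block rows $W_{B,1},W_{B,2},W_C$ has full row rank. A prime denotes the derivative in $\zeta$. Let $\tau:H^2((0,1);\mathbb R^n)\to\mathbb R^{4n}$ be the trace operator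 $\tau(x)=(x(1),x'(1),x(0),x'(0))^\top$. The space $X=L^2((0,1);\mathbb R^n)$ carries the inner product $\langle x,z\rangle_X=\int_0^1x(\zeta)^\top\mathcal H(\zeta)z(\zeta)\,d\zeta$ with norm $\|\cdot\|_X$; put $E(x)=\frac12\|x\|_X^2$. Define $$D(\mathcal A)=\{x\in L^2((0,1);\mathbb R^n):\mathcal Hx\in H^2((0,1);\mathbb R^n),\ W_{B,2}\tau(\mathcal Hx)=0\},$$ $$\mathcal Ax=P_2(\mathcal Hx)''+P_1(\mathcal Hx)'+P_0\mathcal Hx,\qquad\mathcal Bx=W_{B,1}\tau(\mathcal Hx),\qquad\mathcal Cx=W_C\tau(\mathcal Hx).$$ Standing assumption (impedance passivity): $\langle x,\mathcal Ax\rangle_X\le(\mathcal Bx)^\top\mathcal Cx$ for all $x\in D(\mathcal A)$. The system is $\dot x=\mathcal Ax$, $u=\mathcal Bx$, $y=\mathcal Cx$. Controller. Let $B_c\in\mathbb R^{n_c\times m}$, and let $K\in\mathbb R^{n_c\times n_c}$ and $S_c\in\mathbb R^{m\times m}$ be (symmetric) positive definite; put $\delta=\min\sigma(S_c)>0$, so $S_c\ge\delta I$. Let $\mathcal P:\mathbb R^{n_c}\to[0,\infty)$ be differentiable with $\nabla\mathcal P$ locally Lipschitz, $\mathcal P(0)=0$, $\mathcal P(v_1)>0$ for $v_1\ne0$, and $\mathcal P(v_1)\to\infty$ as $|v_1|\to\infty$. Let $\mathcal R:\mathbb R^{n_c}\to\mathbb R^{n_c}$ be locally Lipschitz with $\mathcal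 R(0)=0$ and $v_2^\top\mathcal R(v_2)\ge0$ for all $v_2$. The controller is $\dot v_1=Kv_2$, $\dot v_2=-\nabla\mathcal P(v_1)-\mathcal R(Kv_2)+B_cu_c$, $y_c=B_c^\top Kv_2+S_cu_c$. On $V=\mathbb R^{2n_c}$ use $|v|_V^2=|v_1|^2+v_2^\top Kv_2$ for $v=(v_1,v_2)$, and put $E_c(v)=\mathcal P(v_1)+\frac12v_2^\top Kv_2$. Closed loop. With $u_c=y+d_c$ and $u=-y_c+d$, where $d,d_c$ are $\mathbb R^m$-valued disturbances, the state space is $\tilde X=X\times\mathbb R^{2n_c}$ with $\|(x,v)\|_{\tilde X}^2=\|x\|_X^2+|v|_V^2$. Put $D(\tilde{\mathcal A})=D(\mathcal A)\times\mathbb R^{2n_c}$ (with graph norm) and, for $\tilde x=(x,v_1,v_2)$, $$\tilde{\mathcal A}\tilde x=(\mathcal Ax,\ Kv_2,\ -v_1+B_c\mathcal Cx),\quad\tilde f(\tilde x)=(0,0,v_1-\nabla\mathcal P(v_1)-\mathcal R(Kv_2)),$$ $$\tilde{\mathcal B}\tilde x=\mathcal Bx+B_c^\top Kv_2+S_c\mathcal Cx,\quad\tilde{\mathcal C}\tilde x=\mathcal Cx,\quad\tilde B_cw=(0,0,w)\ \text{ for }w\in\mathbb R^{n_c}.$$ The closed-loop system (CL) is $$\dot{\tilde x}(t)=\tilde{\mathcal A}\tilde x(t)+\tilde f(\tilde x(t))+\tilde B_cB_cd_c(t),\quad\tilde{\mathcal B}\tilde x(t)=d(t)-S_cd_c(t),\quad\tilde{\mathcal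 C}\tilde x(t)=y(t),\quad t>0,\qquad\tilde x(0)=\tilde x_0.$$ Its energy is $\tilde E(\tilde x)=E(x)+E_c(v)=\frac12\|x\|_X^2+\mathcal P(v_1)+\frac12v_2^\top Kv_2$. Under the standing assumptions functions $\phi_1,\phi_2\in\mathcal K_\infty$ with $\phi_1(\|\tilde x\|_{\tilde X})\le\tilde E(\tilde x)\le\phi_2(\|\tilde x\|_{\tilde X})$ on $\tilde X$ exist. Solutions. Let $t_0\in(0,\infty]$. A triple $(\tilde x,(d,d_c),y)$ is a classical solution of (CL) on $[0,t_0)$ if $d,d_c\in C^2([0,t_0);\mathbb R^m)$, $y\in C([0,t_0);\mathbb R^m)$, $\tilde x\in C([0,t_0);D(\tilde{\mathcal A}))\cap C^1([0,t_0);\tilde X)$ and the equations of (CL) hold for every $t\in(0,t_0)$. It is a generalized solution on $[0,t_0)$ if $\tilde x\in C([0,t_0);\tilde X)$, $d,d_c,y\in L^2_{\mathrm{loc}}([0,t_0);\mathbb R^m)$ and there is a sequence of classical solutions $(\tilde x_k,(d_k,d_{c,k}),y_k)$ with $\tilde x_k\to\tilde x$ in $C([0,t_0);\tilde X)$ (uniformly on compact subintervals) and $d_k\to d$, $d_{c,k}\to d_c$, $y_k\to y$ in $L^2_{\mathrm{loc}}([0,t_0);\mathbb R^m)$. For every $\tilde x_0\in\tilde X$ and $d,d_c\in L^2_{\mathrm{loc}}([0,\infty);\mathbb R^m)$, (CL) has a unique generalized solution $(\tilde x_{ext},(d,d_c),y)$ on $[0,\infty)$ with $\tilde x_{ext}(0)=\tilde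 x_0$. *)

theory Defs
  imports
    "HOL-Analysis.Analysis"
    "HOL-Probability.Essential_Supremum"
    "HOL-Library.Function_Algebras"
begin

section \<open>Comparison functions\<close>

text \<open>Functions on \<open>[0,\<infinity>)\<close> are total functions on the reals of which only the values on
  \<^term>\<open>{0::real..}\<close> matter.\<close>

definition class_K :: "(real \<Rightarrow> real) \<Rightarrow> bool" where
  "class_K \<gamma> \<longleftrightarrow> continuous_on {0..} \<gamma> \<and> strict_mono_on {0..} \<gamma> \<and> \<gamma> 0 = 0 \<and> \<gamma> ` {0..} \<subseteq> {0..}"

definition class_K_inf :: "(real \<Rightarrow> real) \<Rightarrow> bool" where
  "class_K_inf \<gamma> \<longleftrightarrow> class_K \<gamma> \<and> \<not> bdd_above (\<gamma> ` {0..})"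

definition class_L :: "(real \<Rightarrow> real) \<Rightarrow> bool" where
  "class_L \<gamma> \<longleftrightarrow> continuous_on {0..} \<gamma> \<and> (\<forall>r\<ge>0. \<forall>s>r. \<gamma> s < \<gamma> r) \<and> \<gamma> ` {0..} \<subseteq> {0..} \<and>
     (\<gamma> \<longlongrightarrow> 0) at_top"

definition class_KL :: "(real \<Rightarrow> real \<Rightarrow> real) \<Rightarrow> bool" where
  "class_KL \<beta> \<longleftrightarrow> continuous_on ({0..} \<times> {0..}) (\<lambda>(r, t). \<beta> r t) \<and>
     (\<forall>t\<ge>0. class_K (\<lambda>r. \<beta> r t)) \<and> (\<forall>r>0. class_L (\<beta> r))"


section \<open>Matrices\<close>

definition opnorm :: "real^'n^'m \<Rightarrow> real" where
  "opnorm M = onorm ((*v) M)"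

definition symmetric_mat :: "real^'n^'n \<Rightarrow> bool" where
  "symmetric_mat M \<longleftrightarrow> transpose M = M"

definition mat_le :: "real^'n^'n \<Rightarrow> real^'n^'n \<Rightarrow> bool" where
  "mat_le M N \<longleftrightarrow> (\<forall>v. v \<bullet> (M *v v) \<le> v \<bullet> (N *v v))"

definition pos_def_mat :: "real^'n^'n \<Rightarrow> bool" where
  "pos_def_mat M \<longleftrightarrow> symmetric_mat M \<and> (\<forall>v. v \<noteq> 0 \<longrightarrow> 0 < v \<bullet> (M *v v))"


section \<open>Lebesgue and Sobolev spaces\<close>

text \<open>Elements of Lebesgue spaces are represented by functions; all notions below are invariant
  under modification of the representatives on null sets.\<close>

definition L2_on :: "real set \<Rightarrow> (real \<Rightarrow> 'a::euclidean_space) set" where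
  "L2_on S = {f. f \<in> borel_measurable (lebesgue_on S) \<and>
                 integrable (lebesgue_on S) (\<lambda>s. (norm (f s))\<^sup>2)}"

definition L2_norm_on :: "real set \<Rightarrow> (real \<Rightarrow> 'a::euclidean_space) \<Rightarrow> real" where
  "L2_norm_on S f = sqrt (LINT s|lebesgue_on S. (norm (f s))\<^sup>2)"

abbreviation unit_leb :: "real measure" where
  "unit_leb \<equiv> lebesgue_on {0<..<1}"

definition Linf_unit :: "(real \<Rightarrow> 'a::euclidean_space) set" where
  "Linf_unit = {f. f \<in> borel_measurable unit_leb \<and> (\<exists>c. AE s in unit_leb. norm (f s) \<le> c)}"

definition test_fun :: "(real \<Rightarrow> real) \<Rightarrow> (real \<Rightarrow> real) \<Rightarrow> bool" where
  "test_fun \<phi> \<phi>' \<longleftrightarrow> (\<forall>s. (\<phi> has_real_derivative \<phi>' s) (at s)) \<and> continuous_on UNIV \<phi>' \<and>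
     (\<exists>a b. 0 < a \<and> b < 1 \<and> (\<forall>s. s \<notin> {a..b} \<longrightarrow> \<phi> s = 0))"

text \<open>Weak derivatives on \<open>(0,1)\<close>, with compactly supported \<open>C\<^sup>1\<close> test functions (as in Brezis).
  Integrability on \<open>(0,1)\<close> is implied by membership in any \<open>L\<^sup>p(0,1)\<close>; it makes the
  integrals below meaningful.\<close>

definition weak_deriv :: "(real \<Rightarrow> 'a::euclidean_space) \<Rightarrow> (real \<Rightarrow> 'a) \<Rightarrow> bool" where
  "weak_deriv f g \<longleftrightarrow> integrable unit_leb f \<and> integrable unit_leb g \<and>
     (\<forall>\<phi> \<phi>'. test_fun \<phi> \<phi>' \<longrightarrow>
        (LINT s|unit_leb. \<phi>' s *\<^sub>R f s) = - (LINT s|unit_leb. \<phi> s *\<^sub>R g s))"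

text \<open>The weak derivative is unique only almost everywhere, and \<open>wD f\<close> is some representative.\<close>

definition wD :: "(real \<Rightarrow> 'a::euclidean_space) \<Rightarrow> real \<Rightarrow> 'a" where
  "wD f = (SOME g. weak_deriv f g)"

definition H1 :: "(real \<Rightarrow> 'a::euclidean_space) set" where
  "H1 = {f \<in> L2_on {0<..<1}. \<exists>g \<in> L2_on {0<..<1}. weak_deriv f g}"

definition H2 :: "(real \<Rightarrow> 'a::euclidean_space) set" where
  "H2 = {f \<in> H1. wD f \<in> H1}"

definition W1inf :: "(real \<Rightarrow> 'a::euclidean_space) set" where
  "W1inf = {f \<in> Linf_unit. \<exists>g \<in> Linf_unit. weak_deriv f g}"

text \<open>The continuous representative on \<open>[0,1]\<close> of an element of \<open>H\<^sup>1(0,1)\<close>, which is what point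
  values refer to; its values on \<open>[0,1]\<close> are uniquely determined.\<close>

definition crep :: "(real \<Rightarrow> 'a::euclidean_space) \<Rightarrow> real \<Rightarrow> 'a" where
  "crep f = (SOME w. continuous_on {0..1} w \<and> (AE s in unit_leb. w s = f s))"

text \<open>The trace \<open>(x(1), x'(1), x(0), x'(0))\<close>; vectors with \<open>4n\<close> entries are indexed by the
  fourfold sum type.\<close>

definition trace_op :: "(real \<Rightarrow> real^'n) \<Rightarrow> real^('n + 'n + 'n + 'n)" where
  "trace_op f = (\<chi> i. case i of
       Inl a \<Rightarrow> crep f 1 $ a
     | Inr (Inl a) \<Rightarrow> crep (wD f) 1 $ a
     | Inr (Inr (Inl a)) \<Rightarrow> crep f 0 $ a
     | Inr (Inr (Inr a)) \<Rightarrow> crep (wD f) 0 $ a)"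


section \<open>The port-Hamiltonian system\<close>

text \<open>\<open>WB2\<close> has \<open>2n - m\<close> rows, which may be no rows at all, so that it cannot be indexed by a type:
  its rows are \<open>WB2 S i\<close> for \<open>i < 2n - m\<close>.\<close>

record ('n::finite, 'm::finite) phs =
  P0 :: "real^'n^'n"
  P1 :: "real^'n^'n"
  P2 :: "real^'n^'n"
  Ham :: "real \<Rightarrow> real^'n^'n"
  WB1 :: "real^('n + 'n + 'n + 'n)^'m"
  WB2 :: "nat \<Rightarrow> real^('n + 'n + 'n + 'n)"
  WC :: "real^('n + 'n + 'n + 'n)^'m"

definition WB2_dim :: "('n::finite, 'm::finite) phs \<Rightarrow> nat" where
  "WB2_dim S = 2 * CARD('n) - CARD('m)"

definition Hmul :: "('n::finite, 'm::finite) phs \<Rightarrow> (real \<Rightarrow> real^'n) \<Rightarrow> real \<Rightarrow> real^'n" where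
  "Hmul S x = (\<lambda>\<zeta>. Ham S \<zeta> *v x \<zeta>)"

definition X_space :: "(real \<Rightarrow> real^'n) set" where
  "X_space = L2_on {0<..<1}"

definition inner_X ::
  "('n::finite, 'm::finite) phs \<Rightarrow> (real \<Rightarrow> real^'n) \<Rightarrow> (real \<Rightarrow> real^'n) \<Rightarrow> real" where
  "inner_X S x z = (LINT \<zeta>|unit_leb. x \<zeta> \<bullet> (Ham S \<zeta> *v z \<zeta>))"

definition norm_X :: "('n::finite, 'm::finite) phs \<Rightarrow> (real \<Rightarrow> real^'n) \<Rightarrow> real" where
  "norm_X S x = sqrt (inner_X S x x)"

definition E_X :: "('n::finite, 'm::finite) phs \<Rightarrow> (real \<Rightarrow> real^'n) \<Rightarrow> real" where
  "E_X S x = 1/2 * (norm_X S x)\<^sup>2"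

definition dom_A :: "('n::finite, 'm::finite) phs \<Rightarrow> (real \<Rightarrow> real^'n) set" where
  "dom_A S = {x \<in> X_space. Hmul S x \<in> H2 \<and>
                (\<forall>i < WB2_dim S. WB2 S i \<bullet> trace_op (Hmul S x) = 0)}"

definition op_A :: "('n::finite, 'm::finite) phs \<Rightarrow> (real \<Rightarrow> real^'n) \<Rightarrow> real \<Rightarrow> real^'n" where
  "op_A S x = (\<lambda>\<zeta>. P2 S *v wD (wD (Hmul S x)) \<zeta> + P1 S *v wD (Hmul S x) \<zeta> + P0 S *v Hmul S x \<zeta>)"

definition op_B :: "('n::finite, 'm::finite) phs \<Rightarrow> (real \<Rightarrow> real^'n) \<Rightarrow> real^'m" where
  "op_B S x = WB1 S *v trace_op (Hmul S x)"

definition op_C :: "('n::finite, 'm::finite) phs \<Rightarrow> (real \<Rightarrow> real^'n) \<Rightarrow> real^'m" where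
  "op_C S x = WC S *v trace_op (Hmul S x)"

text \<open>Continuity of \<open>Ham S\<close> on \<open>[0,1]\<close> only selects the continuous representative of an element
  of \<open>W\<^sup>1\<^sup>,\<^sup>\<infinity>(0,1)\<close>, as needed for the pointwise conditions. The condition on \<open>dim\<close> is full row rank
  of the stacked matrix with \<open>m + (2n - m) + m\<close> rows.\<close>

definition port_Hamiltonian :: "('n::finite, 'm::finite) phs \<Rightarrow> bool" where
  "port_Hamiltonian S \<longleftrightarrow>
     CARD('m) \<le> 2 * CARD('n) \<and>
     transpose (P2 S) = - P2 S \<and> invertible (P2 S) \<and>
     symmetric_mat (P1 S) \<and>
     mat_le ((1/2) *\<^sub>R (P0 S + transpose (P0 S))) 0 \<and>
     Ham S \<in> W1inf \<and> continuous_on {0..1} (Ham S) \<and>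
     (\<forall>\<zeta>\<in>{0..1}. symmetric_mat (Ham S \<zeta>)) \<and>
     (\<exists>m_lo m_hi. 0 < m_lo \<and> 0 < m_hi \<and>
        (\<forall>\<zeta>\<in>{0..1}. mat_le (m_lo *\<^sub>R mat 1) (Ham S \<zeta>) \<and> mat_le (Ham S \<zeta>) (m_hi *\<^sub>R mat 1))) \<and>
     dim (rows (WB1 S) \<union> WB2 S ` {..<WB2_dim S} \<union> rows (WC S)) =
       CARD('m) + WB2_dim S + CARD('m)"

definition impedance_passive :: "('n::finite, 'm::finite) phs \<Rightarrow> bool" where
  "impedance_passive S \<longleftrightarrow> (\<forall>x\<in>dom_A S. inner_X S x (op_A S x) \<le> op_B S x \<bullet> op_C S x)"


section \<open>The controller\<close>

record ('m::finite, 'c::finite) ctrl =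
  Bc :: "real^'m^'c"
  Kc :: "real^'c^'c"
  Sc :: "real^'m^'m"
  Pot :: "real^'c \<Rightarrow> real"
  Res :: "real^'c \<Rightarrow> real^'c"

definition grad :: "(real^'c \<Rightarrow> real) \<Rightarrow> real^'c \<Rightarrow> real^'c" where
  "grad f v = (THE d. GDERIV f v :> d)"

definition locally_lipschitz :: "(real^'c \<Rightarrow> real^'c) \<Rightarrow> bool" where
  "locally_lipschitz f \<longleftrightarrow> (\<forall>v. \<exists>r>0. \<exists>L. L-lipschitz_on (ball v r) f)"

definition nonlinear_controller :: "('m::finite, 'c::finite) ctrl \<Rightarrow> bool" where
  "nonlinear_controller G \<longleftrightarrow>
     pos_def_mat (Kc G) \<and> pos_def_mat (Sc G) \<and>
     (\<forall>v. 0 \<le> Pot G v) \<and> (\<forall>v. Pot G differentiable (at v)) \<and> locally_lipschitz (grad (Pot G)) \<and>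
     Pot G 0 = 0 \<and> (\<forall>v. v \<noteq> 0 \<longrightarrow> 0 < Pot G v) \<and> filterlim (Pot G) at_top at_infinity \<and>
     locally_lipschitz (Res G) \<and> Res G 0 = 0 \<and> (\<forall>v. 0 \<le> v \<bullet> Res G v)"

definition E_ctrl :: "('m::finite, 'c::finite) ctrl \<Rightarrow> (real^'c) \<times> (real^'c) \<Rightarrow> real" where
  "E_ctrl G = (\<lambda>(v1, v2). Pot G v1 + 1/2 * (v2 \<bullet> (Kc G *v v2)))"

definition norm_V :: "('m::finite, 'c::finite) ctrl \<Rightarrow> (real^'c) \<times> (real^'c) \<Rightarrow> real" where
  "norm_V G = (\<lambda>(v1, v2). sqrt ((norm v1)\<^sup>2 + v2 \<bullet> (Kc G *v v2)))"


section \<open>The closed loop\<close>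

text \<open>A state is \<open>(x, v1, v2)\<close>. Sums, differences and \<open>0\<close> are those of products and functions.\<close>

type_synonym ('n, 'c) cl_state = "(real \<Rightarrow> real^'n) \<times> (real^'c) \<times> (real^'c)"

definition cl_space :: "('n::finite, 'c::finite) cl_state set" where
  "cl_space = X_space \<times> UNIV"

definition cl_eq :: "('n::finite, 'c::finite) cl_state \<Rightarrow> ('n, 'c) cl_state \<Rightarrow> bool" where
  "cl_eq z w \<longleftrightarrow> (AE \<zeta> in unit_leb. fst z \<zeta> = fst w \<zeta>) \<and> snd z = snd w"

definition cl_scale :: "real \<Rightarrow> ('n::finite, 'c::finite) cl_state \<Rightarrow> ('n, 'c) cl_state" where
  "cl_scale a z = ((\<lambda>\<zeta>. a *\<^sub>R fst z \<zeta>), a *\<^sub>R snd z)"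

definition norm_cl ::
  "('n::finite, 'm::finite) phs \<Rightarrow> ('m, 'c::finite) ctrl \<Rightarrow> ('n, 'c) cl_state \<Rightarrow> real" where
  "norm_cl S G z = sqrt ((norm_X S (fst z))\<^sup>2 + (norm_V G (snd z))\<^sup>2)"

definition E_cl ::
  "('n::finite, 'm::finite) phs \<Rightarrow> ('m, 'c::finite) ctrl \<Rightarrow> ('n, 'c) cl_state \<Rightarrow> real" where
  "E_cl S G z = E_X S (fst z) + E_ctrl G (snd z)"

definition dom_cl :: "('n::finite, 'm::finite) phs \<Rightarrow> ('n, 'c::finite) cl_state set" where
  "dom_cl S = dom_A S \<times> UNIV"

definition cl_A ::
  "('n::finite, 'm::finite) phs \<Rightarrow> ('m, 'c::finite) ctrl \<Rightarrow> ('n, 'c) cl_state \<Rightarrow> ('n, 'c) cl_state" where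
  "cl_A S G = (\<lambda>(x, v1, v2). (op_A S x, Kc G *v v2, - v1 + Bc G *v op_C S x))"

definition cl_f :: "('m::finite, 'c::finite) ctrl \<Rightarrow> ('n::finite, 'c) cl_state \<Rightarrow> ('n, 'c) cl_state" where
  "cl_f G = (\<lambda>(x, v1, v2). (0, 0, v1 - grad (Pot G) v1 - Res G (Kc G *v v2)))"

definition cl_B ::
  "('n::finite, 'm::finite) phs \<Rightarrow> ('m, 'c::finite) ctrl \<Rightarrow> ('n, 'c) cl_state \<Rightarrow> real^'m" where
  "cl_B S G = (\<lambda>(x, v1, v2). op_B S x + transpose (Bc G) *v (Kc G *v v2) + Sc G *v op_C S x)"

definition cl_C :: "('n::finite, 'm::finite) phs \<Rightarrow> ('n, 'c::finite) cl_state \<Rightarrow> real^'m" where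
  "cl_C S = (\<lambda>(x, v1, v2). op_C S x)"

definition cl_Bc :: "real^'c \<Rightarrow> ('n::finite, 'c::finite) cl_state" where
  "cl_Bc w = (0, 0, w)"

definition graph_norm_cl ::
  "('n::finite, 'm::finite) phs \<Rightarrow> ('m, 'c::finite) ctrl \<Rightarrow> ('n, 'c) cl_state \<Rightarrow> real" where
  "graph_norm_cl S G z = norm_cl S G z + norm_cl S G (cl_A S G z)"


section \<open>Solutions\<close>

definition time_dom :: "ereal \<Rightarrow> real set" where
  "time_dom t0 = {t. 0 \<le> t \<and> ereal t < t0}"

text \<open>Continuity into, respectively differentiability in, a space of states whose topology is
  given by a norm \<open>N\<close> on representatives; one-sided at the left end of \<open>I\<close>.\<close>

definition cont_into ::
  "(('n::finite, 'c::finite) cl_state \<Rightarrow> real) \<Rightarrow> ('n, 'c) cl_state set \<Rightarrow> real set \<Rightarrow>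
   (real \<Rightarrow> ('n, 'c) cl_state) \<Rightarrow> bool" where
  "cont_into N Z I z \<longleftrightarrow>
     (\<forall>t\<in>I. z t \<in> Z \<and> ((\<lambda>s. N (z s - z t)) \<longlongrightarrow> 0) (at t within I))"

definition has_cl_derivative ::
  "(('n::finite, 'c::finite) cl_state \<Rightarrow> real) \<Rightarrow> real set \<Rightarrow>
   (real \<Rightarrow> ('n, 'c) cl_state) \<Rightarrow> (real \<Rightarrow> ('n, 'c) cl_state) \<Rightarrow> bool" where
  "has_cl_derivative N I z z' \<longleftrightarrow>
     (\<forall>t\<in>I. ((\<lambda>s. N (cl_scale (1 / (s - t)) (z s - z t) - z' t)) \<longlongrightarrow> 0) (at t within I))"

definition C2_on :: "real set \<Rightarrow> (real \<Rightarrow> real^'m) \<Rightarrow> bool" where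
  "C2_on I f \<longleftrightarrow> (\<exists>f' f''.
     (\<forall>t\<in>I. (f has_vector_derivative f' t) (at t within I)) \<and>
     (\<forall>t\<in>I. (f' has_vector_derivative f'' t) (at t within I)) \<and>
     continuous_on I f'')"

definition L2_loc :: "ereal \<Rightarrow> (real \<Rightarrow> 'a::euclidean_space) set" where
  "L2_loc t0 = {f. \<forall>T\<in>time_dom t0. f \<in> L2_on {0..T}}"

definition L2_loc_tendsto ::
  "ereal \<Rightarrow> (nat \<Rightarrow> real \<Rightarrow> 'a::euclidean_space) \<Rightarrow> (real \<Rightarrow> 'a) \<Rightarrow> bool" where
  "L2_loc_tendsto t0 fs f \<longleftrightarrow>
     (\<forall>T\<in>time_dom t0. (\<lambda>k. L2_norm_on {0..T} (\<lambda>s. fs k s - f s)) \<longlonglongrightarrow> 0)"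

definition classical_solution ::
  "('n::finite, 'm::finite) phs \<Rightarrow> ('m, 'c::finite) ctrl \<Rightarrow> ereal \<Rightarrow>
   (real \<Rightarrow> ('n, 'c) cl_state) \<Rightarrow> (real \<Rightarrow> real^'m) \<Rightarrow> (real \<Rightarrow> real^'m) \<Rightarrow> (real \<Rightarrow> real^'m) \<Rightarrow> bool" where
  "classical_solution S G t0 z d dc y \<longleftrightarrow>
     C2_on (time_dom t0) d \<and> C2_on (time_dom t0) dc \<and> continuous_on (time_dom t0) y \<and>
     cont_into (graph_norm_cl S G) (dom_cl S) (time_dom t0) z \<and>
     (\<exists>z'. has_cl_derivative (norm_cl S G) (time_dom t0) z z' \<and>
           cont_into (norm_cl S G) cl_space (time_dom t0) z' \<and>
           (\<forall>t\<in>time_dom t0. 0 < t \<longrightarrow>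
              cl_eq (z' t) (cl_A S G (z t) + cl_f G (z t) + cl_Bc (Bc G *v dc t)) \<and>
              cl_B S G (z t) = d t - Sc G *v dc t \<and>
              cl_C S (z t) = y t))"

definition generalized_solution ::
  "('n::finite, 'm::finite) phs \<Rightarrow> ('m, 'c::finite) ctrl \<Rightarrow> ereal \<Rightarrow>
   (real \<Rightarrow> ('n, 'c) cl_state) \<Rightarrow> (real \<Rightarrow> real^'m) \<Rightarrow> (real \<Rightarrow> real^'m) \<Rightarrow> (real \<Rightarrow> real^'m) \<Rightarrow> bool" where
  "generalized_solution S G t0 z d dc y \<longleftrightarrow>
     cont_into (norm_cl S G) cl_space (time_dom t0) z \<and>
     d \<in> L2_loc t0 \<and> dc \<in> L2_loc t0 \<and> y \<in> L2_loc t0 \<and>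
     (\<exists>zs ds dcs ys.
        (\<forall>k. classical_solution S G t0 (zs k) (ds k) (dcs k) (ys k)) \<and>
        (\<forall>T\<in>time_dom t0. \<forall>\<epsilon>>0. \<forall>\<^sub>F k in sequentially. \<forall>t\<in>{0..T}. norm_cl S G (zs k t - z t) < \<epsilon>) \<and>
        L2_loc_tendsto t0 ds d \<and> L2_loc_tendsto t0 dcs dc \<and> L2_loc_tendsto t0 ys y)"

end

theory Submission
  imports Defs
begin

text \<open>
  Let \<open>Q = P\<^sub>2\<^sup>-\<^sup>1\<close> (again skew-symmetric) and let \<open>X(\<zeta>)\<close> be the integral of \<open>x\<close> over \<open>[0,\<zeta>]\<close>. The total
  energy is dissipated at a rate that dominates \<open>|K v\<^sub>2|\<^sup>2 + |y|\<^sup>2\<close>, hence, by (A1), the traces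
  \<open>(Hx)(0)\<close>, \<open>(Hx)'(0)\<close>, \<open>(Hx)(1)\<close>. It becomes a strict Lyapunov function, up to the squares of the
  disturbances, after adding a small multiple of \<open>v\<^sub>1 \<bullet> v\<^sub>2 + F(x)\<close>, where \<open>F(x)\<close> is the integral of
  \<open>q x \<bullet> Q X\<close>. This form is bounded on \<open>L\<^sup>2\<close>, and along solutions its derivative is bounded by
  \<open>- c \<parallel>x\<parallel>\<^sup>2\<close> plus a multiple of the squared traces, provided the weight \<open>q\<close> is of Carleman type:
  \<open>q' = exp (2 \<sigma>)\<close> and \<open>q(1) = 0\<close> with the convex function \<open>\<sigma>(\<zeta>) = exp (\<mu> (1 - \<zeta>))\<close>. Convexity of \<open>\<sigma>\<close> makes
  the principal part coercive with a constant that grows with \<open>\<mu>\<close>, so that for large \<open>\<mu>\<close> all terms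
  with \<open>H'\<close>, \<open>P\<^sub>1\<close> and \<open>P\<^sub>0\<close> are absorbed, whatever their size.
\<close>

text \<open>The energy of x is an L^2 norm, so a correction to it may contain no derivative of x.
  This forces the primitive X: Q undoes P_2, so Q applied to the primitive of A x contains (Hx)' and
  lower-order terms but no second derivative. Skew-symmetry of Q makes the two halves of the product
  rule for F add up, where a symmetric matrix would cancel their leading parts. Integration by parts
  leaves - 2 p x . Hx and an indefinite multiple of X . Hx. With \<rho> = - \<sigma>' these complete
  to the square of x - \<rho> X, which degenerates along x = \<rho> X; the second derivative
  \<sigma>'' = \<mu> \<rho> contributes a multiple of X . HX that removes the degeneracy. Relative
  to the common weight p / \<rho>, both gains grow linearly in \<mu>, whereas the lower-order terms
  keep constants independent of \<mu>.\<close>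

section \<open>The Carleman-type multiplier estimate\<close>

text \<open>\<open>Ham S\<close> is only Lipschitz, so that expressions involving it are integrated by parts through
  lower bounds on their right difference quotients.\<close>

lemma right_dini_integral_le:
  fixes \<phi> \<psi> :: "real \<Rightarrow> real"
  assumes \<phi>: "continuous_on {0..1} \<phi>" and \<psi>: "continuous_on {0..1} \<psi>"
    and dini: "\<And>z. 0 \<le> z \<Longrightarrow> z < 1 \<Longrightarrow> \<exists>g D. (g \<longlongrightarrow> D) (at z within {z<..1}) \<and> \<psi> z \<le> D \<and>
                 (\<forall>s\<in>{z<..1}. (s - z) * g s \<le> \<phi> s - \<phi> z)"
  shows "integral {0..1} \<psi> \<le> \<phi> 1 - \<phi> 0"
proof (rule field_le_epsilon)
  fix \<epsilon> :: real assume \<epsilon>: "0 < \<epsilon>"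
  \<comment> \<open>The slack \<open>\<epsilon> * t\<close> makes the right difference quotients of
    \<open>k\<close> strictly positive in the limit.\<close>
  define k where "k t = \<phi> t - integral {0..t} \<psi> + \<epsilon> * t" for t
  have prim: "((\<lambda>t. integral {0..t} \<psi>) has_real_derivative \<psi> z) (at z within {0..1})" if "z \<in> {0..1}" for z
    using integral_has_real_derivative[OF \<psi> that] .
  have k: "continuous_on {0..1} k"
    unfolding k_def
    by (intro continuous_intros \<phi> indefinite_integral_continuous_1 integrable_continuous_real \<psi>)
  \<comment> \<open>Monotonicity of \<open>k\<close> is never shown. It is enough to look at the
    last time at which \<open>k\<close> is not below \<open>k 0\<close>: if that time were less than
    1, a positive right quotient would produce a later one.\<close>
  define T where "T = {0..1} \<inter> k -` {k 0..}"
  have T: "closed T" unfolding T_def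
    by (rule continuous_closed_preimage[OF k]) auto
  have "0 \<in> T" "bdd_above T" unfolding T_def by (auto intro!: bdd_aboveI[of _ 1])
  then have St: "Sup T \<in> T" using closed_contains_Sup T by blast
  have "Sup T = 1"
  proof (rule ccontr)
    assume "Sup T \<noteq> 1"
    define z where "z = Sup T"
    have z: "0 \<le> z" "z < 1" "k 0 \<le> k z" using St \<open>Sup T \<noteq> 1\<close> by (auto simp: T_def z_def)
    obtain g D where g: "(g \<longlongrightarrow> D) (at z within {z<..1})" "\<psi> z \<le> D"
        "\<And>s. s \<in> {z<..1} \<Longrightarrow> (s - z) * g s \<le> \<phi> s - \<phi> z"
      using dini[OF z(1,2)] by blast
    have "((\<lambda>t. integral {0..t} \<psi>) has_real_derivative \<psi> z) (at z within {z<..1})"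
      using z by (auto intro: DERIV_subset[OF prim])
    then have "((\<lambda>s. (integral {0..s} \<psi> - integral {0..z} \<psi>) / (s - z)) \<longlongrightarrow> \<psi> z) (at z within {z<..1})"
      by (simp add: has_field_derivative_iff)
    then have "((\<lambda>s. g s - (integral {0..s} \<psi> - integral {0..z} \<psi>) / (s - z) + \<epsilon>) \<longlongrightarrow> D - \<psi> z + \<epsilon>)
        (at z within {z<..1})"
      by (intro tendsto_intros g)
    moreover have "0 < D - \<psi> z + \<epsilon>" using g \<epsilon> by simp
    ultimately have ev: "\<forall>\<^sub>F s in at z within {z<..1}.
        0 < g s - (integral {0..s} \<psi> - integral {0..z} \<psi>) / (s - z) + \<epsilon>"
      by (rule order_tendstoD)
    have "at z within {z<..1} \<noteq> bot"
      using z by (simp add: at_within_eq_bot_iff)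
    then obtain s where s: "s \<in> {z<..1}" "0 < g s - (integral {0..s} \<psi> - integral {0..z} \<psi>) / (s - z) + \<epsilon>"
      using eventually_happens'[OF _ eventually_conj[OF ev eventually_at_topological[THEN iffD2]], of "\<lambda>s. s \<in> {z<..1}"]
      by auto
    then have "0 < (s - z) * (g s - (integral {0..s} \<psi> - integral {0..z} \<psi>) / (s - z) + \<epsilon>)"
      by (intro mult_pos_pos) auto
    also have "\<dots> = (s - z) * g s - (s - z) * ((integral {0..s} \<psi> - integral {0..z} \<psi>) / (s - z)) + \<epsilon> * (s - z)"
      by (simp only: distrib_left right_diff_distrib mult.commute)
    also have "\<dots> = (s - z) * g s - (integral {0..s} \<psi> - integral {0..z} \<psi>) + \<epsilon> * (s - z)"
      using s(1) by simp
    also have "\<dots> \<le> k s - k z" using g(3)[OF s(1)] by (simp add: k_def algebra_simps)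
    finally have "s \<in> T" using s(1) z by (auto simp: T_def)
    then have "s \<le> z" unfolding z_def by (intro cSup_upper \<open>bdd_above T\<close>)
    then show False using s(1) by auto
  qed
  then show "integral {0..1} \<psi> \<le> \<phi> 1 - \<phi> 0 + \<epsilon>"
    using St by (auto simp: T_def k_def)
qed

text \<open>Needed twice in quotient form: for the one-sided quotients in \<open>estimate\<close>,
  and for curves of states, whose derivatives are given as limits of quotients.\<close>

lemma has_vector_derivative_iff_tendsto:
  "(f has_vector_derivative d) (at t within T) \<longleftrightarrow> ((\<lambda>s. (f s - f t) /\<^sub>R (s - t)) \<longlongrightarrow> d) (at t within T)"
proof -
  have "((\<lambda>s. (f s - f t) /\<^sub>R (s - t)) \<longlongrightarrow> d) (at t within T) \<longleftrightarrow>
        ((\<lambda>s. norm ((f s - f t) /\<^sub>R (s - t) - d)) \<longlongrightarrow> 0) (at t within T)"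
    by (subst tendsto_norm_zero_iff) (rule LIM_zero_iff[symmetric])
  also have "\<dots> \<longleftrightarrow> ((\<lambda>s. norm (f s - f t - (s - t) *\<^sub>R d) / norm (s - t)) \<longlongrightarrow> 0) (at t within T)"
  proof (rule tendsto_cong)
    have "norm ((f s - f t) /\<^sub>R (s - t) - d) = norm (f s - f t - (s - t) *\<^sub>R d) / norm (s - t)" if "s \<noteq> t" for s
    proof -
      have "(f s - f t) /\<^sub>R (s - t) - d = (f s - f t - (s - t) *\<^sub>R d) /\<^sub>R (s - t)"
        using that by (simp add: scaleR_diff_right)
      then show ?thesis by (simp add: divide_inverse mult.commute)
    qed
    then show "\<forall>\<^sub>F s in at t within T. norm ((f s - f t) /\<^sub>R (s - t) - d) = norm (f s - f t - (s - t) *\<^sub>R d) / norm (s - t)"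
      by (auto simp: eventually_at_filter)
  qed
  finally show ?thesis
    by (simp add: has_vector_derivative_def has_derivative_iff_norm bounded_linear_scaleR_left)
qed

text \<open>Scalar core of the estimate: \<open>u\<close>, \<open>x\<close>, \<open>i\<close> stand
  for |\<xi>|, \<rho> |X|, \<rho> |I| once the factor p / \<rho> is taken out. Young's inequality
  splits every product. The term 2 i^2 is spent in two halves, one on M u i and one on b i;
  \<open>T\<close> collects the factors X and 2 \<xi> by which the remainder R is
  multiplied.\<close>

lemma carleman_pointwise:
  fixes u x i a b \<beta> \<mu> m L M :: real
  assumes "0 \<le> a" "0 \<le> b" "0 \<le> M" "0 \<le> i" "0 \<le> u" "0 \<le> x" "0 \<le> \<beta>"
    and \<mu>: "L + 2 + b\<^sup>2 \<le> \<mu> * m / 2" "L + M\<^sup>2 + a\<^sup>2 * M\<^sup>2 / 2 + 9 + 4 * b\<^sup>2 \<le> \<mu> * m / 4"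
  shows "u\<^sup>2 - \<beta>\<^sup>2 / 2 \<le> \<mu> * m / 4 * u\<^sup>2 + \<mu> * m / 2 * x\<^sup>2 - L * u\<^sup>2 - L * x\<^sup>2 + 2 * i\<^sup>2 - 2 * (M * u * i)
           - (x + 2 * u) * (a * M * u + b * i + \<beta>)"
proof -
  define T where "T = x + 2 * u"
  have am: "y * z \<le> y\<^sup>2 / 2 + z\<^sup>2 / 2" for y z :: real
    using sum_squares_bound[of y z] by simp
  have 1: "2 * (M * u * i) \<le> M\<^sup>2 * u\<^sup>2 + i\<^sup>2"
    using am[of "M * u" i] by (simp add: power_mult_distrib)
  have 2: "T * (a * M * u) \<le> T\<^sup>2 / 2 + a\<^sup>2 * M\<^sup>2 / 2 * u\<^sup>2"
    using am[of T "a * M * u"] by (simp add: power_mult_distrib)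
  have 3: "T * (b * i) \<le> b\<^sup>2 * T\<^sup>2 / 2 + i\<^sup>2"
  proof -
    have "T * (b * i) \<le> b\<^sup>2 * T\<^sup>2 / 2 + i\<^sup>2 / 2"
      using am[of "b * T" i] by (simp add: power_mult_distrib algebra_simps)
    moreover have "0 \<le> i\<^sup>2" by simp
    ultimately show ?thesis by linarith
  qed
  have 4: "T * \<beta> \<le> T\<^sup>2 / 2 + \<beta>\<^sup>2 / 2"
    by (rule am)
  have 5: "T\<^sup>2 \<le> 2 * x\<^sup>2 + 8 * u\<^sup>2"
    using sum_squares_bound[of x "2 * u"] by (simp add: T_def power2_sum)
  have "(1 + b\<^sup>2 / 2) * T\<^sup>2 \<le> (1 + b\<^sup>2 / 2) * (2 * x\<^sup>2 + 8 * u\<^sup>2)"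
    by (intro mult_left_mono 5) auto
  then have 6: "T\<^sup>2 + b\<^sup>2 * T\<^sup>2 / 2 \<le> (2 + b\<^sup>2) * x\<^sup>2 + (8 + 4 * b\<^sup>2) * u\<^sup>2"
    by (simp add: algebra_simps)
  have 7: "(L + 2 + b\<^sup>2) * x\<^sup>2 \<le> (\<mu> * m / 2) * x\<^sup>2"
    "(L + M\<^sup>2 + a\<^sup>2 * M\<^sup>2 / 2 + 9 + 4 * b\<^sup>2) * u\<^sup>2 \<le> (\<mu> * m / 4) * u\<^sup>2"
    by (intro mult_right_mono \<mu>; simp)+
  have 8: "T * (a * M * u + b * i + \<beta>) = T * (a * M * u) + T * (b * i) + T * \<beta>"
    by (simp add: algebra_simps)
  show ?thesis
    using 1 2 3 4 6 7 8 unfolding T_def[symmetric]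
    by (simp add: algebra_simps)
qed

lemma has_real_derivative_nonneg_imp_le:
  fixes f :: "real \<Rightarrow> real"
  assumes "a \<le> b" and f: "\<And>t. t \<in> {a..b} \<Longrightarrow> (f has_real_derivative f' t) (at t within {a..b})"
    and "\<And>t. t \<in> {a..b} \<Longrightarrow> 0 \<le> f' t"
  shows "f a \<le> f b"
proof (rule DERIV_nonneg_imp_increasing_open[OF \<open>a \<le> b\<close>])
  show "continuous_on {a..b} f" by (rule DERIV_continuous_on[OF f])
  fix t assume "a < t" "t < b"
  then show "\<exists>y. (f has_real_derivative y) (at t) \<and> 0 \<le> y"
    using assms(2,3)[of t] by (intro exI[of _ "f' t"]) (auto simp: at_within_Icc_at)
qed

text \<open>To be used with A = Q P_1 and B = Q P_0. The condition \<open>1 \<le> \<mu> * m\<close>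
  is mainly for the boundary term at 1; the last two conditions on \<open>\<mu>\<close> are those of
  \<open>carleman_pointwise\<close>.\<close>

locale carleman =
  fixes H :: "real \<Rightarrow> 'a::euclidean_space \<Rightarrow> 'a" and A B :: "'a \<Rightarrow> 'a"
    and m M L a b \<mu> :: real
  assumes linear_H: "\<zeta> \<in> {0..1} \<Longrightarrow> linear (H \<zeta>)"
    and sym_H: "\<zeta> \<in> {0..1} \<Longrightarrow> v \<bullet> H \<zeta> w = H \<zeta> v \<bullet> w"
    and H_lower: "\<zeta> \<in> {0..1} \<Longrightarrow> m * (norm v)\<^sup>2 \<le> v \<bullet> H \<zeta> v"
    and H_upper: "\<zeta> \<in> {0..1} \<Longrightarrow> norm (H \<zeta> v) \<le> M * norm v"
    and H_lipschitz: "\<zeta> \<in> {0..1} \<Longrightarrow> s \<in> {0..1} \<Longrightarrow> norm (H s v - H \<zeta> v) \<le> L * \<bar>s - \<zeta>\<bar> * norm v"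
    and A_bound: "norm (A v) \<le> a * norm v" and B_bound: "norm (B v) \<le> b * norm v"
    and linear_A: "linear A" and linear_B: "linear B"
    and m: "0 < m" and nonneg: "0 \<le> a" "0 \<le> b" "0 \<le> M" "0 \<le> L"
    and \<mu>: "1 \<le> \<mu>" "1 \<le> \<mu> * m" "L + 2 + b\<^sup>2 \<le> \<mu> * m / 2"
      "L + M\<^sup>2 + a\<^sup>2 * M\<^sup>2 / 2 + 9 + 4 * b\<^sup>2 \<le> \<mu> * m / 4"
begin

definition "p = (\<lambda>\<zeta>. exp (2 * exp (\<mu> * (1 - \<zeta>))))"
text \<open>This is - \<sigma>', half the logarithmic decay rate of \<open>p\<close>. It sets the
  scale on which X and I are weighed against x.\<close>

definition "\<rho> = (\<lambda>\<zeta>. \<mu> * exp (\<mu> * (1 - \<zeta>)))"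
definition "q = (\<lambda>\<zeta>. integral {0..\<zeta>} p - integral {0..1} p)"

text \<open>The item with content is - q \<le> p / \<rho>, which gives the terms with q the same
  weight as all others. Since (p / \<rho>)' = - 2 p + \<mu> p / \<rho> and \<rho> \<ge> \<mu>, the
  function p / \<rho> falls at least as fast as - q, whose derivative is - p, and it ends above - q
  at 1.\<close>

lemma weights:
  shows "(p has_real_derivative - 2 * \<rho> \<zeta> * p \<zeta>) (at \<zeta> within T)"
    and "(\<rho> has_real_derivative - \<mu> * \<rho> \<zeta>) (at \<zeta> within T)"
    and "\<zeta> \<in> {0..1} \<Longrightarrow> (q has_real_derivative p \<zeta>) (at \<zeta> within {0..1})"
    and "q 1 = 0"
    and "\<zeta> \<in> {0..1} \<Longrightarrow> q \<zeta> \<le> 0"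
    and "\<zeta> \<in> {0..1} \<Longrightarrow> - q \<zeta> \<le> p \<zeta> / \<rho> \<zeta>"
    and "\<zeta> \<in> {0..1} \<Longrightarrow> \<mu> \<le> \<rho> \<zeta>"
    and "0 < p \<zeta>"
proof -
  show 1: "(p has_real_derivative - 2 * \<rho> \<zeta> * p \<zeta>) (at \<zeta> within T)" for \<zeta> T
    unfolding p_def \<rho>_def by (rule derivative_eq_intros refl | simp)+
  show 2: "(\<rho> has_real_derivative - \<mu> * \<rho> \<zeta>) (at \<zeta> within T)" for \<zeta> T
    unfolding \<rho>_def by (rule derivative_eq_intros refl | simp)+
  have "continuous_on {0..1} p" unfolding p_def by (intro continuous_intros)
  then show 3: "(q has_real_derivative p \<zeta>) (at \<zeta> within {0..1})" if "\<zeta> \<in> {0..1}" for \<zeta>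
    unfolding q_def using DERIV_diff[OF integral_has_real_derivative[OF _ that] DERIV_const] by simp
  show 4: "q 1 = 0" by (simp add: q_def)
  show p: "0 < p \<zeta>" for \<zeta> by (simp add: p_def)
  show \<rho>: "\<mu> \<le> \<rho> \<zeta>" if "\<zeta> \<in> {0..1}" for \<zeta>
  proof -
    have "1 \<le> exp (\<mu> * (1 - \<zeta>))" using that \<mu>(1) by simp
    then show ?thesis using \<mu>(1) mult_left_mono[of 1 "exp (\<mu> * (1 - \<zeta>))" \<mu>] unfolding \<rho>_def by linarith
  qed
  show "q \<zeta> \<le> 0" if "\<zeta> \<in> {0..1}"
  proof -
    have "q \<zeta> \<le> q 1"
    proof (rule has_real_derivative_nonneg_imp_le[where f' = p and f = q])
      show "\<zeta> \<le> 1" using that by simp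
      fix t assume "t \<in> {\<zeta>..1}"
      then have "t \<in> {0..1}" "{\<zeta>..1} \<subseteq> {0..1}" using that by auto
      then show "(q has_real_derivative p t) (at t within {\<zeta>..1})" by (intro DERIV_subset[OF 3])
      show "0 \<le> p t" using p[of t] by simp
    qed
    then show ?thesis using 4 by simp
  qed
  show "- q \<zeta> \<le> p \<zeta> / \<rho> \<zeta>" if "\<zeta> \<in> {0..1}"
  proof -
    have pos: "0 < \<rho> t" for t using \<mu>(1) by (simp add: \<rho>_def)
    have "- (q \<zeta> + p \<zeta> / \<rho> \<zeta>) \<le> - (q 1 + p 1 / \<rho> 1)"
    proof (rule has_real_derivative_nonneg_imp_le[where f' = "\<lambda>t. p t * (1 - \<mu> / \<rho> t)" and f = "\<lambda>t. - (q t + p t / \<rho> t)"])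
      show "\<zeta> \<le> 1" using that by simp
      fix t assume t: "t \<in> {\<zeta>..1}"
      with that have t': "t \<in> {0..1}" by auto
      have "(q has_real_derivative p t) (at t within {\<zeta>..1})"
        using that by (intro DERIV_subset[OF 3[OF t']]) auto
      then show "((\<lambda>t. - (q t + p t / \<rho> t)) has_real_derivative p t * (1 - \<mu> / \<rho> t)) (at t within {\<zeta>..1})"
        by (rule DERIV_cong[OF DERIV_minus[OF DERIV_add[OF _ DERIV_divide[OF 1 2]]]])
           (use pos[of t] in \<open>auto simp: field_simps\<close>)
      show "0 \<le> p t * (1 - \<mu> / \<rho> t)"
        using \<rho>[OF t'] pos[of t] p[of t] by (simp add: field_simps)
    qed
    moreover have "0 \<le> p 1 / \<rho> 1" using pos[of 1] p[of 1] by simp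
    ultimately show ?thesis using 4 by simp
  qed
qed



text \<open>The right-hand side is the bound on \<phi>' from \<open>estimate\<close> after p (V + R)
  . X + 2 q \<xi> . (V + R) has been subtracted, with the variation of \<open>H\<close> replaced by
  \<open>L\<close>. Its first three terms are 2 p times the quadratic form of \<open>H\<close> at Y
  = \<xi> - \<rho> X, plus \<mu> \<rho> p X . H X. Everything is then measured in units of p /
  \<rho>.\<close>

lemma pointwise:
  assumes \<zeta>: "\<zeta> \<in> {0..1}" and W: "W = H \<zeta> \<xi>" and R: "R = A (W - W0) + B I - V0"
  shows "p \<zeta> / \<rho> \<zeta> * ((norm \<xi>)\<^sup>2 - (a * norm W0 + norm V0)\<^sup>2 / 2)
    \<le> 2 * p \<zeta> * (\<xi> \<bullet> W) - 4 * \<rho> \<zeta> * p \<zeta> * (W \<bullet> X) + (\<mu> * \<rho> \<zeta> + 2 * (\<rho> \<zeta>)\<^sup>2) * p \<zeta> * (X \<bullet> H \<zeta> X)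
        + q \<zeta> * L * (norm \<xi>)\<^sup>2 - \<rho> \<zeta> * p \<zeta> * L * (norm X)\<^sup>2
        + 4 * \<rho> \<zeta> * p \<zeta> * (norm I)\<^sup>2 / 2 - 2 * p \<zeta> * (W \<bullet> I)
        - p \<zeta> * (R \<bullet> X) - 2 * q \<zeta> * (\<xi> \<bullet> R)"
proof -
  define P where "P = p \<zeta>"
  define r where "r = \<rho> \<zeta>"
  define k where "k = q \<zeta>"
  define \<beta> where "\<beta> = a * norm W0 + norm V0"
  define Y where "Y = \<xi> - r *\<^sub>R X"
  have P: "0 < P" and r: "\<mu> \<le> r" and k: "k \<le> 0" "- k \<le> P / r"
    using weights(5-7)[of \<zeta>] weights(8)[of \<zeta>] \<zeta> by (auto simp: P_def r_def k_def)
  have r1: "1 \<le> r" using r \<mu>(1) by simp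
  have lin: "linear (H \<zeta>)" by (rule linear_H[OF \<zeta>])
  have WX: "W \<bullet> X = \<xi> \<bullet> H \<zeta> X" using sym_H[OF \<zeta>] W by simp
  have "Y \<bullet> H \<zeta> Y = \<xi> \<bullet> W - 2 * r * (W \<bullet> X) + r\<^sup>2 * (X \<bullet> H \<zeta> X)"
    unfolding Y_def using sym_H[OF \<zeta>, of X \<xi>]
    by (simp add: linear_diff[OF lin] linear_cmul[OF lin] inner_diff W[symmetric] WX power2_eq_square algebra_simps inner_commute)
  note Y_eq = this
  have quad: "2 * P * (\<xi> \<bullet> W) - 4 * r * P * (W \<bullet> X) + (\<mu> * r + 2 * r\<^sup>2) * P * (X \<bullet> H \<zeta> X)
    = 2 * P * (Y \<bullet> H \<zeta> Y) + \<mu> * r * P * (X \<bullet> H \<zeta> X)"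
    unfolding Y_eq by (simp add: algebra_simps)
  \<comment> \<open>Passing to the weight p / \<rho> costs the factor \<mu> / \<rho>, which is at
    most 1; this is how a coefficient proportional to \<open>\<mu>\<close> is gained.\<close>
  have n1: "P / r * (2 * \<mu> * m * (norm Y)\<^sup>2) \<le> 2 * P * (Y \<bullet> H \<zeta> Y)"
  proof -
    have "P / r * (2 * \<mu> * m * (norm Y)\<^sup>2) = 2 * P * (\<mu> / r) * (m * (norm Y)\<^sup>2)" by simp
    also have "\<dots> \<le> 2 * P * 1 * (m * (norm Y)\<^sup>2)"
      using P r r1 m by (intro mult_right_mono mult_left_mono) auto
    also have "\<dots> \<le> 2 * P * (Y \<bullet> H \<zeta> Y)" using H_lower[OF \<zeta>, of Y] P by simp
    finally show ?thesis .
  qed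
  have n2: "P / r * (\<mu> * m * (r * norm X)\<^sup>2) \<le> \<mu> * r * P * (X \<bullet> H \<zeta> X)"
  proof -
    have "P / r * (\<mu> * m * (r * norm X)\<^sup>2) = \<mu> * r * P * (m * (norm X)\<^sup>2)"
      using r1 by (simp add: power2_eq_square)
    also have "\<dots> \<le> \<mu> * r * P * (X \<bullet> H \<zeta> X)"
      using H_lower[OF \<zeta>, of X] P r1 \<mu>(1) by (intro mult_left_mono) auto
    finally show ?thesis .
  qed
  \<comment> \<open>The square controls only \<xi> - \<rho> X; together with the term in X it
    controls \<xi> itself.\<close>
  have tri: "(norm \<xi>)\<^sup>2 \<le> 2 * (norm Y)\<^sup>2 + 2 * (r * norm X)\<^sup>2"
  proof -
    have "norm \<xi> \<le> norm Y + r * norm X"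
      using norm_triangle_ineq[of Y "r *\<^sub>R X"] r1 by (simp add: Y_def)
    then have "(norm \<xi>)\<^sup>2 \<le> (norm Y + r * norm X)\<^sup>2" by (intro power_mono) auto
    also have "\<dots> \<le> 2 * (norm Y)\<^sup>2 + 2 * (r * norm X)\<^sup>2"
      using sum_squares_bound[of "norm Y" "r * norm X"] by (simp add: power2_sum)
    finally show ?thesis .
  qed
  have n12: "P / r * (\<mu> * m / 4 * (norm \<xi>)\<^sup>2 + \<mu> * m / 2 * (r * norm X)\<^sup>2)
      \<le> 2 * P * (\<xi> \<bullet> W) - 4 * r * P * (W \<bullet> X) + (\<mu> * r + 2 * r\<^sup>2) * P * (X \<bullet> H \<zeta> X)"
  proof -
    have "\<mu> * m / 4 * (norm \<xi>)\<^sup>2 \<le> \<mu> * m / 4 * (2 * (norm Y)\<^sup>2 + 2 * (r * norm X)\<^sup>2)"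
      using \<mu>(2) by (intro mult_left_mono tri) auto
    moreover have "0 \<le> \<mu> * m * (norm Y)\<^sup>2" using \<mu>(2) by simp
    ultimately have "\<mu> * m / 4 * (norm \<xi>)\<^sup>2 + \<mu> * m / 2 * (r * norm X)\<^sup>2 \<le> 2 * \<mu> * m * (norm Y)\<^sup>2 + \<mu> * m * (r * norm X)\<^sup>2"
      by (simp add: algebra_simps)
    then have "P / r * (\<mu> * m / 4 * (norm \<xi>)\<^sup>2 + \<mu> * m / 2 * (r * norm X)\<^sup>2)
        \<le> P / r * (2 * \<mu> * m * (norm Y)\<^sup>2 + \<mu> * m * (r * norm X)\<^sup>2)"
      using P r1 by (intro mult_left_mono) auto
    then show ?thesis using n1 n2 unfolding quad by (simp only: distrib_left)
  qed
  have nW: "norm W \<le> M * norm \<xi>" using H_upper[OF \<zeta>] W by simp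
  have nR: "norm R \<le> a * M * norm \<xi> + b * (r * norm I) + \<beta>"
  proof -
    have "norm R \<le> norm (A (W - W0)) + norm (B I) + norm V0"
      unfolding R using norm_triangle_ineq[of "A (W - W0)" "B I"] norm_triangle_ineq4[of "A (W - W0) + B I" V0]
      by linarith
    moreover have "norm (A (W - W0)) \<le> a * (M * norm \<xi> + norm W0)"
      using A_bound[of "W - W0"] norm_triangle_ineq4[of W W0] nW nonneg
      by (meson add_mono_thms_linordered_semiring(3) mult_left_mono order_trans)
    moreover have "norm (B I) \<le> b * (r * norm I)"
      using B_bound[of I] mult_left_mono[OF mult_right_mono[OF r1, of "norm I"], of b] nonneg by simp
    ultimately show ?thesis by (simp add: \<beta>_def algebra_simps)
  qed
  have e1: "- (P / r * (L * (norm \<xi>)\<^sup>2)) \<le> k * L * (norm \<xi>)\<^sup>2"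
  proof -
    have "(- k) * (L * (norm \<xi>)\<^sup>2) \<le> P / r * (L * (norm \<xi>)\<^sup>2)"
      using k nonneg by (intro mult_right_mono) auto
    then show ?thesis by (simp add: algebra_simps)
  qed
  have e2: "P / r * (L * (r * norm X)\<^sup>2) = r * P * L * (norm X)\<^sup>2"
    using r1 by (simp add: power2_eq_square)
  have e3: "P / r * (2 * (r * norm I)\<^sup>2) = 4 * r * P * (norm I)\<^sup>2 / 2"
    using r1 by (simp add: power2_eq_square)
  have e4: "2 * P * (W \<bullet> I) \<le> P / r * (2 * (M * norm \<xi> * (r * norm I)))"
  proof -
    have "W \<bullet> I \<le> norm W * norm I" by (rule norm_cauchy_schwarz)
    also have "\<dots> \<le> M * norm \<xi> * norm I" by (intro mult_right_mono nW) auto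
    finally have "2 * P * (W \<bullet> I) \<le> 2 * P * (M * norm \<xi> * norm I)" using P by simp
    then show ?thesis using r1 by simp
  qed
  have e5: "P * (R \<bullet> X) \<le> P / r * (r * norm X * norm R)"
    using norm_cauchy_schwarz[of R X] P r1 by (simp add: mult.commute)
  have e6: "2 * k * (\<xi> \<bullet> R) \<le> P / r * (2 * norm \<xi> * norm R)"
  proof -
    have "2 * k * (\<xi> \<bullet> R) \<le> 2 * \<bar>k\<bar> * \<bar>\<xi> \<bullet> R\<bar>"
      by (metis abs_ge_self abs_mult abs_numeral)
    also have "\<dots> \<le> 2 * (P / r) * (norm \<xi> * norm R)"
      using k Cauchy_Schwarz_ineq2[of \<xi> R] by (intro mult_mono) auto
    finally show ?thesis by (simp add: mult_ac)
  qed
  have e7: "P / r * ((r * norm X + 2 * norm \<xi>) * norm R)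
      \<le> P / r * ((r * norm X + 2 * norm \<xi>) * (a * M * norm \<xi> + b * (r * norm I) + \<beta>))"
    using P r1 by (intro mult_left_mono nR) auto
  have "P / r * ((norm \<xi>)\<^sup>2 - \<beta>\<^sup>2 / 2)
    \<le> P / r * (\<mu> * m / 4 * (norm \<xi>)\<^sup>2 + \<mu> * m / 2 * (r * norm X)\<^sup>2 - L * (norm \<xi>)\<^sup>2 - L * (r * norm X)\<^sup>2
        + 2 * (r * norm I)\<^sup>2 - 2 * (M * norm \<xi> * (r * norm I))
        - (r * norm X + 2 * norm \<xi>) * (a * M * norm \<xi> + b * (r * norm I) + \<beta>))"
    using P r1 nonneg \<mu> by (intro mult_left_mono carleman_pointwise) (auto simp: \<beta>_def)
  also have "\<dots> = P / r * (\<mu> * m / 4 * (norm \<xi>)\<^sup>2 + \<mu> * m / 2 * (r * norm X)\<^sup>2) - P / r * (L * (norm \<xi>)\<^sup>2)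
      - P / r * (L * (r * norm X)\<^sup>2)
        + P / r * (2 * (r * norm I)\<^sup>2) - P / r * (2 * (M * norm \<xi> * (r * norm I)))
        - P / r * ((r * norm X + 2 * norm \<xi>) * (a * M * norm \<xi> + b * (r * norm I) + \<beta>))"
    by (simp only: right_diff_distrib distrib_left)
  finally show ?thesis
    using n12 e1 e2 e3 e4 e5 e6 e7
    unfolding P_def[symmetric] r_def[symmetric] k_def[symmetric] \<beta>_def[symmetric]
    by (simp only: distrib_right distrib_left[of "P / r" "r * norm X * norm R"])
qed


text \<open>The multiplier identity in integrated form, as an inequality. \<xi> is merely continuous
  and \<open>H\<close> merely Lipschitz, so the derivatives of W . \<xi> and X . H X in the boundary
  function \<phi> need not exist; lower bounds on their right difference quotients take their
  place.\<close>

lemma estimate: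
  assumes V: "continuous_on {0..1} V" and \<xi>: "continuous_on {0..1} \<xi>"
    and W': "\<And>\<zeta>. \<zeta> \<in> {0..1} \<Longrightarrow> (W has_vector_derivative V \<zeta>) (at \<zeta> within {0..1})"
    and X': "\<And>\<zeta>. \<zeta> \<in> {0..1} \<Longrightarrow> (X has_vector_derivative \<xi> \<zeta>) (at \<zeta> within {0..1})"
    and I': "\<And>\<zeta>. \<zeta> \<in> {0..1} \<Longrightarrow> (I has_vector_derivative W \<zeta>) (at \<zeta> within {0..1})"
    and X0: "X 0 = 0" and I0: "I 0 = 0"
    and W: "\<And>\<zeta>. \<zeta> \<in> {0..1} \<Longrightarrow> W \<zeta> = H \<zeta> (\<xi> \<zeta>)"
  defines "R \<equiv> \<lambda>\<zeta>. A (W \<zeta> - W 0) + B (I \<zeta>) - V 0"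
  shows "integral {0..1} (\<lambda>\<zeta>. p \<zeta> * ((V \<zeta> + R \<zeta>) \<bullet> X \<zeta>) + 2 * q \<zeta> * (\<xi> \<zeta> \<bullet> (V \<zeta> + R \<zeta>))
           + p \<zeta> / \<rho> \<zeta> * ((norm (\<xi> \<zeta>))\<^sup>2 - (a * norm (W 0) + norm (V 0))\<^sup>2 / 2))
         \<le> exp 2 * (norm (W 1))\<^sup>2 - q 0 / m * (norm (W 0))\<^sup>2"
proof -
  define \<beta> where "\<beta> = a * norm (W 0) + norm (V 0)"
  define \<psi> where "\<psi> = (\<lambda>\<zeta>. p \<zeta> * ((V \<zeta> + R \<zeta>) \<bullet> X \<zeta>) + 2 * q \<zeta> * (\<xi> \<zeta> \<bullet> (V \<zeta> + R \<zeta>))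
           + p \<zeta> / \<rho> \<zeta> * ((norm (\<xi> \<zeta>))\<^sup>2 - \<beta>\<^sup>2 / 2))"
  define r where "r = (\<lambda>\<zeta>. \<rho> \<zeta> * p \<zeta>)"
  define \<phi> where "\<phi> = (\<lambda>s. p s * (W s \<bullet> X s) + q s * (W s \<bullet> \<xi> s) - r s * (X s \<bullet> H s (X s)) - p s * (I s \<bullet> I s))"
  have cont: "continuous_on {0..1} W" "continuous_on {0..1} X" "continuous_on {0..1} I"
    by (rule continuous_on_vector_derivative[OF W'] continuous_on_vector_derivative[OF X']
        continuous_on_vector_derivative[OF I']; assumption)+
  have cont_p: "continuous_on {0..1} p" "continuous_on {0..1} \<rho>" "continuous_on {0..1} q" "continuous_on {0..1} r"
    unfolding r_def by (auto intro!: continuous_intros DERIV_continuous_on[OF weights(1)]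
      DERIV_continuous_on[OF weights(2)] DERIV_continuous_on[OF weights(3)])
  have \<rho>_pos: "\<rho> \<zeta> \<noteq> 0" for \<zeta> using \<mu>(1) by (simp add: \<rho>_def)
  have r_nonneg: "0 \<le> r s" if "s \<in> {0..1}" for s
    using weights(7)[OF that] weights(8)[of s] \<mu>(1) by (simp add: r_def)
  have lin_AB: "continuous_on {0..1} (\<lambda>\<zeta>. A (f \<zeta>))" "continuous_on {0..1} (\<lambda>\<zeta>. B (f \<zeta>))"
    if "continuous_on {0..1} f" for f :: "real \<Rightarrow> 'a"
    using that linear_A linear_B by (auto intro: linear_continuous_on_compose)
  have cont_HX: "continuous_on {0..1} (\<lambda>s. H s (X s))"
    unfolding continuous_on_def
  proof
    fix z :: real assume z: "z \<in> {0..1}"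
    have "((\<lambda>s. H z (X s)) \<longlongrightarrow> H z (X z)) (at z within {0..1})"
      using linear_continuous_on_compose[OF cont(2) linear_H[OF z]] z by (auto simp: continuous_on_def)
    moreover have "((\<lambda>s. H s (X s) - H z (X s)) \<longlongrightarrow> 0) (at z within {0..1})"
    proof (rule Lim_null_comparison)
      show "\<forall>\<^sub>F s in at z within {0..1}. norm (H s (X s) - H z (X s)) \<le> L * \<bar>s - z\<bar> * norm (X s)"
        using H_lipschitz z by (auto simp: eventually_at_filter)
      have "((\<lambda>s. L * \<bar>s - z\<bar> * norm (X s)) \<longlongrightarrow> L * \<bar>z - z\<bar> * norm (X z)) (at z within {0..1})"
        using cont(2) z by (intro tendsto_intros) (auto simp: continuous_on_def)
      then show "((\<lambda>s. L * \<bar>s - z\<bar> * norm (X s)) \<longlongrightarrow> 0) (at z within {0..1})" by simp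
    qed
    ultimately show "((\<lambda>s. H s (X s)) \<longlongrightarrow> H z (X z)) (at z within {0..1})"
      using tendsto_add[of "\<lambda>s. H z (X s)" "H z (X z)" _ "\<lambda>s. H s (X s) - H z (X s)" 0] by simp
  qed
  \<comment> \<open>Formally, \<open>\<phi>'\<close> is the integrand plus \<open>2 p (\<xi> - \<rho> X) \<bullet> H (\<xi> - \<rho> X) + \<mu> \<rho> p X \<bullet> H X\<close>, up to errors
    of order \<open>L\<close>; the term \<open>- p |I|\<^sup>2\<close> of \<open>\<phi>\<close> absorbs the contribution of \<open>B\<close> (Hardy's inequality).\<close>
  have 1: "integral {0..1} \<psi> \<le> \<phi> 1 - \<phi> 0"
  proof (rule right_dini_integral_le)
    show "continuous_on {0..1} \<phi>" unfolding \<phi>_def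
      by (intro continuous_intros cont cont_p \<xi> cont_HX)
    show "continuous_on {0..1} \<psi>" unfolding \<psi>_def R_def
      by (intro continuous_intros cont cont_p \<xi> V lin_AB) (auto simp: \<rho>_pos)
    fix z :: real assume "0 \<le> z" "z < 1"
    then have z: "z \<in> {0..1}" by simp
    define F where "F = at z within {z<..1}"
    have sub: "{z<..1} \<subseteq> {0..1}" using z by auto
    have ct: "(f \<longlongrightarrow> f z) F" if "continuous_on {0..1} f" for f :: "real \<Rightarrow> 'b::metric_space"
      using that z unfolding F_def continuous_on_def by (blast intro: tendsto_within_subset[OF _ sub])
    have dv: "((\<lambda>s. (f s - f z) /\<^sub>R (s - z)) \<longlongrightarrow> d) F" if "(f has_vector_derivative d) (at z within {0..1})"
      for f :: "real \<Rightarrow> 'a" and d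
      using has_vector_derivative_within_subset[OF that sub] unfolding F_def
      by (simp add: has_vector_derivative_iff_tendsto)
    \<comment> \<open>The part of \<phi> that is differentiable at z once the operator in X . H X is
      frozen there. The change of \<open>H\<close> is charged to the last summand of
      \<open>g\<close>.\<close>
    define \<phi>1 where "\<phi>1 = (\<lambda>s. p s * (W s \<bullet> X s) - r s * (X s \<bullet> H z (X s)) - p s * (I s \<bullet> I s))"
    define d1 where "d1 = - 2 * \<rho> z * p z * (W z \<bullet> X z) + p z * (V z \<bullet> X z + W z \<bullet> \<xi> z)
        - ((- \<mu> * \<rho> z * p z - 2 * \<rho> z * \<rho> z * p z) * (X z \<bullet> H z (X z)) + r z * (\<xi> z \<bullet> H z (X z) + X z \<bullet> H z (\<xi> z)))
        - (- 2 * \<rho> z * p z * (I z \<bullet> I z) + p z * (2 * (W z \<bullet> I z)))"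
    have HX': "((\<lambda>s. H z (X s)) has_vector_derivative H z (\<xi> z)) (at z within {0..1})"
      using bounded_linear.has_vector_derivative[OF _ X'[OF z]] linear_H[OF z] linear_conv_bounded_linear by blast
    have \<phi>1': "(\<phi>1 has_real_derivative d1) (at z within {0..1})"
    proof -
      have inner': "((\<lambda>s. f s \<bullet> h s) has_real_derivative f z \<bullet> h' + f' \<bullet> h z) (at z within {0..1})"
        if "(f has_vector_derivative f') (at z within {0..1})" "(h has_vector_derivative h') (at z within {0..1})"
        for f h :: "real \<Rightarrow> 'a" and f' h'
        unfolding has_real_derivative_iff_has_vector_derivative
        by (rule bounded_bilinear.has_vector_derivative[OF bounded_bilinear_inner that])
      have r': "(r has_real_derivative - \<mu> * \<rho> z * p z + - 2 * \<rho> z * p z * \<rho> z) (at z within {0..1})"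
        unfolding r_def by (rule DERIV_mult[OF weights(2) weights(1)])
      have "- 2 * \<rho> z * p z * (W z \<bullet> X z) + (W z \<bullet> \<xi> z + V z \<bullet> X z) * p z
          - ((- \<mu> * \<rho> z * p z + - 2 * \<rho> z * p z * \<rho> z) * (X z \<bullet> H z (X z)) + (X z \<bullet> H z (\<xi> z) + \<xi> z \<bullet> H z (X z)) * r z)
          - (- 2 * \<rho> z * p z * (I z \<bullet> I z) + (I z \<bullet> W z + W z \<bullet> I z) * p z) = d1"
        unfolding d1_def inner_commute[of "I z" "W z"] by (simp add: algebra_simps)
      from DERIV_cong[OF DERIV_diff[OF DERIV_diff[OF DERIV_mult[OF weights(1) inner'[OF W'[OF z] X'[OF z]]]
          DERIV_mult[OF r' inner'[OF X'[OF z] HX']]] DERIV_mult[OF weights(1) inner'[OF I'[OF z] I'[OF z]]]] this]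
      show ?thesis unfolding \<phi>1_def .
    qed
    \<comment> \<open>A lower bound for the difference quotient of \<phi>: the summands with
      \<open>L\<close> stand for the increments of \<open>H\<close>, and their signs are right
      because q \<le> 0 and r \<ge> 0.\<close>
    define g where "g = (\<lambda>s. (\<phi>1 s - \<phi>1 z) / (s - z) + (q s - q z) / (s - z) * (W s \<bullet> \<xi> s)
        + q z * (((W s - W z) /\<^sub>R (s - z)) \<bullet> (\<xi> s + \<xi> z)) + q z * (L * norm (\<xi> z) * norm (\<xi> s))
        - r s * (L * (norm (X s))\<^sup>2))"
    define D where "D = d1 + p z * (W z \<bullet> \<xi> z) + q z * (V z \<bullet> (\<xi> z + \<xi> z)) + q z * (L * norm (\<xi> z) * norm (\<xi> z))
        - r z * (L * (norm (X z))\<^sup>2)"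
    have Rz: "R z = A (W z - W 0) + B (I z) - V 0" by (simp add: R_def)
    have "(g \<longlongrightarrow> D) F"
    proof -
      have "((\<lambda>s. (\<phi>1 s - \<phi>1 z) / (s - z)) \<longlongrightarrow> d1) F" "((\<lambda>s. (q s - q z) / (s - z)) \<longlongrightarrow> p z) F"
        using DERIV_subset[OF \<phi>1' sub] DERIV_subset[OF weights(3)[OF z] sub]
        by (auto simp: has_field_derivative_iff F_def)
      then show ?thesis unfolding g_def D_def
        by (intro tendsto_intros dv W' z ct cont cont_p \<xi>)
    qed
    moreover have "\<psi> z \<le> D"
    proof -
      have inner_eqs: "(V z + R z) \<bullet> X z = V z \<bullet> X z + R z \<bullet> X z" "\<xi> z \<bullet> (V z + R z) = V z \<bullet> \<xi> z + \<xi> z \<bullet> R z"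
        "W z \<bullet> \<xi> z = \<xi> z \<bullet> W z" "\<xi> z \<bullet> H z (X z) = W z \<bullet> X z" "X z \<bullet> H z (\<xi> z) = W z \<bullet> X z"
        "V z \<bullet> (\<xi> z + \<xi> z) = 2 * (V z \<bullet> \<xi> z)" "I z \<bullet> I z = (norm (I z))\<^sup>2"
        "q z * (L * norm (\<xi> z) * norm (\<xi> z)) = q z * L * (norm (\<xi> z))\<^sup>2"
        using sym_H[OF z, of "X z" "\<xi> z"] sym_H[OF z, of "\<xi> z" "X z"] W[OF z]
        by (simp_all only: inner_add_left inner_add_right inner_commute power2_norm_eq_inner)
           (simp_all add: power2_eq_square flip: power2_norm_eq_inner)
      have "k * (vx + rx) + 2 * qz * (v\<xi> + \<xi>R) + f \<le>
            - 2 * t * k * wx + k * (vx + \<xi>w) - ((- \<mu> * t * k - 2 * t * t * k) * xhx + t * k * (wx + wx))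
            - (- 2 * t * k * ii + k * (2 * wi)) + k * \<xi>w + qz * (2 * v\<xi>) + qz * L * n - t * k * (L * xx)"
        if "f \<le> 2 * k * \<xi>w - 4 * t * k * wx + (\<mu> * t + 2 * t\<^sup>2) * k * xhx + qz * L * n - t * k * L * xx
              + 4 * t * k * ii / 2 - 2 * k * wi - k * rx - 2 * qz * \<xi>R"
        for k vx rx qz v\<xi> \<xi>R f t wx \<xi>w xhx ii wi n xx :: real
        using that by (simp add: algebra_simps power2_eq_square)
      from this[OF pointwise[OF z W[OF z] Rz, where X = "X z"], of "V z \<bullet> X z" "V z \<bullet> \<xi> z"]
      show ?thesis
        unfolding \<psi>_def D_def d1_def \<beta>_def r_def inner_eqs .
    qed
    moreover have "(s - z) * g s \<le> \<phi> s - \<phi> z" if s: "s \<in> {z<..1}" for s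
    proof -
      have s01: "s \<in> {0..1}" and sz: "z < s" using s z by auto
      have eq: "(s - z) * g s = \<phi>1 s - \<phi>1 z + (q s - q z) * (W s \<bullet> \<xi> s) + q z * ((W s - W z) \<bullet> (\<xi> s + \<xi> z))
         + q z * (L * (s - z) * norm (\<xi> z) * norm (\<xi> s)) - r s * (L * (s - z) * (norm (X s))\<^sup>2)"
      proof -
        have "d * (u / d + v / d * c + k * ((w /\<^sub>R d) \<bullet> e) + k * (x * y) - r * (x * n))
            = u + v * c + k * (w \<bullet> e) + k * (x * d * y) - r * (x * d * n)"
          if "d \<noteq> 0" for d u v c k x y r n :: real and w e :: 'a
          using that by (simp add: distrib_left right_diff_distrib mult_ac)
        from this[of "s - z" "\<phi>1 s - \<phi>1 z" "q s - q z" "W s \<bullet> \<xi> s" "q z" "W s - W z" "\<xi> s + \<xi> z" L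
            "norm (\<xi> z) * norm (\<xi> s)" "r s" "(norm (X s))\<^sup>2"]
        show ?thesis using sz unfolding g_def by (simp only: mult.assoc)
      qed
      \<comment> \<open>Symmetry of \<open>H\<close> expresses the increment of W . \<xi> through
        increments of W and \<open>H\<close> only, so that \<xi> need not be differentiated.\<close>
      have Wid: "W s \<bullet> \<xi> s - W z \<bullet> \<xi> z = (W s - W z) \<bullet> (\<xi> s + \<xi> z) - \<xi> z \<bullet> (H s (\<xi> s) - H z (\<xi> s))"
      proof -
        have "W s \<bullet> \<xi> z = \<xi> z \<bullet> H s (\<xi> s)" "W z \<bullet> \<xi> s = \<xi> z \<bullet> H z (\<xi> s)"
          using sym_H[OF z, of "\<xi> z" "\<xi> s"] W[OF z] W[OF s01] by (simp_all only: inner_commute)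
        then show ?thesis
          by (simp add: inner_diff_left inner_diff_right inner_add_right)
      qed
      have "- (\<xi> z \<bullet> (H s (\<xi> s) - H z (\<xi> s))) \<le> norm (\<xi> z) * norm (H s (\<xi> s) - H z (\<xi> s))"
        using Cauchy_Schwarz_ineq2[of "\<xi> z" "H s (\<xi> s) - H z (\<xi> s)"] by linarith
      also have "\<dots> \<le> norm (\<xi> z) * (L * \<bar>s - z\<bar> * norm (\<xi> s))"
        by (intro mult_left_mono H_lipschitz z s01) auto
      finally have "- (\<xi> z \<bullet> (H s (\<xi> s) - H z (\<xi> s))) \<le> L * (s - z) * norm (\<xi> z) * norm (\<xi> s)"
        using sz by (simp add: mult_ac)
      then have 1: "q z * (L * (s - z) * norm (\<xi> z) * norm (\<xi> s)) \<le> q z * - (\<xi> z \<bullet> (H s (\<xi> s) - H z (\<xi> s)))"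
        using weights(5)[OF z] by (intro mult_left_mono_neg)
      have "X s \<bullet> (H s (X s) - H z (X s)) \<le> norm (X s) * norm (H s (X s) - H z (X s))"
        by (rule norm_cauchy_schwarz)
      also have "\<dots> \<le> norm (X s) * (L * \<bar>s - z\<bar> * norm (X s))"
        by (intro mult_left_mono H_lipschitz z s01) auto
      finally have "X s \<bullet> (H s (X s) - H z (X s)) \<le> L * (s - z) * (norm (X s))\<^sup>2"
        using sz by (simp add: power2_eq_square mult_ac)
      then have 2: "r s * (X s \<bullet> (H s (X s) - H z (X s))) \<le> r s * (L * (s - z) * (norm (X s))\<^sup>2)"
        using r_nonneg[OF s01] by (intro mult_left_mono)
      have "\<phi> s - \<phi> z = \<phi>1 s - \<phi>1 z + (q s - q z) * (W s \<bullet> \<xi> s) + q z * (W s \<bullet> \<xi> s - W z \<bullet> \<xi> z)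
          - r s * (X s \<bullet> (H s (X s) - H z (X s)))"
        unfolding \<phi>_def \<phi>1_def by (simp add: inner_diff algebra_simps)
      then show ?thesis unfolding eq Wid using 1 2 by (simp only: right_diff_distrib)
    qed
    ultimately show "\<exists>g D. (g \<longlongrightarrow> D) (at z within {z<..1}) \<and> \<psi> z \<le> D \<and>
                 (\<forall>s\<in>{z<..1}. (s - z) * g s \<le> \<phi> s - \<phi> z)"
      unfolding F_def by blast
  qed
  \<comment> \<open>X(1) is not a trace and has to disappear: the term - r X . H X absorbs half of
    |X(1)|^2 because \<mu> m \<ge> 1. The term with \<xi>(1) vanishes with q.\<close>
  have 2: "\<phi> 1 \<le> exp 2 * (norm (W 1))\<^sup>2"
  proof -
    have p1: "p 1 = exp 2" and r1: "r 1 = \<mu> * exp 2" by (auto simp: p_def r_def \<rho>_def)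
    have "\<mu> * (X 1 \<bullet> H 1 (X 1)) \<ge> \<mu> * (m * (norm (X 1))\<^sup>2)"
      using H_lower[of 1 "X 1"] \<mu>(1) by (intro mult_left_mono) auto
    moreover have "\<mu> * m * (norm (X 1))\<^sup>2 \<ge> 1 * (norm (X 1))\<^sup>2"
      using \<mu>(2) by (intro mult_right_mono) auto
    moreover have "W 1 \<bullet> X 1 \<le> (norm (W 1))\<^sup>2 / 2 + (norm (X 1))\<^sup>2 / 2"
      using norm_cauchy_schwarz[of "W 1" "X 1"] sum_squares_bound[of "norm (W 1)" "norm (X 1)"] by linarith
    moreover have "0 \<le> (norm (W 1))\<^sup>2" "0 \<le> (norm (X 1))\<^sup>2" "0 \<le> I 1 \<bullet> I 1" by auto
    ultimately have "(W 1 \<bullet> X 1) - \<mu> * (X 1 \<bullet> H 1 (X 1)) - (I 1 \<bullet> I 1) \<le> (norm (W 1))\<^sup>2"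
      by (simp only: mult.assoc)
    then have "exp 2 * ((W 1 \<bullet> X 1) - \<mu> * (X 1 \<bullet> H 1 (X 1)) - (I 1 \<bullet> I 1)) \<le> exp 2 * (norm (W 1))\<^sup>2"
      by simp
    then show ?thesis by (simp add: \<phi>_def p1 r1 weights(4) algebra_simps)
  qed
  \<comment> \<open>At 0 only q W . \<xi> survives, since X and I start at 0, and coercivity of
    \<open>H\<close> bounds |\<xi>(0)| by |W(0)| / m.\<close>
  have 3: "- \<phi> 0 \<le> - q 0 / m * (norm (W 0))\<^sup>2"
  proof -
    have "m * (norm (\<xi> 0))\<^sup>2 \<le> norm (\<xi> 0) * norm (W 0)"
      using H_lower[of 0 "\<xi> 0"] norm_cauchy_schwarz[of "\<xi> 0" "W 0"] W[of 0] by simp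
    then have "m * norm (\<xi> 0) \<le> norm (W 0)"
      by (cases "\<xi> 0 = 0") (auto simp: power2_eq_square mult.left_commute)
    then have "norm (\<xi> 0) \<le> norm (W 0) / m" using m by (simp add: field_simps)
    then have "W 0 \<bullet> \<xi> 0 \<le> norm (W 0) * (norm (W 0) / m)"
      using norm_cauchy_schwarz[of "W 0" "\<xi> 0"] by (meson mult_left_mono norm_ge_zero order_trans)
    then have "- q 0 * (W 0 \<bullet> \<xi> 0) \<le> - q 0 * (norm (W 0) * (norm (W 0) / m))"
      using weights(5)[of 0] by (intro mult_left_mono) auto
    then show ?thesis by (simp add: \<phi>_def X0 I0 power2_eq_square linear_0[OF linear_H])
  qed
  show ?thesis using 1 2 3 unfolding \<psi>_def \<beta>_def by simp
qed

end

section \<open>Sobolev functions on the unit interval\<close>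

lemma absolutely_integrable_scaleR_continuous_on:
  fixes g :: "real \<Rightarrow> 'a::euclidean_space" and b :: "real \<Rightarrow> real"
  assumes "g absolutely_integrable_on {u..v}" "continuous_on {u..v} b"
  shows "(\<lambda>t. b t *\<^sub>R g t) absolutely_integrable_on {u..v}"
proof (rule absolutely_integrable_bounded_measurable_product[where h = "(*\<^sub>R)" and f = b, OF _ _ _ _ assms(1)])
  show "bilinear ((*\<^sub>R) :: real \<Rightarrow> 'a \<Rightarrow> 'a)"
    using bounded_bilinear_scaleR bilinear_conv_bounded_bilinear by blast
  show "b \<in> borel_measurable (lebesgue_on {u..v})"
    by (intro continuous_imp_measurable_on_sets_lebesgue assms) auto
  show "bounded (b ` {u..v})"
    by (intro compact_imp_bounded compact_continuous_image assms) auto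
qed auto

text \<open>The difference of the two sides, with \<open>1\<close> replaced by \<open>t\<close>, is \<open>o(|t - s|)\<close> between \<open>s\<close> and \<open>t\<close>, hence
  constant in \<open>t\<close>; this avoids Fubini's theorem.\<close>

lemma integral_primitive_by_parts:
  fixes g :: "real \<Rightarrow> real"
  assumes g: "g absolutely_integrable_on {0..1}"
    and b: "\<And>t. t \<in> {0..1} \<Longrightarrow> (b has_real_derivative b' t) (at t within {0..1})"
    and b': "continuous_on {0..1} b'"
  shows "integral {0..1} (\<lambda>t. b' t * integral {0..t} g)
       = b 1 * integral {0..1} g - integral {0..1} (\<lambda>t. b t * g t)"
proof -
  define P where "P t = integral {0..t} g" for t
  define N where "N t = integral {0..t} (\<lambda>s. \<bar>g s\<bar>)" for t
  have gi: "g integrable_on {0..1}" "(\<lambda>s. \<bar>g s\<bar>) integrable_on {0..1}"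
    using g by (auto simp: absolutely_integrable_on_def)
  have cP: "continuous_on {0..1} P" and cN: "continuous_on {0..1} N"
    unfolding P_def N_def by (intro indefinite_integral_continuous_1 gi)+
  have cb: "continuous_on {0..1} b" by (rule DERIV_continuous_on[OF b])
  have bg: "(\<lambda>t. b t * g t) integrable_on {0..1}"
    using absolutely_integrable_scaleR_continuous_on[OF g cb] by (simp add: absolutely_integrable_on_def)
  have bP: "(\<lambda>t. b' t * P t) integrable_on {0..1}"
    by (intro integrable_continuous_real continuous_intros b' cP)
  obtain K where K: "\<And>t. t \<in> {0..1} \<Longrightarrow> \<bar>b' t\<bar> \<le> K"
    using compact_imp_bounded[OF compact_continuous_image[OF b' compact_Icc]]
    unfolding bounded_iff by (metis imageI real_norm_def)
  have K0: "0 \<le> K" using K[of 0] by auto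
  have lip: "\<bar>b s - b t\<bar> \<le> K * \<bar>s - t\<bar>" if "s \<in> {0..1}" "t \<in> {0..1}" for s t
    using field_differentiable_bound[of "{0..1}" b b' K s t] b K that by simp
  define \<Theta> where "\<Theta> t = b t * P t - integral {0..t} (\<lambda>s. b s * g s) - integral {0..t} (\<lambda>s. b' s * P s)" for t
  \<comment> \<open>On [s,t] the function \<open>b\<close> moves by at most K (t - s) and
    \<open>P\<close> by at most the increment of \<open>N\<close>. The product of the two is o(t -
    s), because \<open>N\<close> is continuous.\<close>
  have incr: "\<bar>\<Theta> t - \<Theta> s\<bar> \<le> 2 * K * (t - s) * (N t - N s)" if st: "0 \<le> s" "s \<le> t" "t \<le> 1" for s t
  proof -
    have sub: "{s..t} \<subseteq> {0..1}" using st by auto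
    have split: "integral {0..t} f - integral {0..s} f = integral {s..t} f" if "f integrable_on {0..1}" for f :: "real \<Rightarrow> real"
      using Henstock_Kurzweil_Integration.integral_combine[OF st(1,2), of f] integrable_on_subinterval[OF that, of 0 t] st by simp
    note ig = integrable_on_subinterval[OF _ sub]
    have NN: "N t - N s = integral {s..t} (\<lambda>r. \<bar>g r\<bar>)" and PP: "P t - P s = integral {s..t} g"
      unfolding N_def P_def by (intro split gi)+
    have "\<bar>integral {s..t} (\<lambda>r. (b t - b r) * g r)\<bar> \<le> integral {s..t} (\<lambda>r. K * (t - s) * \<bar>g r\<bar>)"
    proof -
      have "norm (integral {s..t} (\<lambda>r. (b t - b r) * g r)) \<le> integral {s..t} (\<lambda>r. K * (t - s) * \<bar>g r\<bar>)"
      proof (rule integral_norm_bound_integral)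
        have "(\<lambda>r. b t * g r - b r * g r) integrable_on {s..t}"
          by (intro integrable_diff integrable_on_mult_right ig gi bg)
        then show "(\<lambda>r. (b t - b r) * g r) integrable_on {s..t}" by (simp add: left_diff_distrib)
        show "(\<lambda>r. K * (t - s) * \<bar>g r\<bar>) integrable_on {s..t}"
          by (intro integrable_on_mult_right ig gi)
        fix r assume r: "r \<in> {s..t}"
        have "\<bar>b t - b r\<bar> \<le> K * (t - s)"
          using lip[of t r] r st mult_left_mono[of "t - r" "t - s" K] K0 by simp
        then show "norm ((b t - b r) * g r) \<le> K * (t - s) * \<bar>g r\<bar>"
          by (simp add: abs_mult mult_right_mono)
      qed
      then show ?thesis by simp
    qed
    then have 1: "\<bar>integral {s..t} (\<lambda>r. (b t - b r) * g r)\<bar> \<le> K * (t - s) * (N t - N s)"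
      unfolding NN by simp
    have 2: "integral {s..t} (\<lambda>r. (b t - b r) * g r) = b t * (P t - P s) - integral {s..t} (\<lambda>r. b r * g r)"
      unfolding PP left_diff_distrib
      by (subst Henstock_Kurzweil_Integration.integral_diff) (auto intro!: integrable_on_mult_right ig gi bg)
    have P_incr: "\<bar>P r - P s\<bar> \<le> N t - N s" if r: "r \<in> {s..t}" for r
    proof -
      have "P r - P s = integral {s..r} g"
        unfolding P_def
        using Henstock_Kurzweil_Integration.integral_combine[of 0 s r g] integrable_on_subinterval[OF gi(1), of 0 r] st r by simp
      also have "\<bar>\<dots>\<bar> \<le> integral {s..r} (\<lambda>r. \<bar>g r\<bar>)"
      proof -
        have "{s..r} \<subseteq> {0..1}" using r st by auto
        then show ?thesis
          using integral_norm_bound_integral[of g "{s..r}" "\<lambda>r. \<bar>g r\<bar>"]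
            integrable_on_subinterval[OF gi(1)] integrable_on_subinterval[OF gi(2)] by simp
      qed
      also have "\<dots> \<le> integral {s..t} (\<lambda>r. \<bar>g r\<bar>)"
        using r st by (intro integral_subset_le) (auto intro: integrable_on_subinterval[OF gi(2)])
      finally show ?thesis by (simp add: NN)
    qed
    have bPs: "(\<lambda>r. b' r * P s) integrable_on {s..t}"
      by (intro integrable_on_mult_left ig integrable_continuous_real b')
    have b'i: "integral {s..t} b' = b t - b s"
      by (intro integral_unique fundamental_theorem_of_calculus)
         (use st sub in \<open>auto intro!: has_vector_derivative_within_subset[OF b[unfolded has_real_derivative_iff_has_vector_derivative]]\<close>)
    have *: "norm (integral {s..t} (\<lambda>r. b' r * P r - b' r * P s)) \<le> integral {s..t} (\<lambda>r. K * (N t - N s))"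
    proof (rule integral_norm_bound_integral)
      show "(\<lambda>r. b' r * P r - b' r * P s) integrable_on {s..t}"
        by (intro integrable_diff ig bP bPs)
      fix r assume r: "r \<in> {s..t}"
      then show "norm (b' r * P r - b' r * P s) \<le> K * (N t - N s)"
        using mult_mono[OF K[of r] P_incr[OF r]] K0 sub
        by (simp add: right_diff_distrib[symmetric] abs_mult subset_iff)
    qed auto
    have 3: "\<bar>integral {s..t} (\<lambda>r. b' r * P r) - (b t - b s) * P s\<bar> \<le> K * (t - s) * (N t - N s)"
    proof -
      have "integral {s..t} (\<lambda>r. b' r * P r - b' r * P s) = integral {s..t} (\<lambda>r. b' r * P r) - (b t - b s) * P s"
        unfolding Henstock_Kurzweil_Integration.integral_diff[OF ig[OF bP] bPs] by (simp add: b'i)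
      with * show ?thesis using st by (simp add: mult_ac)
    qed
    have "\<Theta> t - \<Theta> s = b t * P t - b s * P s - integral {s..t} (\<lambda>r. b r * g r) - integral {s..t} (\<lambda>r. b' r * P r)"
      unfolding \<Theta>_def using split[OF bg] split[OF bP] by simp
    also have "\<dots> = integral {s..t} (\<lambda>r. (b t - b r) * g r) - (integral {s..t} (\<lambda>r. b' r * P r) - (b t - b s) * P s)"
      unfolding 2 by (simp add: algebra_simps)
    finally show ?thesis using 1 3 by linarith
  qed
  have incr': "\<bar>\<Theta> t - \<Theta> s\<bar> \<le> 2 * K * \<bar>t - s\<bar> * \<bar>N t - N s\<bar>" if "s \<in> {0..1}" "t \<in> {0..1}" for s t
  proof -
    have *: "\<bar>\<Theta> v - \<Theta> u\<bar> \<le> 2 * K * \<bar>v - u\<bar> * \<bar>N v - N u\<bar>" if "0 \<le> u" "u \<le> v" "v \<le> 1" for u v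
    proof -
      have "2 * K * (v - u) * (N v - N u) \<le> 2 * K * (v - u) * \<bar>N v - N u\<bar>"
        using K0 that by (intro mult_left_mono) auto
      then show ?thesis using incr[OF that] that by simp
    qed
    show ?thesis
    proof (cases "s \<le> t")
      case True
      then show ?thesis using *[of s t] that by simp
    next
      case False
      then show ?thesis
        using *[of t s] that
        unfolding abs_minus_commute[of "\<Theta> t"] abs_minus_commute[of t] abs_minus_commute[of "N t"] by simp
    qed
  qed
  have "(\<Theta> has_field_derivative 0) (at t within {0..1})" if t: "t \<in> {0..1}" for t
    unfolding has_field_derivative_iff
  proof (rule Lim_null_comparison)
    show "\<forall>\<^sub>F s in at t within {0..1}. norm ((\<Theta> s - \<Theta> t) / (s - t)) \<le> 2 * K * \<bar>N s - N t\<bar>"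
      unfolding eventually_at_filter
    proof (intro always_eventually allI impI)
      fix s assume "s \<noteq> t" "s \<in> {0..1}"
      then show "norm ((\<Theta> s - \<Theta> t) / (s - t)) \<le> 2 * K * \<bar>N s - N t\<bar>"
        using incr'[OF t, of s] by (simp add: pos_divide_le_eq mult.assoc mult.commute[of "\<bar>s - t\<bar>"])
    qed
    have "((\<lambda>s. 2 * K * \<bar>N s - N t\<bar>) \<longlongrightarrow> 2 * K * \<bar>N t - N t\<bar>) (at t within {0..1})"
      using cN t by (intro tendsto_intros) (auto simp: continuous_on_def)
    then show "((\<lambda>s. 2 * K * \<bar>N s - N t\<bar>) \<longlongrightarrow> 0) (at t within {0..1})" by simp
  qed
  then have "\<exists>c. \<forall>t\<in>{0..1}. \<Theta> t = c"
    by (rule has_field_derivative_zero_constant[OF convex_real_interval(5)])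
  then have "\<Theta> 1 = \<Theta> 0" by force
  then show ?thesis by (simp add: \<Theta>_def P_def)
qed

text \<open>The signed measure with density \<open>h\<close> vanishes on intervals, hence by
  induction on all Borel sets, which forces the density to vanish almost everywhere.\<close>

lemma primitive_zero_imp_AE_zero:
  fixes h :: "real \<Rightarrow> real"
  assumes h: "h absolutely_integrable_on {0..1}"
    and zero: "\<And>t. t \<in> {0..1} \<Longrightarrow> integral {0..t} h = 0"
  shows "AE t in unit_leb. h t = 0"
proof -
  define h0 where "h0 = (\<lambda>t. indicator {0..1} t *\<^sub>R h t)"
  have h0: "integrable lebesgue h0" using h unfolding h0_def set_integrable_def .
  \<comment> \<open>A Borel representative is taken because the induction over Borel sets and the
    density criterion are applied to \<open>lborel\<close> rather than to its completion.\<close>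
  obtain h' where h': "h' \<in> borel \<rightarrow>\<^sub>M borel" "AE t in lborel. h0 t = h' t"
    using completion_ex_borel_measurable_real[OF borel_measurable_integrable[OF h0]] by auto
  have int': "integrable lborel h'"
  proof -
    have "integrable lebesgue h'"
      by (rule Bochner_Integration.integrable_cong_AE_imp[OF h0])
         (use h' in \<open>auto intro: measurable_completion AE_completion simp: eq_commute\<close>)
    then show ?thesis using h' by (simp add: integrable_completion)
  qed
  have Icc: "integral {a..b} h0 = 0" if "a \<le> b" for a b
  proof -
    have "integral {a..b} h0 = integral {max 0 a..min 1 b} h"
    proof -
      have "integral {a..b} h0 = integral ({0..1} \<inter> {a..b}) h"
        unfolding integral_restrict_Int[symmetric] by (intro integral_cong) (auto simp: h0_def)
      also have "{0..1} \<inter> {a..b} = {max 0 a..min 1 b}" by auto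
      finally show ?thesis .
    qed
    also have "\<dots> = 0"
    proof (cases "max 0 a \<le> min 1 b")
      case True
      have "h integrable_on {0..min 1 b}"
        using h True by (auto intro!: integrable_on_subinterval[of h "{0..1}"] simp: absolutely_integrable_on_def)
      then have "integral {0..max 0 a} h + integral {max 0 a..min 1 b} h = integral {0..min 1 b} h"
        using True by (intro Henstock_Kurzweil_Integration.integral_combine) auto
      then show ?thesis using zero[of "max 0 a"] zero[of "min 1 b"] True by auto
    qed (simp add: not_le)
    finally show ?thesis .
  qed
  have h'_zero: "set_lebesgue_integral lborel A h' = 0" if "A \<in> sets borel" for A
    using that
  proof (induction A rule: borel_set_induct)
    case empty
    then show ?case by (simp add: set_lebesgue_integral_def)
  next
    case (interval a b)
    have "set_integrable lborel {a..b} h'"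
      unfolding set_integrable_def by (intro integrable_mult_indicator int') auto
    then have "set_lebesgue_integral lborel {a..b} h' = integral {a..b} h'"
      by (rule set_borel_integral_eq_integral)
    also have "\<dots> = integral {a..b} h0"
    proof -
      have "(h' has_integral x) {a..b} = (h0 has_integral x) {a..b}" for x
        using h'(2) by (intro has_integral_AE) auto
      then show ?thesis by (simp add: integral_def integrable_on_def)
    qed
    finally show ?case using Icc[OF interval] by simp
  next
    case (compl A)
    have int_A: "integrable lborel (\<lambda>t. indicat_real B t *\<^sub>R h' t)" if "B \<in> sets borel" for B
      using that by (intro integrable_mult_indicator int') auto
    have whole: "integral\<^sup>L lborel h' = 0"
    proof -
      have "integral\<^sup>L lborel h' = integral UNIV h'" by (simp add: integral_lborel[OF int'])
      also have "\<dots> = integral UNIV h0"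
      proof -
        have "(h' has_integral x) UNIV = (h0 has_integral x) UNIV" for x
          using h'(2) by (intro has_integral_AE) auto
        then show ?thesis by (simp add: integral_def integrable_on_def)
      qed
      also have "\<dots> = integral {0..1} h0"
        by (subst integral_restrict_UNIV[symmetric]) (auto simp: h0_def indicator_def intro!: integral_cong)
      finally show ?thesis using Icc[of 0 1] by simp
    qed
    have "(\<lambda>t. indicat_real A t *\<^sub>R h' t + indicat_real (- A) t *\<^sub>R h' t) = h'"
      by (auto simp: indicator_def fun_eq_iff)
    then have "integral\<^sup>L lborel h' = (LINT t|lborel. indicat_real A t *\<^sub>R h' t) + (LINT t|lborel. indicat_real (- A) t *\<^sub>R h' t)"
      using Bochner_Integration.integral_add[OF int_A[of A] int_A[of "- A"]] compl(1) by auto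
    then show ?case using compl whole by (simp add: set_lebesgue_integral_def)
  next
    case (union f)
    have "set_integrable lborel (\<Union>i. f i) h'"
      unfolding set_integrable_def using union by (intro integrable_mult_indicator int') auto
    then show ?case
      using union by (subst lebesgue_integral_countable_add) (auto simp: disjoint_family_on_def)
  qed
  have "AE t in lborel. h' t = 0"
    by (rule sigma_finite_measure.density_zero[OF lborel.sigma_finite_measure_axioms int']) (use h'_zero in auto)
  with h'(2) have "AE t in lborel. h0 t = 0" by eventually_elim simp
  then have "AE t in lebesgue. h0 t = 0" by (rule AE_completion)
  then have "AE t in lebesgue. t \<in> {0<..<1} \<longrightarrow> h t = 0"
    by eventually_elim (auto simp: h0_def)
  then show ?thesis by (subst AE_restrict_space_iff) auto
qed

section \<open>Weak derivatives and continuous representatives\<close>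

lemma integrable_unit_leb_iff:
  fixes f :: "real \<Rightarrow> 'a::euclidean_space"
  shows "integrable unit_leb f \<longleftrightarrow> f absolutely_integrable_on {0..1}"
  unfolding absolutely_integrable_on_Icc_iff_Ioo
  by (simp add: integrable_restrict_space set_integrable_def)

lemma LINT_unit_leb_eq_integral:
  fixes f :: "real \<Rightarrow> 'a::euclidean_space"
  assumes "integrable unit_leb f"
  shows "(LINT s|unit_leb. f s) = integral {0..1} f"
  using lebesgue_integral_eq_integral[OF assms] by (simp add: integral_open_interval_real)

text \<open>Vanishing mean is exactly what makes the primitive return to zero on the right of the
  support of \<theta>.\<close>

lemma test_fun_primitive:
  assumes \<theta>: "continuous_on UNIV \<theta>" and supp: "\<And>s. s \<notin> {a..b} \<Longrightarrow> \<theta> s = 0" and ab: "0 < a" "b < 1"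
    and mean: "integral {0..1} \<theta> = 0"
  shows "test_fun (\<lambda>s. integral {0..s} \<theta>) \<theta>"
proof -
  have c: "continuous_on S \<theta>" for S using \<theta> continuous_on_subset by blast
  have int: "\<theta> integrable_on {u..v}" for u v by (rule integrable_continuous_real[OF c])
  have zr: "integral {u..v} \<theta> = 0" if "\<And>x. x \<in> {u..v} \<Longrightarrow> \<theta> x = 0" for u v
    using integral_cong[of "{u..v}" \<theta> "\<lambda>_. 0", OF that] by simp
  have z1: "integral {0..s} \<theta> = 0" if "s < a" for s
    using supp that by (intro zr) simp
  have z2: "integral {0..s} \<theta> = 0" if "b < s" for s
  proof (cases "s \<le> a")
    case True
    then show ?thesis using supp that by (intro zr) simp
  next
    case False
    then have s0: "0 \<le> s" using ab by simp
    have tail: "integral {u..v} \<theta> = 0" if "b < u" for u v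
      using supp that by (intro zr) simp
    show ?thesis
    proof (cases "s \<le> 1")
      case True
      then show ?thesis
        using Henstock_Kurzweil_Integration.integral_combine[OF s0 True int] tail[OF \<open>b < s\<close>, of 1] mean by simp
    next
      case False
      then show ?thesis
        using Henstock_Kurzweil_Integration.integral_combine[of 0 1 s, OF _ _ int] tail[of 1 s] ab mean by simp
    qed
  qed
  have deriv: "((\<lambda>s. integral {0..s} \<theta>) has_real_derivative \<theta> s) (at s)" for s
  proof -
    \<comment> \<open>The fundamental theorem of calculus is available for 0 < s < 1 only; in the
      two outer regions, which overlap this one, the primitive is locally zero.\<close>
    consider "s < a" | "0 < s" "s < 1" | "b < s" using ab by linarith
    then show ?thesis
    proof cases
      case 1
      have "((\<lambda>s. integral {0..s} \<theta>) has_real_derivative 0) (at s)"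
        by (rule has_field_derivative_transform_within_open[where S = "{..<a}" and f = "\<lambda>_. 0"])
           (simp_all add: 1 z1)
      then show ?thesis using supp[of s] 1 by simp
    next
      case 2
      then show ?thesis
        using integral_has_real_derivative[OF c, of s 0 1] by (simp add: at_within_Icc_at)
    next
      case 3
      have "((\<lambda>s. integral {0..s} \<theta>) has_real_derivative 0) (at s)"
        by (rule has_field_derivative_transform_within_open[where S = "{b<..}" and f = "\<lambda>_. 0"])
           (simp_all add: 3 z2)
      then show ?thesis using supp[of s] 3 by simp
    qed
  qed
  have outside: "integral {0..s} \<theta> = 0" if "s \<notin> {a..b}" for s
  proof -
    from that have "s < a \<or> b < s" unfolding atLeastAtMost_iff by linarith
    then show ?thesis by (elim disjE) (rule z1 z2, assumption)+
  qed
  have "0 < a \<and> b < 1 \<and> (\<forall>s. s \<notin> {a..b} \<longrightarrow> integral {0..s} \<theta> = 0)"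
    using ab outside by blast
  then have ex: "\<exists>a b. 0 < a \<and> b < 1 \<and> (\<forall>s. s \<notin> {a..b} \<longrightarrow> integral {0..s} \<theta> = 0)"
    by (rule_tac exI, rule_tac exI)
  have "\<forall>s. ((\<lambda>s. integral {0..s} \<theta>) has_real_derivative \<theta> s) (at s)"
    by (rule allI) (rule deriv)
  from conjI[OF this conjI[OF \<theta> ex]] show ?thesis
    by (rule iffD2[OF test_fun_def])
qed

text \<open>Trapezoidal bumps of height 1 that increase to the indicator of \<open>(u, v)\<close>.\<close>

definition bump :: "real \<Rightarrow> real \<Rightarrow> nat \<Rightarrow> real \<Rightarrow> real" where
  "bump u v n s = min 1 (real n * max 0 (min (s - u) (v - s)))"

lemma bump_bounds: "0 \<le> bump u v n s" "bump u v n s \<le> 1"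
  by (auto simp: bump_def)

lemma continuous_on_bump: "continuous_on S (bump u v n)"
  unfolding bump_def[abs_def] by (intro continuous_intros)

lemma bump_outside: "s \<notin> {u<..<v} \<Longrightarrow> bump u v n s = 0"
  by (auto simp: bump_def)

lemma bump_tendsto: "(\<lambda>n. bump u v n s) \<longlonglongrightarrow> indicator {u<..<v} s"
proof (cases "s \<in> {u<..<v}")
  case True
  define e where "e = min (s - u) (v - s)"
  have e: "0 < e" using True by (auto simp: e_def)
  obtain N where N: "1 / e < real N" using reals_Archimedean2 by blast
  have "bump u v n s = 1" if "N \<le> n" for n
  proof -
    have "1 \<le> real N * e" using N e by (simp add: field_simps)
    also have "\<dots> \<le> real n * e" using that e by simp
    finally show ?thesis using e by (simp add: bump_def e_def)
  qed
  then show ?thesis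
    using True by (intro tendsto_eventually) (auto simp: eventually_sequentially)
qed (simp add: bump_outside)

text \<open>The du Bois-Reymond lemma. A bump becomes the derivative of a test function once a
  multiple of the fixed bump \<eta> has removed its mean. With \<open>c\<close> the \<eta>-average
  of \<open>h\<close>, the function h - c therefore annihilates every bump; by dominated convergence
  its integral over every inner interval vanishes.\<close>

lemma orthogonal_to_test_fun_imp_constant:
  fixes h :: "real \<Rightarrow> real"
  assumes h: "h absolutely_integrable_on {0..1}"
    and orth: "\<And>\<phi> \<phi>'. test_fun \<phi> \<phi>' \<Longrightarrow> integral {0..1} (\<lambda>s. \<phi>' s * h s) = 0"
  obtains c where "AE s in unit_leb. h s = c"
proof -
  define \<eta> where "\<eta> = bump (1/4) (3/4) 4"
  have int: "(\<lambda>s. \<theta> s * f s) integrable_on {0..1}"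
    if "continuous_on {0..1} \<theta>" "f absolutely_integrable_on {0..1}" for \<theta> f :: "real \<Rightarrow> real"
    using absolutely_integrable_scaleR_continuous_on[OF that(2,1)] by (simp add: absolutely_integrable_on_def)
  have \<eta>: "continuous_on S \<eta>" for S unfolding \<eta>_def by (rule continuous_on_bump)
  have \<eta>_int: "\<eta> integrable_on {0..1}" by (rule integrable_continuous_real[OF \<eta>])
  have pos: "0 < integral {0..1} \<eta>"
  proof -
    have "0 \<le> integral {0..1} \<eta>"
      by (intro integral_nonneg \<eta>_int) (auto simp: \<eta>_def bump_bounds)
    moreover have "integral {0..1} \<eta> \<noteq> 0"
    proof
      assume "integral {0..1} \<eta> = 0"
      then have "\<forall>s\<in>cbox 0 (1::real). \<eta> s = 0"
        using integral_eq_0_iff[of 0 1 \<eta>] \<eta>[of "cbox 0 1"] bump_bounds(1)[of "1/4" "3/4" 4] by (simp add: \<eta>_def)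
      then have "\<eta> (1/2) = 0" by simp
      then show False by (simp add: \<eta>_def bump_def)
    qed
    ultimately show ?thesis by simp
  qed
  define c where "c = integral {0..1} (\<lambda>s. \<eta> s * h s) / integral {0..1} \<eta>"
  define k where "k = (\<lambda>s. h s - c)"
  have k: "k absolutely_integrable_on {0..1}" unfolding k_def by (intro set_integral_diff(1) h) auto
  have bump_k: "integral {0..1} (\<lambda>s. bump u v n s * k s) = 0" if uv: "0 < u" "u < v" "v < 1" for u v n
  proof -
    define r where "r = integral {0..1} (bump u v n) / integral {0..1} \<eta>"
    define \<theta> where "\<theta> = (\<lambda>s. bump u v n s - r * \<eta> s)"
    have cb: "continuous_on S (bump u v n)" for S by (rule continuous_on_bump)
    have ib: "bump u v n integrable_on {0..1}" by (rule integrable_continuous_real[OF cb])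
    have "test_fun (\<lambda>s. integral {0..s} \<theta>) \<theta>"
    proof (rule test_fun_primitive)
      show "continuous_on UNIV \<theta>" unfolding \<theta>_def by (intro continuous_intros cb \<eta>)
      show "\<theta> s = 0" if "s \<notin> {min u (1/4)..max v (3/4)}" for s
      proof -
        have "bump u v n s = 0" "\<eta> s = 0"
          using that unfolding \<eta>_def by (auto intro!: bump_outside)
        then show ?thesis by (simp add: \<theta>_def)
      qed
      show "integral {0..1} \<theta> = 0"
        unfolding \<theta>_def Henstock_Kurzweil_Integration.integral_diff[OF ib integrable_on_mult_right[OF \<eta>_int]]
        using pos by (simp add: r_def)
    qed (use uv in auto)
    then have "integral {0..1} (\<lambda>s. \<theta> s * h s) = 0" by (rule orth)
    moreover have "(\<lambda>s. \<theta> s * h s) = (\<lambda>s. bump u v n s * h s - r * (\<eta> s * h s))"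
      by (simp add: \<theta>_def algebra_simps fun_eq_iff)
    ultimately have "integral {0..1} (\<lambda>s. bump u v n s * h s) = r * integral {0..1} (\<lambda>s. \<eta> s * h s)"
      using Henstock_Kurzweil_Integration.integral_diff[OF int[OF cb h] integrable_on_mult_right[OF int[OF \<eta> h]], of r]
      by simp
    also have "\<dots> = c * integral {0..1} (bump u v n)" by (simp add: r_def c_def)
    finally show ?thesis
      unfolding k_def right_diff_distrib
        Henstock_Kurzweil_Integration.integral_diff[OF int[OF cb h] integrable_on_mult_left[OF ib]]
      by simp
  qed
  define P where "P t = integral {0..t} k" for t
  have ki: "k integrable_on {0..1}" "(\<lambda>s. \<bar>k s\<bar>) integrable_on {0..1}"
    using k by (auto simp: absolutely_integrable_on_def)
  have cP: "continuous_on {0..1} P" unfolding P_def by (rule indefinite_integral_continuous_1[OF ki(1)])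
  have P_const: "P v = P u" if uv: "0 < u" "u < v" "v < 1" for u v
  proof -
    have "(\<lambda>n. integral {0..1} (\<lambda>s. bump u v n s * k s)) \<longlonglongrightarrow> integral {0..1} (\<lambda>s. indicator {u<..<v} s * k s)"
    proof (rule dominated_convergence(2)[OF int[OF continuous_on_bump k] ki(2)])
      show "norm (bump u v n s * k s) \<le> \<bar>k s\<bar>" for n s
        using bump_bounds[of u v n s] by (simp add: abs_mult mult_left_le_one_le)
      show "(\<lambda>n. bump u v n s * k s) \<longlonglongrightarrow> indicator {u<..<v} s * k s" for s
        by (intro tendsto_intros bump_tendsto)
    qed
    then have "integral {0..1} (\<lambda>s. indicator {u<..<v} s * k s) = 0"
      unfolding bump_k[OF uv] by (simp add: LIMSEQ_const_iff)
    moreover have "(\<lambda>s. indicator {u<..<v} s * k s) = (\<lambda>s. if s \<in> {u<..<v} then k s else 0)"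
      by (auto simp: indicator_def)
    ultimately have "integral ({u<..<v} \<inter> {0..1}) k = 0"
      by (simp only: integral_restrict_Int)
    moreover have "{u<..<v} \<inter> {0..1} = {u<..<v}" using uv by auto
    ultimately have "integral {u..v} k = 0" by (simp add: integral_open_interval_real)
    moreover have "integral {0..u} k + integral {u..v} k = integral {0..v} k"
      using uv by (intro Henstock_Kurzweil_Integration.integral_combine integrable_on_subinterval[OF ki(1)]) auto
    ultimately show ?thesis by (simp add: P_def)
  qed
  have P_half: "P t = P (1/2)" if "t \<in> {0<..<1}" for t
  proof (cases t "1/2 :: real" rule: linorder_cases)
    case less
    then show ?thesis using P_const[of t "1/2"] that by simp
  next
    case greater
    then show ?thesis using P_const[of "1/2" t] that by simp
  next
    case equal
    then show ?thesis by (simp only:)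
  qed
  have P_eq: "P t = P (1/2)" if "t \<in> {0..1}" for t
    by (rule continuous_constant_on_closure[of "{0<..<1}" P "P (1/2)" t]) (simp add: cP, erule P_half, use that in simp)
  have "P t = 0" if "t \<in> {0..1}" for t
  proof -
    have "P t = P 0" by (rule trans[OF P_eq[OF that] P_eq[of 0, symmetric]]) simp
    then show ?thesis by (simp add: P_def)
  qed
  then have "AE t in unit_leb. k t = 0"
    unfolding P_def by (rule primitive_zero_imp_AE_zero[OF k])
  then have "AE s in unit_leb. h s = c" unfolding k_def by simp
  then show ?thesis by (rule that)
qed

lemma AE_unit_leb_Ioo: "AE s in unit_leb. s \<in> {0<..<1}"
  by (rule AE_I2) simp

text \<open>Integration by parts shows that the primitive of \<open>g\<close> has the same weak
  derivative as \<open>f\<close>, so the difference of the two is orthogonal to all derivatives of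
  test functions and hence constant.\<close>

lemma weak_deriv_real_imp_primitive:
  fixes f g :: "real \<Rightarrow> real"
  assumes fg: "weak_deriv f g"
  obtains c where "AE s in unit_leb. f s = c + integral {0..s} g"
proof -
  have f: "f absolutely_integrable_on {0..1}" and g: "g absolutely_integrable_on {0..1}"
    using fg by (auto simp: weak_deriv_def integrable_unit_leb_iff)
  define P where "P = (\<lambda>t. integral {0..t} g)"
  have cP: "continuous_on {0..1} P"
    unfolding P_def using g by (intro indefinite_integral_continuous_1) (auto simp: absolutely_integrable_on_def)
  then have P: "P absolutely_integrable_on {0..1}" by (rule absolutely_integrable_continuous_real)
  have "(\<lambda>s. f s - P s) absolutely_integrable_on {0..1}" by (intro set_integral_diff f P)
  moreover have "integral {0..1} (\<lambda>s. \<phi>' s * (f s - P s)) = 0" if \<phi>: "test_fun \<phi> \<phi>'" for \<phi> \<phi>'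
  proof -
    have \<phi>': "continuous_on {0..1} \<phi>'" and d: "(\<phi> has_real_derivative \<phi>' s) (at s within T)" for s T
      using \<phi> by (auto simp: test_fun_def intro: continuous_on_subset has_field_derivative_at_within)
    have c\<phi>: "continuous_on {0..1} \<phi>" by (rule DERIV_continuous_on[OF d])
    have "\<phi> 1 = 0" using \<phi> unfolding test_fun_def by force
    then have by_parts: "integral {0..1} (\<lambda>t. \<phi>' t * P t) = - integral {0..1} (\<lambda>t. \<phi> t * g t)"
      using integral_primitive_by_parts[OF g d \<phi>'] by (simp add: P_def)
    have ai: "(\<lambda>s. \<phi>' s *\<^sub>R f s) absolutely_integrable_on {0..1}" "(\<lambda>s. \<phi> s *\<^sub>R g s) absolutely_integrable_on {0..1}"
      "(\<lambda>s. \<phi>' s *\<^sub>R P s) absolutely_integrable_on {0..1}"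
      by (intro absolutely_integrable_scaleR_continuous_on f g P \<phi>' c\<phi>)+
    then have "integral {0..1} (\<lambda>s. \<phi>' s *\<^sub>R f s) = - integral {0..1} (\<lambda>s. \<phi> s *\<^sub>R g s)"
      using fg \<phi> by (simp add: weak_deriv_def LINT_unit_leb_eq_integral[symmetric] integrable_unit_leb_iff)
    then show ?thesis
      using ai by_parts unfolding right_diff_distrib
      by (subst Henstock_Kurzweil_Integration.integral_diff) (auto simp: absolutely_integrable_on_def)
  qed
  ultimately obtain c where "AE s in unit_leb. f s - P s = c"
    by (rule orthogonal_to_test_fun_imp_constant)
  then have "AE s in unit_leb. f s = c + integral {0..s} g"
    by (rule eventually_mono) (simp add: P_def)
  then show ?thesis by (rule that)
qed

lemma weak_deriv_inner:
  assumes "weak_deriv f g"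
  shows "weak_deriv (\<lambda>s. f s \<bullet> b) (\<lambda>s. g s \<bullet> b)"
proof -
  have f: "integrable unit_leb f" and g: "integrable unit_leb g"
    using assms by (auto simp: weak_deriv_def)
  have "(LINT s|unit_leb. \<phi>' s *\<^sub>R (f s \<bullet> b)) = - (LINT s|unit_leb. \<phi> s *\<^sub>R (g s \<bullet> b))" if \<phi>: "test_fun \<phi> \<phi>'" for \<phi> \<phi>'
  proof -
    have \<phi>': "continuous_on {0..1} \<phi>'" and d: "(\<phi> has_real_derivative \<phi>' s) (at s within T)" for s T
      using \<phi> by (auto simp: test_fun_def intro: continuous_on_subset has_field_derivative_at_within)
    have c\<phi>: "continuous_on {0..1} \<phi>" by (rule DERIV_continuous_on[OF d])
    have i: "integrable unit_leb (\<lambda>s. \<phi>' s *\<^sub>R f s)" "integrable unit_leb (\<lambda>s. \<phi> s *\<^sub>R g s)"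
      using f g \<phi>' c\<phi> by (auto simp: integrable_unit_leb_iff intro: absolutely_integrable_scaleR_continuous_on)
    have "(LINT s|unit_leb. \<phi>' s *\<^sub>R (f s \<bullet> b)) = (LINT s|unit_leb. \<phi>' s *\<^sub>R f s) \<bullet> b"
      unfolding integral_inner_left[OF i(1), symmetric] by simp
    also have "\<dots> = - ((LINT s|unit_leb. \<phi> s *\<^sub>R g s) \<bullet> b)"
      using assms \<phi> by (simp add: weak_deriv_def)
    also have "(LINT s|unit_leb. \<phi> s *\<^sub>R g s) \<bullet> b = (LINT s|unit_leb. \<phi> s *\<^sub>R (g s \<bullet> b))"
      unfolding integral_inner_left[OF i(2), symmetric] by simp
    finally show ?thesis .
  qed
  then show ?thesis using f g by (simp add: weak_deriv_def)
qed

lemma weak_deriv_imp_primitive: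
  fixes f g :: "real \<Rightarrow> 'a::euclidean_space"
  assumes fg: "weak_deriv f g"
  obtains c where "AE s in unit_leb. f s = c + integral {0..s} g"
proof -
  have gi: "g integrable_on {0..1}"
    using fg by (auto simp: weak_deriv_def integrable_unit_leb_iff absolutely_integrable_on_def)
  have "\<exists>c. AE s in unit_leb. f s \<bullet> b = c + integral {0..s} (\<lambda>s. g s \<bullet> b)" for b
    using weak_deriv_real_imp_primitive[OF weak_deriv_inner[OF fg]] by blast
  then obtain c where c: "AE s in unit_leb. f s \<bullet> b = c b + integral {0..s} (\<lambda>s. g s \<bullet> b)" for b
    by metis
  have "AE s in unit_leb. \<forall>b\<in>Basis. f s \<bullet> b = c b + integral {0..s} (\<lambda>s. g s \<bullet> b)"
    by (intro AE_finite_allI c) auto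
  then have "AE s in unit_leb. f s = (\<Sum>b\<in>Basis. c b *\<^sub>R b) + integral {0..s} g"
    using AE_unit_leb_Ioo
  proof eventually_elim
    fix s :: real assume s: "\<forall>b\<in>Basis. f s \<bullet> b = c b + integral {0..s} (\<lambda>s. g s \<bullet> b)" "s \<in> {0<..<1}"
    have "g integrable_on {0..s}" using s by (intro integrable_on_subinterval[OF gi]) auto
    then have "integral {0..s} (\<lambda>s. g s \<bullet> b) = integral {0..s} g \<bullet> b" if "b \<in> Basis" for b
      by (rule integral_component_eq)
    then show "f s = (\<Sum>b\<in>Basis. c b *\<^sub>R b) + integral {0..s} g"
      using s by (intro euclidean_eqI[where 'a='a]) (simp add: inner_add_left)
  qed
  then show ?thesis by (rule that)
qed

text \<open>The set of agreement is closed and of full measure in the open interval, so it contains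
  that interval; the endpoints follow by continuity.\<close>

lemma continuous_AE_eq_imp_eq:
  fixes v w :: "real \<Rightarrow> 'a::real_normed_vector"
  assumes v: "continuous_on {0..1} v" and w: "continuous_on {0..1} w"
    and ae: "AE s in unit_leb. v s = w s" and t: "t \<in> {0..1}"
  shows "v t = w t"
proof -
  define d where "d = (\<lambda>s. v s - w s)"
  have d: "continuous_on {0..1} d" unfolding d_def by (rule continuous_on_diff[OF v w])
  define Z where "Z = {0..1} \<inter> d -` {0}"
  have "closed Z" unfolding Z_def by (rule continuous_closed_preimage[OF d]) auto
  moreover have "AE s \<in> {0<..<1} in lebesgue. s \<in> Z"
    using ae by (subst (asm) AE_restrict_space_iff) (auto simp: Z_def d_def elim: eventually_mono)
  ultimately have "s \<in> Z" if "s \<in> {0<..<1}" for s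
    using that by (rule mem_closed_if_AE_lebesgue_open[OF open_greaterThanLessThan])
  then have "d s = 0" if "s \<in> {0<..<1}" for s using that unfolding Z_def by blast
  then have "d t = 0"
    using continuous_constant_on_closure[of "{0<..<1}" d 0 t] d t by simp
  then show ?thesis by (simp add: d_def)
qed

text \<open>\<open>crep\<close> is a choice, so nothing can be said of it before some continuous
  representative is exhibited; the primitive of \<open>g\<close> is one, and uniqueness identifies
  the two on [0,1].\<close>

lemma crep_weak_deriv:
  fixes f g :: "real \<Rightarrow> 'a::euclidean_space"
  assumes fg: "weak_deriv f g"
  shows "continuous_on {0..1} (crep f)" and "AE s in unit_leb. crep f s = f s"
    and "t \<in> {0..1} \<Longrightarrow> crep f t = crep f 0 + integral {0..t} g"
proof -
  have gi: "g integrable_on {0..1}"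
    using fg by (auto simp: weak_deriv_def integrable_unit_leb_iff absolutely_integrable_on_def)
  obtain c where c: "AE s in unit_leb. f s = c + integral {0..s} g"
    using weak_deriv_imp_primitive[OF fg] .
  define w where "w = (\<lambda>s. c + integral {0..s} g)"
  have w: "continuous_on {0..1} w"
    unfolding w_def by (intro continuous_intros indefinite_integral_continuous_1 gi)
  have "AE s in unit_leb. w s = f s" using c by (rule eventually_mono) (simp add: w_def)
  with w have "\<exists>w. continuous_on {0..1} w \<and> (AE s in unit_leb. w s = f s)" by blast
  from someI_ex[OF this] show 1: "continuous_on {0..1} (crep f)" and 2: "AE s in unit_leb. crep f s = f s"
    by (simp_all add: crep_def)
  have "AE s in unit_leb. crep f s = w s"
    using 2 \<open>AE s in unit_leb. w s = f s\<close> by eventually_elim simp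
  then have eq: "crep f s = w s" if "s \<in> {0..1}" for s
    by (rule continuous_AE_eq_imp_eq[OF 1 w _ that])
  show "crep f t = crep f 0 + integral {0..t} g" if "t \<in> {0..1}"
    using eq[OF that] eq[of 0] by (simp add: w_def)
qed

lemma W1inf_continuous_imp_Lipschitz:
  fixes f :: "real \<Rightarrow> 'a::euclidean_space"
  assumes f: "f \<in> W1inf" and cont: "continuous_on {0..1} f"
  obtains L where "0 \<le> L" "\<And>s t. s \<in> {0..1} \<Longrightarrow> t \<in> {0..1} \<Longrightarrow> norm (f s - f t) \<le> L * \<bar>s - t\<bar>"
proof -
  obtain g c where fg: "weak_deriv f g" and c: "AE s in unit_leb. norm (g s) \<le> c"
    using f by (auto simp: W1inf_def Linf_unit_def)
  have gi: "g integrable_on {0..1}" and ga: "g absolutely_integrable_on {0..1}"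
    using fg by (auto simp: weak_deriv_def integrable_unit_leb_iff absolutely_integrable_on_def)
  have eq: "f t = crep f t" if "t \<in> {0..1}" for t
    using crep_weak_deriv(2)[OF fg] by (intro continuous_AE_eq_imp_eq[OF cont crep_weak_deriv(1)[OF fg] _ that])
      (auto elim: eventually_mono)
  \<comment> \<open>The truncation alters \<open>g\<close> on a null set and makes the essential
    bound hold at every point, as the norm estimate for the integral requires. The absolute value
    keeps the bound valid for the value 0.\<close>
  define g' where "g' s = (if norm (g s) \<le> \<bar>c\<bar> then g s else 0)" for s
  have "AE s in lebesgue. s \<in> {0<..<1} \<longrightarrow> norm (g s) \<le> c"
    using c by (subst (asm) AE_restrict_space_iff) auto
  then obtain N where N: "negligible N" "\<And>s. s \<in> {0<..<1} - N \<Longrightarrow> norm (g s) \<le> c"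
    unfolding eventually_ae_filter_negligible by auto
  have N': "negligible (N \<union> {0,1})" using N by (intro negligible_Un) auto
  have bound: "norm (f t - f s) \<le> \<bar>c\<bar> * (t - s)" if st: "0 \<le> s" "s \<le> t" "t \<le> 1" for s t
  proof -
    have g_st: "g integrable_on {s..t}" using st by (intro integrable_on_subinterval[OF gi]) auto
    have eq_g': "g' r = g r" if "r \<in> {s..t} - (N \<union> {0,1})" for r
      using N(2)[of r] that st by (auto simp: g'_def)
    have g': "g' integrable_on {s..t}"
      using integrable_spike[OF g_st N'] eq_g' by blast
    have "f t - f s = integral {s..t} g"
      using eq[of s] eq[of t] crep_weak_deriv(3)[OF fg, of s] crep_weak_deriv(3)[OF fg, of t] st
        Henstock_Kurzweil_Integration.integral_combine[of 0 s t g] integrable_on_subinterval[OF gi, of 0 t]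
      by (simp add: algebra_simps)
    also have "\<dots> = integral {s..t} g'"
      using integral_spike[OF N', of "{s..t}" g' g] eq_g' by simp
    also have "norm \<dots> \<le> integral {s..t} (\<lambda>_. \<bar>c\<bar>)"
      by (intro integral_norm_bound_integral g') (auto simp: g'_def)
    finally show ?thesis using st by (simp add: mult.commute)
  qed
  have "norm (f s - f t) \<le> \<bar>c\<bar> * \<bar>s - t\<bar>" if "s \<in> {0..1}" "t \<in> {0..1}" for s t
    using bound[of s t] bound[of t s] that by (cases "s \<le> t") (auto simp: norm_minus_commute)
  then show ?thesis by (intro that[of "\<bar>c\<bar>"]) auto
qed

section \<open>The multiplier estimate with constant coefficients\<close>

context carleman
begin

text \<open>In \<open>estimate\<close> the quotient p / \<rho> is replaced by a positive lower bound
  in front of |\<xi>|^2 and by an upper bound in front of the boundary data, so that the weights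
  survive only in \<open>p\<close> and \<open>q\<close> on the left and in constants on the
  right.\<close>

lemma multiplier_estimate:
  assumes V: "continuous_on {0..1} V" and \<xi>: "continuous_on {0..1} \<xi>"
    and W': "\<And>\<zeta>. \<zeta> \<in> {0..1} \<Longrightarrow> (W has_vector_derivative V \<zeta>) (at \<zeta> within {0..1})"
    and X': "\<And>\<zeta>. \<zeta> \<in> {0..1} \<Longrightarrow> (X has_vector_derivative \<xi> \<zeta>) (at \<zeta> within {0..1})"
    and I': "\<And>\<zeta>. \<zeta> \<in> {0..1} \<Longrightarrow> (I has_vector_derivative W \<zeta>) (at \<zeta> within {0..1})"
    and X0: "X 0 = 0" and I0: "I 0 = 0"
    and W: "\<And>\<zeta>. \<zeta> \<in> {0..1} \<Longrightarrow> W \<zeta> = H \<zeta> (\<xi> \<zeta>)"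
  defines "U \<equiv> \<lambda>\<zeta>. V \<zeta> - V 0 + A (W \<zeta> - W 0) + B (I \<zeta>)"
  shows "integral {0..1} (\<lambda>\<zeta>. p \<zeta> * (U \<zeta> \<bullet> X \<zeta>) + 2 * q \<zeta> * (\<xi> \<zeta> \<bullet> U \<zeta>))
         \<le> - (exp 2 / (\<mu> * exp \<mu>)) * integral {0..1} (\<lambda>\<zeta>. (norm (\<xi> \<zeta>))\<^sup>2)
           + (exp (2 * exp \<mu>) * (a\<^sup>2 + 1) + exp 2 - q 0 / m)
             * ((norm (W 0))\<^sup>2 + (norm (V 0))\<^sup>2 + (norm (W 1))\<^sup>2)"
proof -
  define \<beta> where "\<beta> = a * norm (W 0) + norm (V 0)"
  define \<kappa> where "\<kappa> = exp 2 / (\<mu> * exp \<mu>)"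
  have U: "U \<zeta> = V \<zeta> + (A (W \<zeta> - W 0) + B (I \<zeta>) - V 0)" for \<zeta> by (simp add: U_def)
  have cont: "continuous_on {0..1} W" "continuous_on {0..1} X" "continuous_on {0..1} I"
    by (rule continuous_on_vector_derivative[OF W'] continuous_on_vector_derivative[OF X']
        continuous_on_vector_derivative[OF I']; assumption)+
  have cont_p: "continuous_on {0..1} p" "continuous_on {0..1} \<rho>" "continuous_on {0..1} q"
    by (auto intro!: DERIV_continuous_on[OF weights(1)] DERIV_continuous_on[OF weights(2)] DERIV_continuous_on[OF weights(3)])
  have lin_AB: "continuous_on {0..1} (\<lambda>\<zeta>. A (f \<zeta>))" "continuous_on {0..1} (\<lambda>\<zeta>. B (f \<zeta>))"
    if "continuous_on {0..1} f" for f :: "real \<Rightarrow> 'a"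
    using that linear_A linear_B by (auto intro: linear_continuous_on_compose)
  have cont_U: "continuous_on {0..1} U"
    unfolding U_def by (intro continuous_intros V cont lin_AB)
  have \<rho>_ne: "\<rho> \<zeta> \<noteq> 0" for \<zeta> using \<mu>(1) by (simp add: \<rho>_def)
  define f where "f = (\<lambda>\<zeta>. p \<zeta> * (U \<zeta> \<bullet> X \<zeta>) + 2 * q \<zeta> * (\<xi> \<zeta> \<bullet> U \<zeta>))"
  define g where "g = (\<lambda>\<zeta>. \<kappa> * (norm (\<xi> \<zeta>))\<^sup>2 - exp (2 * exp \<mu>) * (\<beta>\<^sup>2 / 2))"
  have fi: "f integrable_on {0..1}" unfolding f_def
    by (intro integrable_continuous_real continuous_intros cont cont_p cont_U \<xi>)
  have gi: "g integrable_on {0..1}" unfolding g_def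
    by (intro integrable_continuous_real continuous_intros \<xi>)
  have ni: "(\<lambda>\<zeta>. (norm (\<xi> \<zeta>))\<^sup>2) integrable_on {0..1}"
    by (intro integrable_continuous_real continuous_intros \<xi>)
  have "integral {0..1} f + integral {0..1} g = integral {0..1} (\<lambda>\<zeta>. f \<zeta> + g \<zeta>)"
    by (rule Henstock_Kurzweil_Integration.integral_add[OF fi gi, symmetric])
  also have "\<dots> \<le> integral {0..1} (\<lambda>\<zeta>. f \<zeta> + p \<zeta> / \<rho> \<zeta> * ((norm (\<xi> \<zeta>))\<^sup>2 - \<beta>\<^sup>2 / 2))"
  proof (rule integral_le)
    show "(\<lambda>\<zeta>. f \<zeta> + g \<zeta>) integrable_on {0..1}" by (intro integrable_add fi gi)
    show "(\<lambda>\<zeta>. f \<zeta> + p \<zeta> / \<rho> \<zeta> * ((norm (\<xi> \<zeta>))\<^sup>2 - \<beta>\<^sup>2 / 2)) integrable_on {0..1}"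
      by (intro integrable_add fi integrable_continuous_real continuous_intros cont_p \<xi> ballI \<rho>_ne)
    fix \<zeta> :: real assume \<zeta>: "\<zeta> \<in> {0..1}"
    have e: "1 \<le> exp (\<mu> * (1 - \<zeta>))" "exp (\<mu> * (1 - \<zeta>)) \<le> exp \<mu>"
      using \<zeta> \<mu>(1) by (auto simp: mult_le_cancel_left2)
    have p: "exp 2 \<le> p \<zeta>" "p \<zeta> \<le> exp (2 * exp \<mu>)" using e by (auto simp: p_def)
    have r: "\<rho> \<zeta> \<le> \<mu> * exp \<mu>" "1 \<le> \<rho> \<zeta>"
    proof -
      show "\<rho> \<zeta> \<le> \<mu> * exp \<mu>" using e(2) \<mu>(1) by (simp add: \<rho>_def)
      show "1 \<le> \<rho> \<zeta>" using \<mu>(1) weights(7)[OF \<zeta>] by linarith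
    qed
    have p0: "0 \<le> p \<zeta>" using weights(8)[of \<zeta>] by simp
    have "\<kappa> \<le> p \<zeta> / \<rho> \<zeta>" unfolding \<kappa>_def using p r p0 by (intro frac_le) auto
    moreover have "p \<zeta> / \<rho> \<zeta> \<le> exp (2 * exp \<mu>) / 1" using p r p0 by (intro frac_le) auto
    ultimately have "\<kappa> * (norm (\<xi> \<zeta>))\<^sup>2 \<le> p \<zeta> / \<rho> \<zeta> * (norm (\<xi> \<zeta>))\<^sup>2"
      "p \<zeta> / \<rho> \<zeta> * (\<beta>\<^sup>2 / 2) \<le> exp (2 * exp \<mu>) * (\<beta>\<^sup>2 / 2)"
      by (intro mult_right_mono; simp)+
    then show "f \<zeta> + g \<zeta> \<le> f \<zeta> + p \<zeta> / \<rho> \<zeta> * ((norm (\<xi> \<zeta>))\<^sup>2 - \<beta>\<^sup>2 / 2)"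
      unfolding g_def right_diff_distrib by linarith
  qed
  also have "\<dots> \<le> exp 2 * (norm (W 1))\<^sup>2 - q 0 / m * (norm (W 0))\<^sup>2"
    using estimate[OF V \<xi> W' X' I' X0 I0 W] unfolding f_def U \<beta>_def .
  finally have 1: "integral {0..1} f + integral {0..1} g \<le> exp 2 * (norm (W 1))\<^sup>2 - q 0 / m * (norm (W 0))\<^sup>2" .
  have 2: "integral {0..1} g = \<kappa> * integral {0..1} (\<lambda>\<zeta>. (norm (\<xi> \<zeta>))\<^sup>2) - exp (2 * exp \<mu>) * (\<beta>\<^sup>2 / 2)"
    unfolding g_def
    by (subst Henstock_Kurzweil_Integration.integral_diff[OF integrable_on_mult_right[OF ni]]) auto
  have "\<beta>\<^sup>2 \<le> 2 * (a * norm (W 0))\<^sup>2 + 2 * (norm (V 0))\<^sup>2"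
    using sum_squares_bound[of "a * norm (W 0)" "norm (V 0)"] by (simp add: \<beta>_def power2_sum)
  then have "\<beta>\<^sup>2 / 2 \<le> a\<^sup>2 * (norm (W 0))\<^sup>2 + (norm (V 0))\<^sup>2" by (simp add: power_mult_distrib)
  also have "\<dots> \<le> (a\<^sup>2 + 1) * ((norm (W 0))\<^sup>2 + (norm (V 0))\<^sup>2 + (norm (W 1))\<^sup>2)"
    using zero_le_power2[of "norm (W 0)"] zero_le_power2[of "norm (W 1)"] zero_le_power2[of "norm (V 0)"]
      mult_nonneg_nonneg[OF zero_le_power2[of a] zero_le_power2[of "norm (W 1)"]]
      mult_nonneg_nonneg[OF zero_le_power2[of a] zero_le_power2[of "norm (V 0)"]]
    unfolding distrib_left distrib_right by linarith
  finally have 3: "exp (2 * exp \<mu>) * (\<beta>\<^sup>2 / 2)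
      \<le> exp (2 * exp \<mu>) * ((a\<^sup>2 + 1) * ((norm (W 0))\<^sup>2 + (norm (V 0))\<^sup>2 + (norm (W 1))\<^sup>2))"
    by (intro mult_left_mono) auto
  have 4: "exp 2 * (norm (W 1))\<^sup>2 \<le> exp 2 * ((norm (W 0))\<^sup>2 + (norm (V 0))\<^sup>2 + (norm (W 1))\<^sup>2)"
    by (intro mult_left_mono) auto
  have q0: "q 0 / m \<le> 0" using weights(5)[of 0] m by (simp add: divide_le_0_iff)
  have 5: "q 0 / m * ((norm (W 0))\<^sup>2 + (norm (V 0))\<^sup>2 + (norm (W 1))\<^sup>2) \<le> q 0 / m * (norm (W 0))\<^sup>2"
    by (intro mult_left_mono_neg q0) auto
  have 6: "- k * J + (E * A1 + F - Q) * N = - (k * J) + E * (A1 * N) + F * N - Q * N" for E A1 F Q N k J :: real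
    by (simp add: algebra_simps)
  show ?thesis
    unfolding f_def[symmetric] \<kappa>_def[symmetric] 6 using 1[unfolded 2] 3 4 5 by linarith
qed

end

text \<open>\<open>norm M\<close> is the Frobenius norm here, so Cauchy-Schwarz is applied row by
  row.\<close>

lemma norm_matrix_vector_mult_le: "norm (M *v x) \<le> norm M * norm (x :: real^'n)"
proof -
  have "norm (M *v x) = L2_set (\<lambda>i. \<bar>M $ i \<bullet> x\<bar>) UNIV"
    by (simp add: norm_vec_def matrix_vector_mul_component)
  also have "\<dots> \<le> L2_set (\<lambda>i. norm (M $ i) * norm x) UNIV"
    by (intro L2_set_mono Cauchy_Schwarz_ineq2) auto
  also have "\<dots> = norm M * norm x"
    by (simp add: norm_vec_def L2_set_left_distrib)
  finally show ?thesis .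
qed

lemma symmetric_mat_inner:
  assumes "symmetric_mat M"
  shows "v \<bullet> (M *v w) = (M *v v) \<bullet> w"
  using assms by (metis dot_lmul_matrix symmetric_mat_def vector_transpose_matrix)

lemma integral_primitive_by_parts_inner:
  fixes g b b' :: "real \<Rightarrow> 'a::euclidean_space"
  assumes g: "g absolutely_integrable_on {0..1}"
    and b: "\<And>t. t \<in> {0..1} \<Longrightarrow> (b has_vector_derivative b' t) (at t within {0..1})"
    and b': "continuous_on {0..1} b'"
  shows "integral {0..1} (\<lambda>t. b' t \<bullet> integral {0..t} g)
       = b 1 \<bullet> integral {0..1} g - integral {0..1} (\<lambda>t. b t \<bullet> g t)"
proof -
  have gi: "g integrable_on {0..1}" using g by (simp add: absolutely_integrable_on_def)
  have cb: "continuous_on {0..1} b" by (rule continuous_on_vector_derivative[OF b])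
  have gi_t: "integral {0..t} (\<lambda>s. g s \<bullet> i) = integral {0..t} g \<bullet> i" if "t \<in> {0..1}" "i \<in> Basis" for t i
    using that by (intro integral_component_eq integrable_on_subinterval[OF gi]) auto
  have gc: "(\<lambda>s. g s \<bullet> i) absolutely_integrable_on {0..1}" if "i \<in> Basis" for i
    by (rule absolutely_integrable_component[OF g])
  have part: "integral {0..1} (\<lambda>t. (b' t \<bullet> i) * (integral {0..t} g \<bullet> i))
      = (b 1 \<bullet> i) * (integral {0..1} g \<bullet> i) - integral {0..1} (\<lambda>t. (b t \<bullet> i) * (g t \<bullet> i))" if i: "i \<in> Basis" for i
  proof -
    have "((\<lambda>t. b t \<bullet> i) has_real_derivative b' t \<bullet> i) (at t within {0..1})" if "t \<in> {0..1}" for t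
      unfolding has_real_derivative_iff_has_vector_derivative
      by (rule bounded_linear.has_vector_derivative[OF bounded_linear_inner_left b[OF that]])
    from integral_primitive_by_parts[OF gc[OF i] this continuous_on_inner[OF b' continuous_on_const]] have
      "integral {0..1} (\<lambda>t. (b' t \<bullet> i) * integral {0..t} (\<lambda>s. g s \<bullet> i))
        = (b 1 \<bullet> i) * integral {0..1} (\<lambda>s. g s \<bullet> i) - integral {0..1} (\<lambda>t. (b t \<bullet> i) * (g t \<bullet> i))"
      .
    then show ?thesis
      using gi_t[OF _ i] integral_cong[of "{0..1}" "\<lambda>t. (b' t \<bullet> i) * integral {0..t} (\<lambda>s. g s \<bullet> i)"
        "\<lambda>t. (b' t \<bullet> i) * (integral {0..t} g \<bullet> i)"] by simp
  qed
  have cG: "continuous_on {0..1} (\<lambda>t. integral {0..t} g)" by (rule indefinite_integral_continuous_1[OF gi])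
  have "integral {0..1} (\<lambda>t. b' t \<bullet> integral {0..t} g)
      = integral {0..1} (\<lambda>t. \<Sum>i\<in>Basis. (b' t \<bullet> i) * (integral {0..t} g \<bullet> i))"
    by (rule arg_cong[where f = "integral {0..1}"], rule ext, rule euclidean_inner)
  also have "\<dots> = (\<Sum>i\<in>Basis. integral {0..1} (\<lambda>t. (b' t \<bullet> i) * (integral {0..t} g \<bullet> i)))"
    by (intro integral_sum integrable_continuous_real continuous_intros b' cG finite_Basis)
  also have "\<dots> = (\<Sum>i\<in>Basis. (b 1 \<bullet> i) * (integral {0..1} g \<bullet> i)) - (\<Sum>i\<in>Basis. integral {0..1} (\<lambda>t. (b t \<bullet> i) * (g t \<bullet> i)))"
    by (simp add: part sum_subtractf)
  also have "(\<Sum>i\<in>Basis. integral {0..1} (\<lambda>t. (b t \<bullet> i) * (g t \<bullet> i)))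
      = integral {0..1} (\<lambda>t. \<Sum>i\<in>Basis. (b t \<bullet> i) * (g t \<bullet> i))"
  proof (rule integral_sum[symmetric])
    show "(\<lambda>t. (b t \<bullet> i) * (g t \<bullet> i)) integrable_on {0..1}" if "i \<in> Basis" for i
      using absolutely_integrable_scaleR_continuous_on[OF gc[OF that] continuous_on_inner[OF cb continuous_on_const]]
      by (simp add: absolutely_integrable_on_def)
  qed (rule finite_Basis)
  also have "\<dots> = integral {0..1} (\<lambda>t. b t \<bullet> g t)"
    by (rule arg_cong[where f = "integral {0..1}"], rule ext, rule euclidean_inner[symmetric])
  also have "(\<Sum>i\<in>Basis. (b 1 \<bullet> i) * (integral {0..1} g \<bullet> i)) = b 1 \<bullet> integral {0..1} g"
    by (rule euclidean_inner[symmetric])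
  finally show ?thesis .
qed

lemma integral_cong_AE_unit:
  fixes f g :: "real \<Rightarrow> 'a::euclidean_space"
  assumes "AE s in unit_leb. f s = g s" "{u..v} \<subseteq> {0..1}"
  shows "integral {u..v} f = integral {u..v} g" and "f integrable_on {u..v} \<longleftrightarrow> g integrable_on {u..v}"
proof -
  have "AE s in lebesgue. s \<in> {0<..<1} \<longrightarrow> f s = g s"
    using assms(1) by (subst (asm) AE_restrict_space_iff) auto
  then obtain N where N: "negligible N" "\<And>s. s \<in> {0<..<1} - N \<Longrightarrow> f s = g s"
    unfolding eventually_ae_filter_negligible by auto
  have N': "negligible (N \<union> {0,1})" using N by (intro negligible_Un) auto
  have eq: "f s = g s" if "s \<in> {u..v} - (N \<union> {0,1})" for s
    using that assms(2) N(2)[of s] by force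
  show "integral {u..v} f = integral {u..v} g"
    by (rule integral_spike[OF N']) (simp add: eq)
  show "f integrable_on {u..v} \<longleftrightarrow> g integrable_on {u..v}"
    using integrable_spike[OF _ N', of f "{u..v}" g] integrable_spike[OF _ N', of g "{u..v}" f] eq by metis
qed


lemma invertible_matrix_inv:
  fixes M :: "real^'n^'n"
  assumes "invertible M"
  shows "M *v (matrix_inv M *v x) = x" "matrix_inv M *v (M *v x) = x"
  using someI_ex[OF assms[unfolded invertible_def]]
  by (simp_all add: matrix_inv_def matrix_vector_mul_assoc)

lemma coercive_imp_invertible:
  fixes M :: "real^'n^'n"
  assumes m: "0 < m" and M: "\<And>v. m * (norm v)\<^sup>2 \<le> v \<bullet> (M *v v)"
  shows "invertible M"
proof -
  have "v = 0" if "M *v v = 0" for v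
    using M[of v] that m by (simp add: mult_le_0_iff)
  then have "inj ((*v) M)"
    by (simp add: linear_injective_0[OF matrix_vector_mul_linear])
  then show ?thesis
    by (metis invertible_left_inverse matrix_left_invertible_injective)
qed

lemma skew_matrix_inv:
  fixes M :: "real^'n^'n"
  assumes "transpose M = - M" "invertible M"
  shows "(matrix_inv M *v a) \<bullet> b = - (a \<bullet> (matrix_inv M *v b))"
proof -
  define a' b' where "a' = matrix_inv M *v a" and "b' = matrix_inv M *v b"
  have ab: "a = M *v a'" "b = M *v b'"
    by (simp_all add: a'_def b'_def invertible_matrix_inv[OF assms(2)])
  have "a' \<bullet> (M *v b') = (transpose M *v a') \<bullet> b'"
    by (metis dot_lmul_matrix vector_transpose_matrix transpose_transpose)
  also have "\<dots> = - ((M *v a') \<bullet> b')"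
    unfolding assms(1) by (simp add: matrix_vector_mult_def inner_vec_def sum_negf)
  finally have "a' \<bullet> b = - (a \<bullet> b')" by (simp only: ab[symmetric])
  then show ?thesis by (simp only: a'_def b'_def)
qed

section \<open>The operator in terms of continuous representatives\<close>

locale phs =
  fixes S :: "('n::finite, 'm::finite) phs"
  assumes system: "port_Hamiltonian S"
begin

lemma Ham_bounds:
  obtains m M L where "0 < m" "0 \<le> M" "0 \<le> L"
    "\<forall>\<zeta>\<in>{0..1}. \<forall>v. m * (norm v)\<^sup>2 \<le> v \<bullet> (Ham S \<zeta> *v v)"
    "\<forall>\<zeta>\<in>{0..1}. \<forall>v. norm (Ham S \<zeta> *v v) \<le> M * norm v"
    "\<forall>\<zeta>\<in>{0..1}. \<forall>s\<in>{0..1}. \<forall>v. norm (Ham S s *v v - Ham S \<zeta> *v v) \<le> L * \<bar>s - \<zeta>\<bar> * norm v"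
proof -
  have W: "Ham S \<in> W1inf" and c: "continuous_on {0..1} (Ham S)"
    using system by (auto simp: port_Hamiltonian_def)
  obtain m where m: "0 < m" "\<And>\<zeta>. \<zeta> \<in> {0..1} \<Longrightarrow> mat_le (m *\<^sub>R mat 1) (Ham S \<zeta>)"
    using system by (auto simp: port_Hamiltonian_def)
  obtain M where M: "\<And>\<zeta>. \<zeta> \<in> {0..1} \<Longrightarrow> norm (Ham S \<zeta>) \<le> M"
    using compact_imp_bounded[OF compact_continuous_image[OF c compact_Icc]]
    unfolding bounded_iff by (metis imageI)
  obtain L where L: "0 \<le> L" "\<And>s t. s \<in> {0..1} \<Longrightarrow> t \<in> {0..1} \<Longrightarrow> norm (Ham S s - Ham S t) \<le> L * \<bar>s - t\<bar>"
    using W1inf_continuous_imp_Lipschitz[OF W c] by blast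
  show ?thesis
  proof (rule that[of m M L], goal_cases)
    case 2
    show ?case using order_trans[OF norm_ge_zero M[of 0]] by simp
  next
    case 4
    then show ?case
      using m(2) by (simp add: mat_le_def scaleR_matrix_vector_assoc[symmetric] power2_norm_eq_inner)
  next
    case 5
    show ?case
    proof (intro ballI allI)
      fix \<zeta> :: real and v assume "\<zeta> \<in> {0..1}"
      then show "norm (Ham S \<zeta> *v v) \<le> M * norm v"
        using norm_matrix_vector_mult_le[of "Ham S \<zeta>" v] mult_right_mono[OF M, of \<zeta> "norm v"] by simp
    qed
  next
    case 6
    show ?case
    proof (intro ballI allI)
      fix \<zeta> s :: real and v assume "\<zeta> \<in> {0..1}" "s \<in> {0..1}"
      then show "norm (Ham S s *v v - Ham S \<zeta> *v v) \<le> L * \<bar>s - \<zeta>\<bar> * norm v"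
        using norm_matrix_vector_mult_le[of "Ham S s - Ham S \<zeta>" v] mult_right_mono[OF L(2), of s \<zeta> "norm v"]
        by (simp add: matrix_vector_mult_diff_rdistrib)
    qed
  qed (use m L in auto)
qed

lemma Ham_invertible: "\<zeta> \<in> {0..1} \<Longrightarrow> invertible (Ham S \<zeta>)"
  by (rule Ham_bounds) (auto intro: coercive_imp_invertible)

definition W :: "(real \<Rightarrow> real^'n) \<Rightarrow> real \<Rightarrow> real^'n" where
  "W x = crep (Hmul S x)"

definition V :: "(real \<Rightarrow> real^'n) \<Rightarrow> real \<Rightarrow> real^'n" where
  "V x = crep (wD (Hmul S x))"

text \<open>For x in the domain this is the continuous representative of x itself, obtained by
  dividing the one of Hx by H pointwise.\<close>

definition \<xi> :: "(real \<Rightarrow> real^'n) \<Rightarrow> real \<Rightarrow> real^'n" where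
  "\<xi> x \<zeta> = matrix_inv (Ham S \<zeta>) *v W x \<zeta>"

context
  fixes x assumes x: "x \<in> dom_A S"
begin

lemma weak_derivs:
  "weak_deriv (Hmul S x) (wD (Hmul S x))"
  "weak_deriv (wD (Hmul S x)) (wD (wD (Hmul S x)))"
proof -
  have "weak_deriv f (wD f)" if "f \<in> H1" for f :: "real \<Rightarrow> real^'n"
    using that someI_ex[of "weak_deriv f"] unfolding wD_def H1_def by blast
  then show "weak_deriv (Hmul S x) (wD (Hmul S x))" "weak_deriv (wD (Hmul S x)) (wD (wD (Hmul S x)))"
    using x by (auto simp: dom_A_def H2_def)
qed

lemma continuous_W: "continuous_on {0..1} (W x)" and continuous_V: "continuous_on {0..1} (V x)"
  unfolding W_def V_def by (intro crep_weak_deriv(1)[OF weak_derivs(1)] crep_weak_deriv(1)[OF weak_derivs(2)])+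

lemma AE_W: "AE s in unit_leb. W x s = Hmul S x s" and AE_V: "AE s in unit_leb. V x s = wD (Hmul S x) s"
  unfolding W_def V_def by (intro crep_weak_deriv(2)[OF weak_derivs(1)] crep_weak_deriv(2)[OF weak_derivs(2)])+

lemma W_eq: "t \<in> {0..1} \<Longrightarrow> W x t = W x 0 + integral {0..t} (V x)"
  using crep_weak_deriv(3)[OF weak_derivs(1), of t] integral_cong_AE_unit(1)[OF AE_V, of 0 t]
  by (simp add: W_def)

lemma V_eq: "t \<in> {0..1} \<Longrightarrow> V x t = V x 0 + integral {0..t} (wD (wD (Hmul S x)))"
  using crep_weak_deriv(3)[OF weak_derivs(2), of t] by (simp add: V_def)

lemma W_deriv:
  assumes t: "t \<in> {0..1}"
  shows "(W x has_vector_derivative V x t) (at t within {0..1})"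
proof -
  have "((\<lambda>t. W x 0 + integral {0..t} (V x)) has_vector_derivative 0 + V x t) (at t within {0..1})"
    by (intro has_vector_derivative_add has_vector_derivative_const integral_has_vector_derivative continuous_V t)
  then show ?thesis
    by (intro has_vector_derivative_transform[OF t W_eq]) simp_all
qed

lemma \<xi>: "t \<in> {0..1} \<Longrightarrow> W x t = Ham S t *v \<xi> x t"
  by (simp add: \<xi>_def invertible_matrix_inv[OF Ham_invertible])

lemma AE_\<xi>: "AE s in unit_leb. x s = \<xi> x s"
  using AE_W AE_unit_leb_Ioo
  by eventually_elim (simp add: \<xi>_def Hmul_def invertible_matrix_inv[OF Ham_invertible])

text \<open>Coercivity of H(s) takes the place of continuity of matrix inversion: applied to e =
  \<xi>(s) - \<xi>(z), the matrix H(s) gives W(s) - W(z) minus (H(s) - H(z)) \<xi>(z), and both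
  parts are small.\<close>

lemma continuous_\<xi>: "continuous_on {0..1} (\<xi> x)"
  unfolding continuous_on_def
proof
  fix z :: real assume z: "z \<in> {0..1}"
  obtain m M L where m: "0 < m"
    and lower: "\<forall>\<zeta>\<in>{0..1}. \<forall>v. m * (norm v)\<^sup>2 \<le> v \<bullet> (Ham S \<zeta> *v v)"
    and lip: "\<forall>\<zeta>\<in>{0..1}. \<forall>s\<in>{0..1}. \<forall>v. norm (Ham S s *v v - Ham S \<zeta> *v v) \<le> L * \<bar>s - \<zeta>\<bar> * norm v"
    by (rule Ham_bounds)
  have "norm (\<xi> x s - \<xi> x z) \<le> (norm (W x s - W x z) + L * \<bar>s - z\<bar> * norm (\<xi> x z)) / m" if s: "s \<in> {0..1}" for s
  proof -
    define e where "e = \<xi> x s - \<xi> x z"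
    have "Ham S s *v e = (W x s - W x z) - (Ham S s *v \<xi> x z - Ham S z *v \<xi> x z)"
      by (simp add: e_def \<xi>[OF s] \<xi>[OF z] matrix_vector_mult_diff_distrib)
    then have n: "norm (Ham S s *v e) \<le> norm (W x s - W x z) + L * \<bar>s - z\<bar> * norm (\<xi> x z)"
      using norm_triangle_ineq4[of "W x s - W x z" "Ham S s *v \<xi> x z - Ham S z *v \<xi> x z"] bspec[OF bspec[OF lip z] s, THEN spec, of "\<xi> x z"]
      by simp
    have "m * (norm e)\<^sup>2 \<le> norm e * norm (Ham S s *v e)"
      using bspec[OF lower s, THEN spec, of e] norm_cauchy_schwarz[of e "Ham S s *v e"] by simp
    then have "m * norm e \<le> norm (Ham S s *v e)"
      by (cases "e = 0") (auto simp: power2_eq_square mult.left_commute)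
    then show ?thesis using n m unfolding e_def[symmetric] by (simp add: pos_le_divide_eq mult.commute)
  qed
  then have ev: "\<forall>\<^sub>F s in at z within {0..1}. norm (\<xi> x s - \<xi> x z) \<le> (norm (W x s - W x z) + L * \<bar>s - z\<bar> * norm (\<xi> x z)) / m"
    by (simp add: eventually_at_filter)

  have tW: "(W x \<longlongrightarrow> W x z) (at z within {0..1})"
    using continuous_W z by (simp add: continuous_on_def)
  have "((\<lambda>s. (norm (W x s - W x z) + L * \<bar>s - z\<bar> * norm (\<xi> x z)) / m) \<longlongrightarrow>
      (norm (W x z - W x z) + L * \<bar>z - z\<bar> * norm (\<xi> x z)) / m) (at z within {0..1})"
    by (intro tendsto_intros tW) (use m in simp)
  then have lim: "((\<lambda>s. (norm (W x s - W x z) + L * \<bar>s - z\<bar> * norm (\<xi> x z)) / m) \<longlongrightarrow> 0) (at z within {0..1})"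
    by simp
  have "((\<lambda>s. \<xi> x s - \<xi> x z) \<longlongrightarrow> 0) (at z within {0..1})"
    by (rule Lim_null_comparison[OF ev lim])
  then show "(\<xi> x \<longlongrightarrow> \<xi> x z) (at z within {0..1})" by (rule LIM_zero_cancel)
qed

lemma op_A_integrable: "op_A S x absolutely_integrable_on {0..1}"
proof -
  have i: "(\<lambda>\<zeta>. M *v f \<zeta>) absolutely_integrable_on {0..1}" if "f absolutely_integrable_on {0..1}"
    for M :: "real^'n^'n" and f :: "real \<Rightarrow> real^'n"
    using absolutely_integrable_linear[OF that, of "(*v) M"] by (simp add: o_def)
  show ?thesis
    using weak_derivs unfolding op_A_def weak_deriv_def integrable_unit_leb_iff
    by (intro set_integral_add i) auto
qed

text \<open>This is why forms in primitives are used: one integration leaves a continuous function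
  of W, V and their values at 0. Applying Q afterwards turns it into the function U of
  \<open>multiplier_estimate\<close>.\<close>

lemma op_A_primitive:
  assumes t: "t \<in> {0..1}"
  shows "integral {0..t} (op_A S x) = P2 S *v (V x t - V x 0) + P1 S *v (W x t - W x 0) + P0 S *v integral {0..t} (W x)"
proof -
  have sub: "{0..t} \<subseteq> {0..1}" using t by auto
  have i: "wD (wD (Hmul S x)) integrable_on {0..t}" "wD (Hmul S x) integrable_on {0..t}" "Hmul S x integrable_on {0..t}"
    using weak_derivs integrable_on_subinterval[OF _ sub]
    unfolding weak_deriv_def integrable_unit_leb_iff absolutely_integrable_on_def by blast+
  have lin: "integral {0..t} (\<lambda>\<zeta>. M *v f \<zeta>) = M *v integral {0..t} f" "(\<lambda>\<zeta>. M *v f \<zeta>) integrable_on {0..t}"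
    if "f integrable_on {0..t}" for M :: "real^'n^'n" and f
    using integral_linear[OF that, of "(*v) M"] integrable_linear[OF that, of "(*v) M"] by (simp_all add: o_def)
  have "integral {0..t} (op_A S x) = P2 S *v integral {0..t} (wD (wD (Hmul S x)))
      + P1 S *v integral {0..t} (wD (Hmul S x)) + P0 S *v integral {0..t} (Hmul S x)"
    unfolding op_A_def lin(1)[OF i(1), symmetric] lin(1)[OF i(2), symmetric] lin(1)[OF i(3), symmetric]
    by (simp add: Henstock_Kurzweil_Integration.integral_add integrable_add lin(2) i)
  also have "integral {0..t} (wD (wD (Hmul S x))) = V x t - V x 0" using V_eq[OF t] by simp
  also have "integral {0..t} (wD (Hmul S x)) = W x t - W x 0"
    using W_eq[OF t] integral_cong_AE_unit(1)[OF AE_V sub] by simp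
  also have "integral {0..t} (Hmul S x) = integral {0..t} (W x)"
    using integral_cong_AE_unit(1)[OF AE_W sub] by simp
  finally show ?thesis .
qed

end

end

text \<open>The form \<open>F\<close> of the introduction is the diagonal of \<open>prim_form q Q\<close>.\<close>

definition prim_form :: "(real \<Rightarrow> real) \<Rightarrow> real^'n^'n \<Rightarrow> (real \<Rightarrow> real^'n) \<Rightarrow> (real \<Rightarrow> real^'n) \<Rightarrow> real" where
  "prim_form q Q x y = integral {0..1} (\<lambda>\<zeta>. q \<zeta> * (x \<zeta> \<bullet> (Q *v integral {0..\<zeta>} y)))"

lemma carleman_parameter_exists:
  fixes m M L a b :: real
  assumes "0 < m" "0 \<le> L"
  obtains \<mu> where "1 \<le> \<mu>" "1 \<le> \<mu> * m" "L + 2 + b\<^sup>2 \<le> \<mu> * m / 2"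
      "L + M\<^sup>2 + a\<^sup>2 * M\<^sup>2 / 2 + 9 + 4 * b\<^sup>2 \<le> \<mu> * m / 4"
proof -
  define K where "K = 4 * (L + M\<^sup>2 + a\<^sup>2 * M\<^sup>2 / 2 + 9 + 4 * b\<^sup>2)"
  have nonneg: "0 \<le> M\<^sup>2" "0 \<le> a\<^sup>2 * M\<^sup>2" "0 \<le> b\<^sup>2" by auto
  have K: "0 \<le> K" "1 \<le> K" "L + 2 + b\<^sup>2 \<le> K / 2" using assms nonneg by (auto simp: K_def)
  have \<mu>: "(1 + K / m) * m = m + K" using assms by (simp add: field_simps)
  show ?thesis
  proof (rule that[of "1 + K / m"])
    show "1 \<le> 1 + K / m" using K assms by simp
  qed (use \<mu> K assms in \<open>auto simp: K_def\<close>)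
qed

section \<open>The form F differentiated along the operator\<close>

context phs
begin

text \<open>The trace \<open>(Hx)'(1)\<close>, which (A1) does not control, drops out because \<open>q(1) = 0\<close>.\<close>

lemma multiplier_form:
  obtains q c C where "continuous_on {0..1} q" "0 < c" "0 < C"
    "\<forall>x\<in>dom_A S. prim_form q (matrix_inv (P2 S)) (op_A S x) x + prim_form q (matrix_inv (P2 S)) x (op_A S x)
       \<le> - c * integral {0..1} (\<lambda>\<zeta>. (norm (x \<zeta>))\<^sup>2)
          + C * ((norm (W x 0))\<^sup>2 + (norm (V x 0))\<^sup>2 + (norm (W x 1))\<^sup>2)"
proof -
  define Q where "Q = matrix_inv (P2 S)"
  define A where "A v = Q *v (P1 S *v v)" for v
  define B where "B v = Q *v (P0 S *v v)" for v
  define a where "a = norm Q * norm (P1 S)"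
  define b where "b = norm Q * norm (P0 S)"
  have skew: "(Q *v v) \<bullet> w = - (v \<bullet> (Q *v w))" for v w
    using system unfolding Q_def by (intro skew_matrix_inv) (auto simp: port_Hamiltonian_def)
  have Q_P2: "Q *v (P2 S *v v) = v" for v
    using system unfolding Q_def by (intro invertible_matrix_inv) (auto simp: port_Hamiltonian_def)
  obtain m M L where bounds: "0 < m" "0 \<le> M" "0 \<le> L"
    "\<forall>\<zeta>\<in>{0..1}. \<forall>v. m * (norm v)\<^sup>2 \<le> v \<bullet> (Ham S \<zeta> *v v)"
    "\<forall>\<zeta>\<in>{0..1}. \<forall>v. norm (Ham S \<zeta> *v v) \<le> M * norm v"
    "\<forall>\<zeta>\<in>{0..1}. \<forall>s\<in>{0..1}. \<forall>v. norm (Ham S s *v v - Ham S \<zeta> *v v) \<le> L * \<bar>s - \<zeta>\<bar> * norm v"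
    by (rule Ham_bounds)
  obtain \<mu> where \<mu>: "1 \<le> \<mu>" "1 \<le> \<mu> * m" "L + 2 + b\<^sup>2 \<le> \<mu> * m / 2"
      "L + M\<^sup>2 + a\<^sup>2 * M\<^sup>2 / 2 + 9 + 4 * b\<^sup>2 \<le> \<mu> * m / 4"
    by (rule carleman_parameter_exists[OF bounds(1,3), of b M a])
  have prod_bound: "norm (N1 *v (N2 *v v)) \<le> norm N1 * norm N2 * norm v" for N1 N2 :: "real^'n^'n" and v
    using order_trans[OF norm_matrix_vector_mult_le mult_left_mono[OF norm_matrix_vector_mult_le norm_ge_zero]]
    by (simp add: mult.assoc)
  interpret car: carleman "\<lambda>\<zeta> v. Ham S \<zeta> *v v" A B m M L a b \<mu>
  proof (rule carleman.intro, goal_cases)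
    case 1
    show ?case by (rule matrix_vector_mul_linear)
  next
    case (2 \<zeta> v w)
    then show ?case using system by (intro symmetric_mat_inner) (auto simp: port_Hamiltonian_def)
  next
    case (6 v)
    show ?case unfolding A_def a_def by (rule prod_bound)
  next
    case (7 v)
    show ?case unfolding B_def b_def by (rule prod_bound)
  next
    case 8
    show ?case unfolding A_def matrix_vector_mul_assoc by (rule matrix_vector_mul_linear)
  next
    case 9
    show ?case unfolding B_def matrix_vector_mul_assoc by (rule matrix_vector_mul_linear)
  qed (use bounds \<mu> in \<open>auto simp: a_def b_def\<close>)
  define c where "c = exp 2 / (\<mu> * exp \<mu>)"
  define C where "C = exp (2 * exp \<mu>) * (a\<^sup>2 + 1) + exp 2 - car.q 0 / m"
  have cq: "continuous_on {0..1} car.q" by (rule DERIV_continuous_on[OF car.weights(3)])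
  have cp: "continuous_on {0..1} car.p" by (rule DERIV_continuous_on[OF car.weights(1)])
  show ?thesis
  proof (rule that[of car.q c C])
    show "continuous_on {0..1} car.q" by (rule cq)
    show "0 < c" using \<mu>(1) by (simp add: c_def)
    have "car.q 0 / m \<le> 0" using car.weights(5)[of 0] bounds(1) by (simp add: divide_le_0_iff)
    moreover have "0 < exp (2 * exp \<mu>) * (a\<^sup>2 + 1)" by (intro mult_pos_pos) (auto intro: add_nonneg_pos)
    ultimately show "0 < C" unfolding C_def using exp_gt_zero[of "2::real"] by linarith
    show "\<forall>x\<in>dom_A S. prim_form car.q (matrix_inv (P2 S)) (op_A S x) x + prim_form car.q (matrix_inv (P2 S)) x (op_A S x)
       \<le> - c * integral {0..1} (\<lambda>\<zeta>. (norm (x \<zeta>))\<^sup>2)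
          + C * ((norm (W x 0))\<^sup>2 + (norm (V x 0))\<^sup>2 + (norm (W x 1))\<^sup>2)"
    proof
      fix x assume x: "x \<in> dom_A S"
      define X where "X t = integral {0..t} (\<xi> x)" for t
      define J where "J t = integral {0..t} (W x)" for t
      define U where "U t = V x t - V x 0 + A (W x t - W x 0) + B (J t)" for t
      have X': "(X has_vector_derivative \<xi> x t) (at t within {0..1})" if "t \<in> {0..1}" for t
        unfolding X_def by (rule integral_has_vector_derivative[OF continuous_\<xi>[OF x] that])
      have J': "(J has_vector_derivative W x t) (at t within {0..1})" if "t \<in> {0..1}" for t
        unfolding J_def by (rule integral_has_vector_derivative[OF continuous_W[OF x] that])
      have cX: "continuous_on {0..1} X" by (rule continuous_on_vector_derivative[OF X'])
      have cJ: "continuous_on {0..1} J" by (rule continuous_on_vector_derivative[OF J'])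
      have mvc: "continuous_on {0..1} (\<lambda>t. N *v f t)" if "continuous_on {0..1} f" for N :: "real^'n^'n" and f :: "real \<Rightarrow> real^'n"
        by (rule linear_continuous_on_compose[OF that matrix_vector_mul_linear])
      have cU: "continuous_on {0..1} U" unfolding U_def A_def B_def
        by (intro continuous_intros mvc continuous_W[OF x] continuous_V[OF x] cJ)
      have X_eq: "integral {0..t} x = X t" if "t \<in> {0..1}" for t
        unfolding X_def using that by (intro integral_cong_AE_unit(1)[OF AE_\<xi>[OF x]]) auto
      have QZ: "Q *v integral {0..t} (op_A S x) = U t" if "t \<in> {0..1}" for t
        unfolding op_A_primitive[OF x that] U_def A_def B_def J_def
        by (simp add: matrix_vector_right_distrib Q_P2)
      have form1: "prim_form car.q Q x (op_A S x) = integral {0..1} (\<lambda>t. car.q t * (\<xi> x t \<bullet> U t))"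
      proof -
        have "prim_form car.q Q x (op_A S x) = integral {0..1} (\<lambda>t. car.q t * (x t \<bullet> U t))"
          unfolding prim_form_def by (intro integral_cong) (simp add: QZ)
        also have "\<dots> = integral {0..1} (\<lambda>t. car.q t * (\<xi> x t \<bullet> U t))"
          by (rule integral_cong_AE_unit(1)[OF eventually_mono[OF AE_\<xi>[OF x]]]) auto
        finally show ?thesis .
      qed
      \<comment> \<open>Written as the integral of f . (A x), the form is integrated by parts so
        that only the primitive Z of A x occurs. The boundary term at 1 vanishes with q, and
        skew-symmetry turns - f' . Z into q \<xi> . U + p U . X with U = Q Z.\<close>
      define f where "f t = car.q t *\<^sub>R (Q *v X t)" for t
      define f' where "f' t = car.q t *\<^sub>R (Q *v \<xi> x t) + car.p t *\<^sub>R (Q *v X t)" for t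
      have f': "(f has_vector_derivative f' t) (at t within {0..1})" if t: "t \<in> {0..1}" for t
        unfolding f_def f'_def
        by (intro has_vector_derivative_scaleR car.weights(3)[OF t]
            bounded_linear.has_vector_derivative[OF matrix_vector_mul_bounded_linear X'[OF t]])
      have cf': "continuous_on {0..1} f'" unfolding f'_def
        by (intro continuous_intros cq cp mvc continuous_\<xi>[OF x] cX)
      have form2: "prim_form car.q Q (op_A S x) x = integral {0..1} (\<lambda>t. car.q t * (\<xi> x t \<bullet> U t) + car.p t * (U t \<bullet> X t))"
      proof -
        have "prim_form car.q Q (op_A S x) x = integral {0..1} (\<lambda>t. f t \<bullet> op_A S x t)"
          unfolding prim_form_def f_def by (intro integral_cong) (simp add: X_eq inner_commute)
        also have "\<dots> = f 1 \<bullet> integral {0..1} (op_A S x) - integral {0..1} (\<lambda>t. f' t \<bullet> integral {0..t} (op_A S x))"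
          using integral_primitive_by_parts_inner[OF op_A_integrable[OF x] f' cf'] by simp
        also have "\<dots> = integral {0..1} (\<lambda>t. - (f' t \<bullet> integral {0..t} (op_A S x)))"
          by (simp add: f_def car.weights(4))
        also have "\<dots> = integral {0..1} (\<lambda>t. car.q t * (\<xi> x t \<bullet> U t) + car.p t * (U t \<bullet> X t))"
        proof (rule integral_cong)
          fix t :: real assume t: "t \<in> {0..1}"
          show "- (f' t \<bullet> integral {0..t} (op_A S x)) = car.q t * (\<xi> x t \<bullet> U t) + car.p t * (U t \<bullet> X t)"
            unfolding f'_def inner_add_left inner_scaleR_left skew QZ[OF t] by (simp add: inner_commute)
        qed
        finally show ?thesis .
      qed
      have i: "(\<lambda>t. car.q t * (\<xi> x t \<bullet> U t)) integrable_on {0..1}"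
        "(\<lambda>t. car.q t * (\<xi> x t \<bullet> U t) + car.p t * (U t \<bullet> X t)) integrable_on {0..1}"
        by (intro integrable_continuous_real continuous_intros cq cp cU cX continuous_\<xi>[OF x])+
      have "prim_form car.q Q (op_A S x) x + prim_form car.q Q x (op_A S x)
          = integral {0..1} (\<lambda>t. car.p t * (U t \<bullet> X t) + 2 * car.q t * (\<xi> x t \<bullet> U t))"
        unfolding form1 form2 Henstock_Kurzweil_Integration.integral_add[OF i(2) i(1), symmetric]
        by (intro integral_cong) simp
      also have "\<dots> \<le> - c * integral {0..1} (\<lambda>\<zeta>. (norm (\<xi> x \<zeta>))\<^sup>2)
          + C * ((norm (W x 0))\<^sup>2 + (norm (V x 0))\<^sup>2 + (norm (W x 1))\<^sup>2)"
        unfolding U_def c_def C_def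
        by (rule car.multiplier_estimate[OF continuous_V[OF x] continuous_\<xi>[OF x] W_deriv[OF x] X' J' _ _ \<xi>[OF x]])
           (simp_all add: X_def J_def)
      also have "integral {0..1} (\<lambda>\<zeta>. (norm (\<xi> x \<zeta>))\<^sup>2) = integral {0..1} (\<lambda>\<zeta>. (norm (x \<zeta>))\<^sup>2)"
        by (rule integral_cong_AE_unit(1)[OF eventually_mono[OF AE_\<xi>[OF x]]]) auto
      finally show "prim_form car.q (matrix_inv (P2 S)) (op_A S x) x + prim_form car.q (matrix_inv (P2 S)) x (op_A S x)
       \<le> - c * integral {0..1} (\<lambda>\<zeta>. (norm (x \<zeta>))\<^sup>2)
          + C * ((norm (W x 0))\<^sup>2 + (norm (V x 0))\<^sup>2 + (norm (W x 1))\<^sup>2)"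
        unfolding Q_def .
    qed
  qed
qed

end

section \<open>Square-integrable states and bounded forms\<close>

lemma X_space_measurable: "x \<in> X_space \<Longrightarrow> x \<in> borel_measurable unit_leb"
  and X_space_square: "x \<in> X_space \<Longrightarrow> integrable unit_leb (\<lambda>s. (norm (x s))\<^sup>2)"
  by (auto simp: X_space_def L2_on_def)

lemma integrable_const_unit_leb: "integrable unit_leb (\<lambda>_. c :: real)"
  unfolding integrable_unit_leb_iff by simp

lemma X_space_product_integrable:
  fixes x :: "real \<Rightarrow> real^'n" and y :: "real \<Rightarrow> real^'k"
  assumes x: "x \<in> X_space" and y: "y \<in> X_space"
  shows "integrable unit_leb (\<lambda>s. norm (x s) * norm (y s))"
proof (rule Bochner_Integration.integrable_bound)
  show "integrable unit_leb (\<lambda>s. (norm (x s))\<^sup>2 + (norm (y s))\<^sup>2)"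
    by (intro Bochner_Integration.integrable_add X_space_square x y)
  show "(\<lambda>s. norm (x s) * norm (y s)) \<in> borel_measurable unit_leb"
    by (intro borel_measurable_times measurable_compose[OF X_space_measurable[OF x] borel_measurable_norm]
        measurable_compose[OF X_space_measurable[OF y] borel_measurable_norm])
  have "\<bar>u * v\<bar> \<le> \<bar>u\<^sup>2 + v\<^sup>2\<bar>" if "0 \<le> u" "0 \<le> v" for u v :: real
  proof -
    have "0 \<le> u * v" using that by simp
    then show ?thesis using sum_squares_bound[of u v] by linarith
  qed
  then show "AE s in unit_leb. norm (norm (x s) * norm (y s)) \<le> norm ((norm (x s))\<^sup>2 + (norm (y s))\<^sup>2)"
    by (intro AE_I2) simp
qed

lemma X_spaceI:
  fixes x :: "real \<Rightarrow> real^'n"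
  assumes "x \<in> borel_measurable unit_leb" "integrable unit_leb g" "\<And>s. (norm (x s))\<^sup>2 \<le> g s"
  shows "x \<in> X_space"
proof -
  have "integrable unit_leb (\<lambda>s. (norm (x s))\<^sup>2)"
  proof (rule Bochner_Integration.integrable_bound[OF assms(2)])
    show "(\<lambda>s. (norm (x s))\<^sup>2) \<in> borel_measurable unit_leb"
      by (intro borel_measurable_power measurable_compose[OF assms(1) borel_measurable_norm])
    show "AE s in unit_leb. norm ((norm (x s))\<^sup>2) \<le> norm (g s)"
    proof (rule AE_I2)
      fix s
      show "norm ((norm (x s))\<^sup>2) \<le> norm (g s)" using assms(3)[of s] by simp
    qed
  qed
  then show ?thesis using assms(1) by (simp add: X_space_def L2_on_def)
qed

lemma X_space_diff:
  assumes x: "x \<in> X_space" and y: "y \<in> X_space"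
  shows "x - y \<in> X_space"
proof (rule X_spaceI)
  show "x - y \<in> borel_measurable unit_leb"
    unfolding fun_diff_def by (intro borel_measurable_diff X_space_measurable x y)
  show "integrable unit_leb (\<lambda>s. 2 * (norm (x s))\<^sup>2 + 2 * (norm (y s))\<^sup>2)"
    by (intro Bochner_Integration.integrable_add integrable_mult_right X_space_square x y)
  fix s
  have "(norm (x s - y s))\<^sup>2 \<le> (norm (x s) + norm (y s))\<^sup>2"
    by (intro power_mono norm_triangle_ineq4) auto
  also have "\<dots> \<le> 2 * (norm (x s))\<^sup>2 + 2 * (norm (y s))\<^sup>2"
    using sum_squares_bound[of "norm (x s)" "norm (y s)"] by (simp add: power2_sum)
  finally show "(norm ((x - y) s))\<^sup>2 \<le> 2 * (norm (x s))\<^sup>2 + 2 * (norm (y s))\<^sup>2" by simp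
qed

lemma X_space_scale:
  assumes x: "x \<in> X_space"
  shows "(\<lambda>s. a *\<^sub>R x s) \<in> X_space"
proof (rule X_spaceI)
  show "(\<lambda>s. a *\<^sub>R x s) \<in> borel_measurable unit_leb"
    by (intro borel_measurable_scaleR X_space_measurable x borel_measurable_const)
  show "integrable unit_leb (\<lambda>s. a\<^sup>2 * (norm (x s))\<^sup>2)"
    by (intro integrable_mult_right X_space_square x)
qed (simp add: power_mult_distrib)

lemma X_space_imp_integrable:
  assumes x: "x \<in> X_space"
  shows "integrable unit_leb x"
proof (rule Bochner_Integration.integrable_bound)
  show "integrable unit_leb (\<lambda>s. 1 + (norm (x s))\<^sup>2)"
    by (intro Bochner_Integration.integrable_add integrable_const_unit_leb X_space_square x)
  show "x \<in> borel_measurable unit_leb" by (rule X_space_measurable[OF x])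
  have "u \<le> \<bar>1 + u\<^sup>2\<bar>" for u :: real
  proof -
    have "2 * u \<le> 1 + u\<^sup>2" using sum_squares_bound[of 1 u] by simp
    moreover have "0 \<le> u\<^sup>2" by simp
    ultimately show ?thesis by linarith
  qed
  then show "AE s in unit_leb. norm (x s) \<le> norm (1 + (norm (x s))\<^sup>2)"
    by (intro AE_I2) simp
qed

text \<open>The unweighted norm, which is equivalent to \<open>norm_X S\<close> on
  \<open>X_space\<close> by the bounds on H. The bounds of all forms are stated in it.\<close>

definition l2 :: "(real \<Rightarrow> real^'n) \<Rightarrow> real" where
  "l2 x = sqrt (LINT s|unit_leb. (norm (x s))\<^sup>2)"

lemma l2_nonneg: "0 \<le> l2 x"
  by (simp add: l2_def)

lemma l2_square: "(l2 x)\<^sup>2 = (LINT s|unit_leb. (norm (x s))\<^sup>2)"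
  by (simp add: l2_def)

lemma Cauchy_Schwarz_unit:
  fixes f g :: "real \<Rightarrow> real"
  assumes f: "integrable unit_leb (\<lambda>s. (f s)\<^sup>2)" and g: "integrable unit_leb (\<lambda>s. (g s)\<^sup>2)"
    and fg: "integrable unit_leb (\<lambda>s. f s * g s)"
  shows "(LINT s|unit_leb. f s * g s) \<le> sqrt (LINT s|unit_leb. (f s)\<^sup>2) * sqrt (LINT s|unit_leb. (g s)\<^sup>2)"
proof -
  define A where "A = sqrt (LINT s|unit_leb. (f s)\<^sup>2)"
  define B where "B = sqrt (LINT s|unit_leb. (g s)\<^sup>2)"
  define P where "P = (LINT s|unit_leb. f s * g s)"
  have A: "0 \<le> A" "A\<^sup>2 = (LINT s|unit_leb. (f s)\<^sup>2)" and B: "0 \<le> B" "B\<^sup>2 = (LINT s|unit_leb. (g s)\<^sup>2)"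
    by (auto simp: A_def B_def)
  \<comment> \<open>\<open>A\<close> or \<open>B\<close> may be zero. Enlarging both by
    \<open>e\<close> allows division by 2 a b, and letting \<open>e\<close> tend to 0 gives the
    inequality.\<close>
  have le: "P \<le> (A + e) * (B + e)" if e: "0 < e" for e
  proof -
    define a b where "a = A + e" and "b = B + e"
    have pos: "0 < a" "0 < b" "A \<le> a" "B \<le> b" using A B e by (auto simp: a_def b_def)
    have "0 \<le> (LINT s|unit_leb. (b * f s - a * g s)\<^sup>2)" by (intro Bochner_Integration.integral_nonneg) auto
    also have "(\<lambda>s. (b * f s - a * g s)\<^sup>2) = (\<lambda>s. b\<^sup>2 * (f s)\<^sup>2 - 2 * a * b * (f s * g s) + a\<^sup>2 * (g s)\<^sup>2)"
      by (simp add: power2_eq_square algebra_simps fun_eq_iff)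
    also have "(LINT s|unit_leb. b\<^sup>2 * (f s)\<^sup>2 - 2 * a * b * (f s * g s) + a\<^sup>2 * (g s)\<^sup>2) = b\<^sup>2 * A\<^sup>2 - 2 * a * b * P + a\<^sup>2 * B\<^sup>2"
      unfolding A(2) B(2) P_def using f g fg by simp
    finally have "2 * a * b * P \<le> b\<^sup>2 * A\<^sup>2 + a\<^sup>2 * B\<^sup>2" by simp
    also have "\<dots> \<le> b\<^sup>2 * a\<^sup>2 + a\<^sup>2 * b\<^sup>2"
      using pos A(1) B(1) by (intro add_mono mult_left_mono power_mono) auto
    finally have "(2 * a * b) * P \<le> (2 * a * b) * (a * b)" by (simp add: power2_eq_square mult_ac)
    then have "P \<le> a * b" using pos by (simp add: mult_le_cancel_left)
    then show ?thesis by (simp add: a_def b_def)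
  qed
  have "((\<lambda>e. (A + e) * (B + e)) \<longlongrightarrow> (A + 0) * (B + 0)) (at_right 0)"
    by (intro tendsto_intros)
  then have "P \<le> (A + 0) * (B + 0)"
    by (rule tendsto_lowerbound) (auto simp: eventually_at_right_less le intro: eventually_at_rightI[of 0 1])
  then show ?thesis by (simp add: A_def B_def P_def)
qed

lemma l2_Cauchy_Schwarz:
  fixes x :: "real \<Rightarrow> real^'n" and y :: "real \<Rightarrow> real^'k"
  assumes x: "x \<in> X_space" and y: "y \<in> X_space"
  shows "(LINT s|unit_leb. norm (x s) * norm (y s)) \<le> l2 x * l2 y"
  unfolding l2_def
  by (intro Cauchy_Schwarz_unit X_space_square X_space_product_integrable x y)

lemma integral_norm_le_l2:
  fixes x :: "real \<Rightarrow> real^'n"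
  assumes x: "x \<in> X_space"
  shows "integral {0..1} (\<lambda>s. norm (x s)) \<le> l2 x"
proof -
  have "integral {0..1} (\<lambda>s. norm (x s)) = (LINT s|unit_leb. norm (x s) * 1)"
    using LINT_unit_leb_eq_integral[OF integrable_norm[OF X_space_imp_integrable[OF x]]] by simp
  also have "\<dots> \<le> sqrt (LINT s|unit_leb. (norm (x s))\<^sup>2) * sqrt (LINT s|unit_leb. 1\<^sup>2)"
    using integrable_norm[OF X_space_imp_integrable[OF x]]
    by (intro Cauchy_Schwarz_unit X_space_square x) (simp_all add: integrable_const_unit_leb)
  also have "(LINT s|unit_leb. (1::real)\<^sup>2) = 1"
    using LINT_unit_leb_eq_integral[OF integrable_const_unit_leb, of 1] by simp
  finally show ?thesis by (simp add: l2_def)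
qed

lemma X_space_absolutely_integrable: "x \<in> X_space \<Longrightarrow> x absolutely_integrable_on {0..1}"
  using X_space_imp_integrable integrable_unit_leb_iff by blast

lemma norm_integral_le_l2:
  fixes x :: "real \<Rightarrow> real^'n"
  assumes x: "x \<in> X_space" and t: "t \<in> {0..1}"
  shows "norm (integral {0..t} x) \<le> l2 x"
proof -
  have xi: "x integrable_on {0..1}" and ni: "(\<lambda>s. norm (x s)) integrable_on {0..1}"
    using X_space_absolutely_integrable[OF x] by (auto simp: absolutely_integrable_on_def)
  have sub: "{0..t} \<subseteq> {0..1}" using t by auto
  have "norm (integral {0..t} x) \<le> integral {0..t} (\<lambda>s. norm (x s))"
    by (intro integral_norm_bound_integral integrable_on_subinterval[OF xi sub] integrable_on_subinterval[OF ni sub] order_refl)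
  also have "\<dots> \<le> integral {0..1} (\<lambda>s. norm (x s))"
    by (intro integral_subset_le sub integrable_on_subinterval[OF ni sub] ni) simp
  also have "\<dots> \<le> l2 x" by (rule integral_norm_le_l2[OF x])
  finally show ?thesis .
qed

text \<open>Bounded bilinear forms on L^2. States are functions with a seminorm rather than points
  of a normed type, so bilinearity is required on \<open>X_space\<close> and the product rule along
  curves is derived from these laws.\<close>

locale l2_form =
  fixes b :: "(real \<Rightarrow> real^'n) \<Rightarrow> (real \<Rightarrow> real^'n) \<Rightarrow> real" and K :: real
  assumes diff_left: "x \<in> X_space \<Longrightarrow> y \<in> X_space \<Longrightarrow> z \<in> X_space \<Longrightarrow> b (x - y) z = b x z - b y z"
    and diff_right: "x \<in> X_space \<Longrightarrow> y \<in> X_space \<Longrightarrow> z \<in> X_space \<Longrightarrow> b z (x - y) = b z x - b z y"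
    and scale_left: "x \<in> X_space \<Longrightarrow> z \<in> X_space \<Longrightarrow> b (\<lambda>s. a *\<^sub>R x s) z = a * b x z"
    and scale_right: "x \<in> X_space \<Longrightarrow> z \<in> X_space \<Longrightarrow> b z (\<lambda>s. a *\<^sub>R x s) = a * b z x"
    and bound: "x \<in> X_space \<Longrightarrow> y \<in> X_space \<Longrightarrow> \<bar>b x y\<bar> \<le> K * l2 x * l2 y"
begin

text \<open>The hypothesis on \<open>u * v\<close> covers in one statement two null factors and a
  null factor paired with a constant one.\<close>

lemma tendsto_zero:
  assumes "\<forall>\<^sub>F s in F. x s \<in> X_space" "\<forall>\<^sub>F s in F. y s \<in> X_space"
    and "((\<lambda>s. l2 (x s)) \<longlongrightarrow> u) F" "((\<lambda>s. l2 (y s)) \<longlongrightarrow> v) F" "u * v = 0"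
  shows "((\<lambda>s. b (x s) (y s)) \<longlongrightarrow> 0) F"
proof (rule Lim_null_comparison)
  show "\<forall>\<^sub>F s in F. norm (b (x s) (y s)) \<le> K * l2 (x s) * l2 (y s)"
    using assms(1,2) by eventually_elim (simp add: bound)
  have "((\<lambda>s. K * l2 (x s) * l2 (y s)) \<longlongrightarrow> K * u * v) F"
    by (intro tendsto_intros assms)
  then show "((\<lambda>s. K * l2 (x s) * l2 (y s)) \<longlongrightarrow> 0) F" using assms(5) by (simp add: mult.assoc)
qed

lemma has_real_derivative:
  assumes x: "\<And>s. s \<in> T \<Longrightarrow> x s \<in> X_space" and t: "t \<in> T" and x': "x' \<in> X_space"
    and lim: "((\<lambda>s. l2 ((\<lambda>\<zeta>. (1 / (s - t)) *\<^sub>R (x s - x t) \<zeta>) - x')) \<longlongrightarrow> 0) (at t within T)"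
    and cont: "((\<lambda>s. l2 (x s - x t)) \<longlongrightarrow> 0) (at t within T)"
  shows "((\<lambda>s. b (x s) (x s)) has_real_derivative b x' (x t) + b (x t) x') (at t within T)"
proof -
  define d where "d s = (\<lambda>\<zeta>. (1 / (s - t)) *\<^sub>R (x s - x t) \<zeta>)" for s
  have ev: "\<forall>\<^sub>F s in at t within T. s \<in> T \<and> s \<noteq> t"
    by (simp add: eventually_at_filter)
  have xt: "x t \<in> X_space" by (rule x[OF t])
  have d: "d s \<in> X_space" "x s - x t \<in> X_space" "d s - x' \<in> X_space" if "s \<in> T" for s
  proof -
    show 1: "x s - x t \<in> X_space" by (intro X_space_diff x that t)
    show "d s \<in> X_space" unfolding d_def by (rule X_space_scale[OF 1])
    then show "d s - x' \<in> X_space" by (intro X_space_diff x')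
  qed
  \<comment> \<open>Each of the first four summands contains \<open>d s - x'\<close> or
    \<open>x s - x t\<close>, both of which tend to 0 in L^2; the bracket at the end is the
    limit.\<close>
  have eq: "(b (x s) (x s) - b (x t) (x t)) / (s - t)
      = b (d s - x') (x s - x t) + b (d s - x') (x t) + b x' (x s - x t) + b (x t) (d s - x') + (b x' (x t) + b (x t) x')"
    if s: "s \<in> T" "s \<noteq> t" for s
  proof -
    have xs: "x s \<in> X_space" by (rule x[OF s(1)])
    note D = d[OF s(1)]
    have "b (d s - x') (x s - x t) + b (d s - x') (x t) + b x' (x s - x t) + b (x t) (d s - x') + (b x' (x t) + b (x t) x')
        = b (d s) (x s) + b (x t) (d s)"
      using D xs xt x' by (simp add: diff_left diff_right)
    also have "\<dots> = (1 / (s - t)) * (b (x s - x t) (x s) + b (x t) (x s - x t))"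
    proof -
      have "b (d s) (x s) = (1 / (s - t)) * b (x s - x t) (x s)" "b (x t) (d s) = (1 / (s - t)) * b (x t) (x s - x t)"
        unfolding d_def by (rule scale_left[OF D(2) xs], rule scale_right[OF D(2) xt])
      then show ?thesis by (simp add: distrib_left)
    qed
    also have "\<dots> = (b (x s) (x s) - b (x t) (x t)) / (s - t)"
      using xs xt by (simp add: diff_left diff_right)
    finally show ?thesis by simp
  qed
  have evX: "\<forall>\<^sub>F s in at t within T. d s - x' \<in> X_space" "\<forall>\<^sub>F s in at t within T. x s - x t \<in> X_space"
    using d by (auto intro: eventually_mono[OF ev])
  have lim': "((\<lambda>s. l2 (d s - x')) \<longlongrightarrow> 0) (at t within T)" using lim unfolding d_def .
  have "((\<lambda>s. b (d s - x') (x s - x t) + b (d s - x') (x t) + b x' (x s - x t) + b (x t) (d s - x') + (b x' (x t) + b (x t) x'))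
      \<longlongrightarrow> 0 + 0 + 0 + 0 + (b x' (x t) + b (x t) x')) (at t within T)"
    by (intro tendsto_add tendsto_const tendsto_zero[OF evX(1) evX(2) lim' cont]
        tendsto_zero[OF evX(1) _ lim' tendsto_const] tendsto_zero[OF _ evX(2) tendsto_const cont]
        tendsto_zero[OF _ evX(1) tendsto_const lim']) (simp_all add: xt x')
  then have lim2: "((\<lambda>s. b (d s - x') (x s - x t) + b (d s - x') (x t) + b x' (x s - x t) + b (x t) (d s - x') + (b x' (x t) + b (x t) x'))
      \<longlongrightarrow> b x' (x t) + b (x t) x') (at t within T)"
    by (simp only: add_0)
  have "((\<lambda>s. (b (x s) (x s) - b (x t) (x t)) / (s - t)) \<longlongrightarrow> b x' (x t) + b (x t) x') (at t within T)"
    by (rule Lim_transform_eventually[OF lim2], rule eventually_mono[OF ev], rule eq[symmetric]) blast+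
  then show ?thesis by (simp add: has_field_derivative_iff)
qed

end

lemma bounded_bilinear_matrix_vector_mult:
  "bounded_bilinear ((*v) :: real^'n^'m \<Rightarrow> real^'n \<Rightarrow> real^'m)"
proof
  show "\<exists>K. \<forall>(M::real^'n^'m) x. norm (M *v x) \<le> norm M * norm x * K"
    by (rule exI[of _ 1]) (simp add: norm_matrix_vector_mult_le)
qed (simp_all add: matrix_vector_mult_add_rdistrib matrix_vector_right_distrib
      scaleR_matrix_vector_assoc matrix_vector_mult_scaleR)

lemma absolutely_integrable_inner_continuous_on:
  fixes x w :: "real \<Rightarrow> 'a::euclidean_space"
  assumes "x absolutely_integrable_on {u..v}" "continuous_on {u..v} w"
  shows "(\<lambda>t. x t \<bullet> w t) absolutely_integrable_on {u..v}"
proof -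
  have "(\<lambda>t. w t \<bullet> x t) absolutely_integrable_on {u..v}"
  proof (rule absolutely_integrable_bounded_measurable_product[where h = "(\<bullet>)" and f = w, OF _ _ _ _ assms(1)])
    show "bilinear ((\<bullet>) :: 'a \<Rightarrow> 'a \<Rightarrow> real)"
      using bounded_bilinear_inner bilinear_conv_bounded_bilinear by blast
    show "w \<in> borel_measurable (lebesgue_on {u..v})"
      by (intro continuous_imp_measurable_on_sets_lebesgue assms) auto
    show "bounded (w ` {u..v})"
      by (intro compact_imp_bounded compact_continuous_image assms) auto
  qed auto
  then show ?thesis by (simp add: inner_commute)
qed

text \<open>Taking primitives is bounded from L^2 to the continuous functions, so the second
  argument is estimated uniformly in \<zeta> and the first one in L^1.\<close>

lemma prim_form_l2_form:
  fixes Q :: "real^'n^'n"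
  assumes q: "continuous_on {0..1} q"
  obtains K where "0 \<le> K" "l2_form (prim_form q Q) K"
proof -
  obtain k where k: "\<And>t. t \<in> {0..1} \<Longrightarrow> \<bar>q t\<bar> \<le> k"
    using compact_imp_bounded[OF compact_continuous_image[OF q compact_Icc]]
    unfolding bounded_iff by (metis imageI real_norm_def)
  have k0: "0 \<le> k" using order_trans[OF abs_ge_zero k[of 0]] by simp
  have ii: "(\<lambda>t. q t * (x t \<bullet> (Q *v integral {0..t} y))) integrable_on {0..1}"
    if x: "x \<in> X_space" and y: "y \<in> X_space" for x y :: "real \<Rightarrow> real^'n"
  proof -
    have "continuous_on {0..1} (\<lambda>t. integral {0..t} y)"
      using X_space_absolutely_integrable[OF y]
      by (intro indefinite_integral_continuous_1) (simp add: absolutely_integrable_on_def)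
    then have "continuous_on {0..1} (\<lambda>t. q t *\<^sub>R (Q *v integral {0..t} y))"
      by (intro continuous_on_scaleR q linear_continuous_on_compose[OF _ matrix_vector_mul_linear])
    from absolutely_integrable_inner_continuous_on[OF X_space_absolutely_integrable[OF x] this]
    show ?thesis by (simp add: absolutely_integrable_on_def)
  qed
  have prim: "integral {0..t} (x - y) = integral {0..t} x - integral {0..t} y"
    if "x \<in> X_space" "y \<in> X_space" "t \<in> {0..1}" for x y :: "real \<Rightarrow> real^'n" and t
  proof -
    have sub: "{0..t} \<subseteq> {0..1}" using that(3) by simp
    have i: "f integrable_on {0..t}" if "f \<in> X_space" for f :: "real \<Rightarrow> real^'n"
      using X_space_absolutely_integrable[OF that] unfolding absolutely_integrable_on_def
      by (intro integrable_on_subinterval[OF _ sub]) simp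
    show ?thesis
      unfolding fun_diff_def by (rule Henstock_Kurzweil_Integration.integral_diff[OF i[OF that(1)] i[OF that(2)]])
  qed
  have "l2_form (prim_form q Q) (k * norm Q)"
  proof
    fix x y z :: "real \<Rightarrow> real^'n" and a :: real
    assume x: "x \<in> X_space" and z: "z \<in> X_space"
    show "prim_form q Q (\<lambda>s. a *\<^sub>R x s) z = a * prim_form q Q x z"
      unfolding prim_form_def by (simp add: mult.left_commute)
    show "prim_form q Q z (\<lambda>s. a *\<^sub>R x s) = a * prim_form q Q z x"
      unfolding prim_form_def by (simp add: mult.left_commute matrix_vector_mult_scaleR)
    assume y: "y \<in> X_space"
    show "prim_form q Q (x - y) z = prim_form q Q x z - prim_form q Q y z"
      unfolding prim_form_def Henstock_Kurzweil_Integration.integral_diff[OF ii[OF x z] ii[OF y z], symmetric]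
      by (simp add: inner_diff_left right_diff_distrib)
    show "prim_form q Q z (x - y) = prim_form q Q z x - prim_form q Q z y"
      unfolding prim_form_def Henstock_Kurzweil_Integration.integral_diff[OF ii[OF z x] ii[OF z y], symmetric]
      by (intro integral_cong) (simp add: prim[OF x y] matrix_vector_mult_diff_distrib inner_diff_right right_diff_distrib)
    have ni: "(\<lambda>t. norm (x t)) integrable_on {0..1}"
      using X_space_absolutely_integrable[OF x] by (simp add: absolutely_integrable_on_def)
    have "norm (prim_form q Q x y) \<le> integral {0..1} (\<lambda>t. k * norm Q * l2 y * norm (x t))"
      unfolding prim_form_def
    proof (rule integral_norm_bound_integral[OF ii[OF x y] integrable_on_mult_right[OF ni]])
      fix t :: real assume t: "t \<in> {0..1}"
      have "norm (Q *v integral {0..t} y) \<le> norm Q * l2 y"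
        using norm_matrix_vector_mult_le[of Q "integral {0..t} y"]
          mult_left_mono[OF norm_integral_le_l2[OF y t] norm_ge_zero[of Q]] by linarith
      then have "\<bar>x t \<bullet> (Q *v integral {0..t} y)\<bar> \<le> norm (x t) * (norm Q * l2 y)"
        by (intro order_trans[OF Cauchy_Schwarz_ineq2] mult_left_mono norm_ge_zero)
      then have "\<bar>q t\<bar> * \<bar>x t \<bullet> (Q *v integral {0..t} y)\<bar> \<le> k * (norm (x t) * (norm Q * l2 y))"
        using k[OF t] k0 by (intro mult_mono) auto
      then show "norm (q t * (x t \<bullet> (Q *v integral {0..t} y))) \<le> k * norm Q * l2 y * norm (x t)"
        by (simp add: abs_mult mult_ac)
    qed
    also have "\<dots> = k * norm Q * l2 y * integral {0..1} (\<lambda>t. norm (x t))" by simp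
    also have "\<dots> \<le> k * norm Q * l2 y * l2 x"
      using k0 l2_nonneg[of y] by (intro mult_left_mono integral_norm_le_l2[OF x]) auto
    finally show "\<bar>prim_form q Q x y\<bar> \<le> k * norm Q * l2 x * l2 y" by (simp add: mult_ac)
  qed
  then show ?thesis using k0 by (intro that[of "k * norm Q"]) auto
qed

section \<open>The weighted inner product as a bounded coercive form\<close>

context phs
begin

lemma inner_X_integrable:
  assumes x: "x \<in> X_space" and y: "y \<in> X_space"
  shows "integrable unit_leb (\<lambda>\<zeta>. x \<zeta> \<bullet> (Ham S \<zeta> *v y \<zeta>))"
proof -
  obtain m M L where M: "0 \<le> M" "\<forall>\<zeta>\<in>{0..1}. \<forall>v. norm (Ham S \<zeta> *v v) \<le> M * norm v"
    by (rule Ham_bounds)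
  have Hm: "Ham S \<in> borel_measurable unit_leb"
    using system by (auto simp: port_Hamiltonian_def W1inf_def Linf_unit_def)
  have Hy: "(\<lambda>\<zeta>. Ham S \<zeta> *v y \<zeta>) \<in> borel_measurable unit_leb"
    by (rule borel_measurable_continuous_Pair[OF Hm X_space_measurable[OF y]],
        rule bounded_bilinear.continuous_on[OF bounded_bilinear_matrix_vector_mult
          continuous_on_fst[OF continuous_on_id] continuous_on_snd[OF continuous_on_id]])
  show ?thesis
  proof (rule Bochner_Integration.integrable_bound)
    show "integrable unit_leb (\<lambda>\<zeta>. M * (norm (x \<zeta>) * norm (y \<zeta>)))"
      by (intro integrable_mult_right X_space_product_integrable x y)
    show "(\<lambda>\<zeta>. x \<zeta> \<bullet> (Ham S \<zeta> *v y \<zeta>)) \<in> borel_measurable unit_leb"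
      by (intro borel_measurable_inner X_space_measurable x Hy)
    show "AE \<zeta> in unit_leb. norm (x \<zeta> \<bullet> (Ham S \<zeta> *v y \<zeta>)) \<le> norm (M * (norm (x \<zeta>) * norm (y \<zeta>)))"
      using AE_unit_leb_Ioo
    proof eventually_elim
      fix \<zeta> :: real assume "\<zeta> \<in> {0<..<1}"
      then have "norm (Ham S \<zeta> *v y \<zeta>) \<le> M * norm (y \<zeta>)" using M(2) by simp
      then have "\<bar>x \<zeta> \<bullet> (Ham S \<zeta> *v y \<zeta>)\<bar> \<le> norm (x \<zeta>) * (M * norm (y \<zeta>))"
        by (intro order_trans[OF Cauchy_Schwarz_ineq2] mult_left_mono norm_ge_zero)
      then show "norm (x \<zeta> \<bullet> (Ham S \<zeta> *v y \<zeta>)) \<le> norm (M * (norm (x \<zeta>) * norm (y \<zeta>)))"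
        using M(1) by (simp add: mult_ac abs_mult)
    qed
  qed
qed

lemma inner_X_commute: "inner_X S x y = inner_X S y x"
proof -
  have "x \<zeta> \<bullet> (Ham S \<zeta> *v y \<zeta>) = y \<zeta> \<bullet> (Ham S \<zeta> *v x \<zeta>)" if "\<zeta> \<in> {0<..<1}" for \<zeta>
  proof -
    have "symmetric_mat (Ham S \<zeta>)" using system that by (auto simp: port_Hamiltonian_def)
    from symmetric_mat_inner[OF this, of "x \<zeta>" "y \<zeta>"] show ?thesis
      by (rule trans) (rule inner_commute)
  qed
  then show ?thesis unfolding inner_X_def by (intro Bochner_Integration.integral_cong) auto
qed

lemma inner_X_self_bounds:
  obtains m M where "0 < m" "0 \<le> M" "\<forall>x\<in>X_space. m * (l2 x)\<^sup>2 \<le> inner_X S x x"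
    "l2_form (inner_X S) M"
proof -
  obtain m M L where b: "0 < m" "0 \<le> M"
    "\<forall>\<zeta>\<in>{0..1}. \<forall>v. m * (norm v)\<^sup>2 \<le> v \<bullet> (Ham S \<zeta> *v v)"
    "\<forall>\<zeta>\<in>{0..1}. \<forall>v. norm (Ham S \<zeta> *v v) \<le> M * norm v"
    by (rule Ham_bounds)
  have lower: "m * (l2 x)\<^sup>2 \<le> inner_X S x x" if x: "x \<in> X_space" for x
  proof -
    have "m * (l2 x)\<^sup>2 = (LINT \<zeta>|unit_leb. m * (norm (x \<zeta>))\<^sup>2)" by (simp add: l2_square)
    also have "\<dots> \<le> inner_X S x x"
      unfolding inner_X_def
    proof (rule integral_mono_AE)
      show "integrable unit_leb (\<lambda>\<zeta>. m * (norm (x \<zeta>))\<^sup>2)" by (intro integrable_mult_right X_space_square x)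
      show "integrable unit_leb (\<lambda>\<zeta>. x \<zeta> \<bullet> (Ham S \<zeta> *v x \<zeta>))" by (rule inner_X_integrable[OF x x])
      show "AE \<zeta> in unit_leb. m * (norm (x \<zeta>))\<^sup>2 \<le> x \<zeta> \<bullet> (Ham S \<zeta> *v x \<zeta>)"
        using AE_unit_leb_Ioo by eventually_elim (use b(3) in auto)
    qed
    finally show ?thesis .
  qed
  have "l2_form (inner_X S) M"
  proof
    fix x y z :: "real \<Rightarrow> real^'n" and a :: real
    assume x: "x \<in> X_space" and z: "z \<in> X_space"
    show sl: "inner_X S (\<lambda>s. a *\<^sub>R x s) z = a * inner_X S x z"
      unfolding inner_X_def by simp
    show "inner_X S z (\<lambda>s. a *\<^sub>R x s) = a * inner_X S z x"
      using sl by (simp add: inner_X_commute[of z])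
    assume y: "y \<in> X_space"
    show dl: "inner_X S (x - y) z = inner_X S x z - inner_X S y z"
      unfolding inner_X_def Bochner_Integration.integral_diff[OF inner_X_integrable[OF x z] inner_X_integrable[OF y z], symmetric]
      by (simp add: inner_diff_left)
    show "inner_X S z (x - y) = inner_X S z x - inner_X S z y"
      using dl by (simp add: inner_X_commute[of z])
    have "\<bar>inner_X S x y\<bar> \<le> (LINT \<zeta>|unit_leb. \<bar>x \<zeta> \<bullet> (Ham S \<zeta> *v y \<zeta>)\<bar>)"
      unfolding inner_X_def by (rule integral_abs_bound)
    also have "\<dots> \<le> (LINT \<zeta>|unit_leb. M * (norm (x \<zeta>) * norm (y \<zeta>)))"
    proof (rule integral_mono_AE)
      show "integrable unit_leb (\<lambda>\<zeta>. \<bar>x \<zeta> \<bullet> (Ham S \<zeta> *v y \<zeta>)\<bar>)" by (intro integrable_abs inner_X_integrable x y)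
      show "integrable unit_leb (\<lambda>\<zeta>. M * (norm (x \<zeta>) * norm (y \<zeta>)))"
        by (intro integrable_mult_right X_space_product_integrable x y)
      show "AE \<zeta> in unit_leb. \<bar>x \<zeta> \<bullet> (Ham S \<zeta> *v y \<zeta>)\<bar> \<le> M * (norm (x \<zeta>) * norm (y \<zeta>))"
        using AE_unit_leb_Ioo
      proof eventually_elim
        fix \<zeta> :: real assume "\<zeta> \<in> {0<..<1}"
        then have "norm (Ham S \<zeta> *v y \<zeta>) \<le> M * norm (y \<zeta>)" using b(4) by simp
        then have "\<bar>x \<zeta> \<bullet> (Ham S \<zeta> *v y \<zeta>)\<bar> \<le> norm (x \<zeta>) * (M * norm (y \<zeta>))"
          by (intro order_trans[OF Cauchy_Schwarz_ineq2] mult_left_mono norm_ge_zero)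
        then show "\<bar>x \<zeta> \<bullet> (Ham S \<zeta> *v y \<zeta>)\<bar> \<le> M * (norm (x \<zeta>) * norm (y \<zeta>))" by (simp add: mult_ac)
      qed
    qed
    also have "\<dots> = M * (LINT \<zeta>|unit_leb. norm (x \<zeta>) * norm (y \<zeta>))" by simp
    also have "\<dots> \<le> M * (l2 x * l2 y)" by (intro mult_left_mono l2_Cauchy_Schwarz x y b)
    finally show "\<bar>inner_X S x y\<bar> \<le> M * l2 x * l2 y" by (simp add: mult_ac)
  qed
  then show ?thesis using b lower by (intro that[of m M]) auto
qed

lemma norm_X_square:
  shows "(norm_X S x)\<^sup>2 = inner_X S x x" and "0 \<le> inner_X S x x"
proof -
  obtain m M L where m: "0 < m" "\<forall>\<zeta>\<in>{0..1}. \<forall>v. m * (norm v)\<^sup>2 \<le> v \<bullet> (Ham S \<zeta> *v v)"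
    by (rule Ham_bounds)
  have "0 \<le> x \<zeta> \<bullet> (Ham S \<zeta> *v x \<zeta>)" if "\<zeta> \<in> {0<..<1}" for \<zeta>
  proof -
    have "0 \<le> m * (norm (x \<zeta>))\<^sup>2" "m * (norm (x \<zeta>))\<^sup>2 \<le> x \<zeta> \<bullet> (Ham S \<zeta> *v x \<zeta>)"
      using m that by simp_all
    then show ?thesis by (rule order_trans)
  qed
  then show "0 \<le> inner_X S x x"
    unfolding inner_X_def by (intro integral_nonneg_AE eventually_mono[OF AE_unit_leb_Ioo])
  then show "(norm_X S x)\<^sup>2 = inner_X S x x" by (simp add: norm_X_def)
qed

end

section \<open>The controller\<close>

text \<open>The constant is the minimum of the quadratic form on the unit sphere, which is
  compact.\<close>

lemma pos_def_mat_coercive: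
  fixes M :: "real^'n^'n"
  assumes M: "pos_def_mat M"
  obtains k where "0 < k" "\<forall>v. k * (norm v)\<^sup>2 \<le> v \<bullet> (M *v v)"
proof -
  have c: "continuous_on (sphere 0 1) (\<lambda>v. v \<bullet> (M *v v))"
    by (intro continuous_on_inner continuous_on_id linear_continuous_on_compose[OF continuous_on_id matrix_vector_mul_linear])
  have ne: "sphere (0::real^'n) 1 \<noteq> {}" by simp
  obtain u where u: "u \<in> sphere 0 1" "\<forall>v\<in>sphere 0 1. u \<bullet> (M *v u) \<le> v \<bullet> (M *v v)"
    using continuous_attains_inf[OF compact_sphere ne c] by blast
  define k where "k = u \<bullet> (M *v u)"
  have "u \<noteq> 0" using u(1) by auto
  then have "0 < k" using M by (simp add: k_def pos_def_mat_def)
  moreover have "k * (norm v)\<^sup>2 \<le> v \<bullet> (M *v v)" for v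
  proof (cases "v = 0")
    case False
    define e where "e = v /\<^sub>R norm v"
    have v: "v = norm v *\<^sub>R e" using False by (simp add: e_def)
    have "e \<in> sphere 0 1" using False by (simp add: e_def)
    then have "k \<le> e \<bullet> (M *v e)" using u(2) by (simp add: k_def)
    then have "k * (norm v)\<^sup>2 \<le> (e \<bullet> (M *v e)) * (norm v)\<^sup>2" by (intro mult_right_mono) auto
    also have "\<dots> = (norm v *\<^sub>R e) \<bullet> (M *v (norm v *\<^sub>R e))"
      by (simp add: matrix_vector_mult_scaleR power2_eq_square)
    also have "\<dots> = v \<bullet> (M *v v)" using v by simp
    finally show ?thesis .
  qed simp
  ultimately show ?thesis using that by blast
qed

lemma square_add_le: "(a + b)\<^sup>2 \<le> 2 * a\<^sup>2 + 2 * (b::real)\<^sup>2"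
  using sum_squares_bound[of a b] by (simp add: power2_sum)

lemma young:
  fixes a b \<epsilon> :: real
  assumes "0 < \<epsilon>"
  shows "a * b \<le> \<epsilon> * a\<^sup>2 + b\<^sup>2 / (4 * \<epsilon>)"
proof -
  have "0 \<le> (2 * \<epsilon> * a - b)\<^sup>2 / (4 * \<epsilon>)" using assms by simp
  also have "\<dots> = \<epsilon> * a\<^sup>2 + b\<^sup>2 / (4 * \<epsilon>) - a * b"
    using assms by (simp add: power2_diff power_mult_distrib field_simps power2_eq_square)
  finally show ?thesis by simp
qed

text \<open>\<open>E\<close> is the energy and \<open>g\<close> the correction to it; \<open>s\<close>, \<open>P\<close>, \<open>n\<close>, \<open>D\<close> stand for the dissipation
  \<open>|K v\<^sub>2|\<^sup>2 + |y|\<^sup>2\<close>, the potential energy, \<open>\<parallel>x\<parallel>\<^sup>2\<close> and the disturbances. Since \<open>\<epsilon> g\<close> is at most \<open>E/5\<close>, the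
  energy estimate loses only the factor \<open>3/2 < 3\<close>, which the final gain functions can afford.\<close>

lemma lyapunov_combination:
  fixes a b C :: real
  assumes "0 < a" "0 < b" "0 < C"
  obtains \<epsilon> c C' where "0 < \<epsilon>" "0 < c" "0 < C'"
    "\<And>E g e' g' s P n D :: real. 0 \<le> s \<Longrightarrow> 0 \<le> P \<Longrightarrow> 0 \<le> n \<Longrightarrow> 0 \<le> D \<Longrightarrow> 0 \<le> E \<Longrightarrow>
       e' \<le> - a * s + C * D \<Longrightarrow> g' \<le> - b * (P + n) + C * (s + D) \<Longrightarrow> E \<le> C * (s + P + n) \<Longrightarrow> \<bar>g\<bar> \<le> C * E \<Longrightarrow>
       e' + \<epsilon> * g' \<le> - c * (E + \<epsilon> * g) + C' * D"
    "\<And>E g :: real. \<bar>g\<bar> \<le> C * E \<Longrightarrow> \<bar>\<epsilon> * g\<bar> \<le> E / 5"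
proof -
  \<comment> \<open>The first bound lets half of the dissipation \<open>a * s\<close> survive the
    term \<epsilon> C s; the second keeps \<epsilon> g within E/5.\<close>
  define \<epsilon> where "\<epsilon> = min (a / (2 * C)) (1 / (5 * C))"
  \<comment> \<open>A rate common to \<open>s\<close> (what is left of its dissipation) and to
    \<open>P\<close> and \<open>n\<close> (from the correction).\<close>
  define k where "k = min (a / 2) (\<epsilon> * b)"
  have \<epsilon>: "0 < \<epsilon>" "\<epsilon> \<le> a / (2 * C)" "\<epsilon> \<le> 1 / (5 * C)" using assms by (auto simp: \<epsilon>_def)
  have \<epsilon>': "\<epsilon> * C \<le> a / 2" "\<epsilon> * C \<le> 1 / 5" using \<epsilon> assms by (auto simp: field_simps)
  have k: "0 < k" "k \<le> a / 2" "k \<le> \<epsilon> * b" using assms \<epsilon> by (auto simp: k_def)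
  have small: "\<bar>\<epsilon> * g\<bar> \<le> E / 5" if g: "\<bar>g\<bar> \<le> C * E" for g E
  proof -
    have E: "0 \<le> E" using order_trans[OF abs_ge_zero g] assms by (simp add: zero_le_mult_iff)
    have "\<bar>\<epsilon> * g\<bar> \<le> \<epsilon> * (C * E)" using g \<epsilon> by (simp add: abs_mult)
    also have "\<dots> = (\<epsilon> * C) * E" by simp
    also have "\<dots> \<le> 1 / 5 * E" by (intro mult_right_mono \<epsilon>' E)
    finally show ?thesis by simp
  qed
  show ?thesis
  \<comment> \<open>The rate \<open>k\<close> is with respect to s + P + n; passing to E costs 1/C,
    and passing from E to E + \<epsilon> g \<le> 6/5 E costs the factor 5/6.\<close>
  proof (rule that[of \<epsilon> "k / C * (5 / 6)" "C + \<epsilon> * C"])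
    show "0 < \<epsilon>" "0 < k / C * (5 / 6)" "0 < C + \<epsilon> * C" using assms k \<epsilon> by (auto intro: add_pos_pos)
    show "\<bar>\<epsilon> * g\<bar> \<le> E / 5" if "\<bar>g\<bar> \<le> C * E" for E g by (rule small[OF that])
    fix E g e' g' s P n D :: real
    assume nn: "0 \<le> s" "0 \<le> P" "0 \<le> n" "0 \<le> D" "0 \<le> E"
      and e': "e' \<le> - a * s + C * D" and g': "g' \<le> - b * (P + n) + C * (s + D)"
      and E: "E \<le> C * (s + P + n)" and g: "\<bar>g\<bar> \<le> C * E"
    have "\<epsilon> * g' \<le> \<epsilon> * (- b * (P + n) + C * (s + D))" using g' \<epsilon> by simp
    also have "\<dots> = - (\<epsilon> * b) * (P + n) + (\<epsilon> * C) * s + \<epsilon> * C * D" by (simp add: algebra_simps)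
    also have "\<dots> \<le> - k * (P + n) + a / 2 * s + \<epsilon> * C * D"
      using k \<epsilon>' nn assms by (intro add_mono mult_right_mono) auto
    finally have "e' + \<epsilon> * g' \<le> - (a / 2) * s - k * (P + n) + (C + \<epsilon> * C) * D"
      using e' by (simp add: algebra_simps)
    moreover have "k * s \<le> a / 2 * s" using k nn by (intro mult_right_mono) auto
    ultimately have 1: "e' + \<epsilon> * g' \<le> - (k * (s + P + n)) + (C + \<epsilon> * C) * D"
      by (simp add: algebra_simps)
    have "k / C * E \<le> k / C * (C * (s + P + n))" using E k assms by (intro mult_left_mono) auto
    then have 2: "k / C * E \<le> k * (s + P + n)" using assms by simp
    have "E + \<epsilon> * g \<le> 6 / 5 * E" using small[OF g] by (simp add: abs_le_iff)
    then have "k / C * (5 / 6) * (E + \<epsilon> * g) \<le> k / C * (5 / 6) * (6 / 5 * E)"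
      using k assms by (intro mult_left_mono) auto
    then have 3: "k / C * (5 / 6) * (E + \<epsilon> * g) \<le> k / C * E" by (simp add: mult.commute)
    show "e' + \<epsilon> * g' \<le> - (k / C * (5 / 6)) * (E + \<epsilon> * g) + (C + \<epsilon> * C) * D"
      using 1 2 3 unfolding minus_mult_left[symmetric] by linarith
  qed
qed

locale ctrl =
  fixes G :: "('m::finite, 'c::finite) ctrl"
  assumes controller: "nonlinear_controller G"
    and B1: "\<exists>c1_up>0. \<exists>c1_low>0. \<forall>v1.
               c1_up * (v1 \<bullet> grad (Pot G) v1) \<ge> Pot G v1 \<and> Pot G v1 \<ge> c1_low * (norm v1)\<^sup>2"
    and B2: "\<exists>c2_up>0. \<exists>c2_low>0. \<forall>v2.
               c2_up * (v2 \<bullet> Res G v2) \<ge> (norm v2)\<^sup>2 \<and> (norm v2)\<^sup>2 \<ge> c2_low * (norm (Res G v2))\<^sup>2"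
begin

lemma Kc_symmetric: "v \<bullet> (Kc G *v w) = (Kc G *v v) \<bullet> w"
  using controller by (intro symmetric_mat_inner) (simp add: nonlinear_controller_def pos_def_mat_def)

lemma Kc_coercive: obtains k where "0 < k" "\<forall>v. k * (norm v)\<^sup>2 \<le> v \<bullet> (Kc G *v v)"
  using controller pos_def_mat_coercive unfolding nonlinear_controller_def by blast

lemma Kc_nonneg: "0 \<le> v \<bullet> (Kc G *v v)"
  by (rule Kc_coercive) (meson mult_nonneg_nonneg less_imp_le zero_le_power2 order_trans)

lemma Pot_nonneg: "0 \<le> Pot G v"
  using controller by (simp add: nonlinear_controller_def)

text \<open>The plant input \<open>u = d - y\<^sub>c\<close> and the right-hand side for \<open>v\<^sub>2\<close>, as functions of the output \<open>y\<close>.\<close>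

definition u_in :: "real^'c \<Rightarrow> real^'m \<Rightarrow> real^'m \<Rightarrow> real^'m \<Rightarrow> real^'m" where
  "u_in v2 y d dc = d - Sc G *v dc - transpose (Bc G) *v (Kc G *v v2) - Sc G *v y"

definition v2_dot :: "real^'c \<Rightarrow> real^'c \<Rightarrow> real^'m \<Rightarrow> real^'m \<Rightarrow> real^'c" where
  "v2_dot v1 v2 y dc = - grad (Pot G) v1 - Res G (Kc G *v v2) + Bc G *v y + Bc G *v dc"

text \<open>(A1) bounds the traces by input and output, but the energy balance dissipates only K v_2
  and y. Through the feedback the input costs no more than these and the disturbances.\<close>

lemma u_in_bound:
  obtains C where "0 < C"
    "\<forall>v2 y d dc. (norm (u_in v2 y d dc))\<^sup>2 \<le> C * ((norm (Kc G *v v2))\<^sup>2 + (norm y)\<^sup>2 + (norm d)\<^sup>2 + (norm dc)\<^sup>2)"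
proof -
  define C where "C = 4 * (1 + (norm (Sc G))\<^sup>2 + (norm (transpose (Bc G)))\<^sup>2)"
  have "(norm (u_in v2 y d dc))\<^sup>2 \<le> C * ((norm (Kc G *v v2))\<^sup>2 + (norm y)\<^sup>2 + (norm d)\<^sup>2 + (norm dc)\<^sup>2)" for v2 y d dc
  proof -
    define w where "w = Kc G *v v2"
    define S T where "S = norm (Sc G)" and "T = norm (transpose (Bc G))"
    have "norm (u_in v2 y d dc) \<le> (norm d + norm (Sc G *v dc)) + (norm (transpose (Bc G) *v w) + norm (Sc G *v y))"
      unfolding u_in_def w_def[symmetric]
      using norm_triangle_ineq4[of d "Sc G *v dc"] norm_triangle_ineq4[of "d - Sc G *v dc" "transpose (Bc G) *v w"]
        norm_triangle_ineq4[of "d - Sc G *v dc - transpose (Bc G) *v w" "Sc G *v y"] by linarith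
    also have "\<dots> \<le> (norm d + S * norm dc) + (T * norm w + S * norm y)"
      unfolding S_def T_def by (intro add_mono norm_matrix_vector_mult_le order_refl)
    finally have "(norm (u_in v2 y d dc))\<^sup>2 \<le> ((norm d + S * norm dc) + (T * norm w + S * norm y))\<^sup>2"
      by (intro power_mono) auto
    also have "\<dots> \<le> 2 * (norm d + S * norm dc)\<^sup>2 + 2 * (T * norm w + S * norm y)\<^sup>2"
      by (rule square_add_le)
    also have "\<dots> \<le> 2 * (2 * (norm d)\<^sup>2 + 2 * (S * norm dc)\<^sup>2) + 2 * (2 * (T * norm w)\<^sup>2 + 2 * (S * norm y)\<^sup>2)"
      by (intro add_mono mult_left_mono square_add_le) auto
    also have "\<dots> = 4 * (1 * (norm d)\<^sup>2 + S\<^sup>2 * (norm dc)\<^sup>2 + T\<^sup>2 * (norm w)\<^sup>2 + S\<^sup>2 * (norm y)\<^sup>2)"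
      by (simp add: power_mult_distrib)
    also have "\<dots> \<le> 4 * ((1 + S\<^sup>2 + T\<^sup>2) * (norm d)\<^sup>2 + (1 + S\<^sup>2 + T\<^sup>2) * (norm dc)\<^sup>2 + (1 + S\<^sup>2 + T\<^sup>2) * (norm w)\<^sup>2 + (1 + S\<^sup>2 + T\<^sup>2) * (norm y)\<^sup>2)"
      by (intro mult_left_mono add_mono mult_right_mono) auto
    also have "\<dots> = C * ((norm w)\<^sup>2 + (norm y)\<^sup>2 + (norm d)\<^sup>2 + (norm dc)\<^sup>2)"
      by (simp add: C_def S_def T_def algebra_simps)
    finally show ?thesis unfolding w_def .
  qed
  moreover have "0 < C" by (simp add: C_def add_pos_nonneg)
  ultimately show ?thesis using that by blast
qed

text \<open>The power balance after the plant's own power has been bounded by u . y. The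
  interconnection conserves power: the terms with the gradient cancel, as do y . B_c^T K v_2 and K
  v_2 . B_c y. What remains is the damping by S_c and the resistance, and the work of the
  disturbances.\<close>

lemma energy_rate:
  obtains a C where "0 < a" "0 < C"
    "\<forall>v1 v2 y d dc. u_in v2 y d dc \<bullet> y + grad (Pot G) v1 \<bullet> (Kc G *v v2) + (Kc G *v v2) \<bullet> v2_dot v1 v2 y dc
       \<le> - a * ((norm (Kc G *v v2))\<^sup>2 + (norm y)\<^sup>2) + C * ((norm d)\<^sup>2 + (norm dc)\<^sup>2)"
proof -
  obtain c2 where c2: "0 < c2" "\<forall>v2. c2 * (v2 \<bullet> Res G v2) \<ge> (norm v2)\<^sup>2" using B2 by blast
  obtain \<delta> where \<delta>: "0 < \<delta>" "\<forall>v. \<delta> * (norm v)\<^sup>2 \<le> v \<bullet> (Sc G *v v)"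
    using controller pos_def_mat_coercive unfolding nonlinear_controller_def by blast
  define a where "a = min (1 / c2) \<delta>"
  have a: "0 < a" "a \<le> 1 / c2" "a \<le> \<delta>" using c2 \<delta> by (auto simp: a_def)
  define S T where "S = norm (Sc G)" and "T = norm (Bc G)"
  \<comment> \<open>Young's inequality with weight a/2 is applied once to y and once to w = K v_2,
    so half of the damping is kept; each application contributes a coefficient 1/(2 a).\<close>
  define C where "C = (2 + 2 * S\<^sup>2 + T\<^sup>2) / (2 * a)"
  have "u_in v2 y d dc \<bullet> y + grad (Pot G) v1 \<bullet> (Kc G *v v2) + (Kc G *v v2) \<bullet> v2_dot v1 v2 y dc
       \<le> - (a / 2) * ((norm (Kc G *v v2))\<^sup>2 + (norm y)\<^sup>2) + C * ((norm d)\<^sup>2 + (norm dc)\<^sup>2)" for v1 v2 y d dc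
  proof -
    define w where "w = Kc G *v v2"
    have tr: "(transpose (Bc G) *v w) \<bullet> y = w \<bullet> (Bc G *v y)"
      by (metis dot_lmul_matrix vector_transpose_matrix transpose_transpose)
    have eq: "u_in v2 y d dc \<bullet> y + grad (Pot G) v1 \<bullet> w + w \<bullet> v2_dot v1 v2 y dc
        = y \<bullet> (d - Sc G *v dc) - y \<bullet> (Sc G *v y) - w \<bullet> Res G w + w \<bullet> (Bc G *v dc)"
      unfolding u_in_def v2_dot_def w_def[symmetric] inner_diff_left tr inner_diff_right inner_add_right inner_minus_right
      by (simp add: inner_commute)
    have "(norm w)\<^sup>2 / c2 \<le> w \<bullet> Res G w" using c2 by (simp add: pos_divide_le_eq mult.commute)
    moreover have "a * (norm w)\<^sup>2 \<le> 1 / c2 * (norm w)\<^sup>2" by (intro mult_right_mono a) auto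
    ultimately have 1: "a * (norm w)\<^sup>2 \<le> w \<bullet> Res G w" by simp
    have "a * (norm y)\<^sup>2 \<le> \<delta> * (norm y)\<^sup>2" by (intro mult_right_mono a) auto
    then have 2: "a * (norm y)\<^sup>2 \<le> y \<bullet> (Sc G *v y)" using \<delta> by (meson order_trans)
    have "norm (d - Sc G *v dc) \<le> norm d + S * norm dc"
      using norm_triangle_ineq4[of d "Sc G *v dc"] norm_matrix_vector_mult_le[of "Sc G" dc] by (simp add: S_def)
    then have sq: "(norm (d - Sc G *v dc))\<^sup>2 \<le> 2 * (norm d)\<^sup>2 + 2 * (S * norm dc)\<^sup>2"
      using square_add_le[of "norm d" "S * norm dc"] power_mono[OF _ norm_ge_zero] by (meson order_trans)
    have "y \<bullet> (d - Sc G *v dc) \<le> norm y * norm (d - Sc G *v dc)" by (rule norm_cauchy_schwarz)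
    also have "\<dots> \<le> a / 2 * (norm y)\<^sup>2 + (norm (d - Sc G *v dc))\<^sup>2 / (4 * (a / 2))"
      using a by (intro young) auto
    also have "\<dots> \<le> a / 2 * (norm y)\<^sup>2 + (2 * (norm d)\<^sup>2 + 2 * (S * norm dc)\<^sup>2) / (4 * (a / 2))"
      using a sq by (intro add_mono divide_right_mono) auto
    finally have 3: "y \<bullet> (d - Sc G *v dc) \<le> a / 2 * (norm y)\<^sup>2 + (2 * (norm d)\<^sup>2 + 2 * S\<^sup>2 * (norm dc)\<^sup>2) / (2 * a)"
      by (simp add: power_mult_distrib mult.assoc)
    have "w \<bullet> (Bc G *v dc) \<le> norm w * norm (Bc G *v dc)" by (rule norm_cauchy_schwarz)
    also have "\<dots> \<le> norm w * (T * norm dc)"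
      unfolding T_def by (intro mult_left_mono norm_matrix_vector_mult_le) auto
    also have "\<dots> \<le> a / 2 * (norm w)\<^sup>2 + (T * norm dc)\<^sup>2 / (4 * (a / 2))"
      using a by (intro young) auto
    finally have 4: "w \<bullet> (Bc G *v dc) \<le> a / 2 * (norm w)\<^sup>2 + T\<^sup>2 * (norm dc)\<^sup>2 / (2 * a)"
      by (simp add: power_mult_distrib)
    have "(2 * (norm d)\<^sup>2 + 2 * S\<^sup>2 * (norm dc)\<^sup>2) / (2 * a) + T\<^sup>2 * (norm dc)\<^sup>2 / (2 * a)
        = (2 * (norm d)\<^sup>2 + (2 * S\<^sup>2 + T\<^sup>2) * (norm dc)\<^sup>2) / (2 * a)"
      by (simp add: add_divide_distrib[symmetric] algebra_simps)
    also have "\<dots> \<le> ((2 + 2 * S\<^sup>2 + T\<^sup>2) * (norm d)\<^sup>2 + (2 + 2 * S\<^sup>2 + T\<^sup>2) * (norm dc)\<^sup>2) / (2 * a)"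
      using a by (intro divide_right_mono add_mono mult_right_mono) auto
    also have "\<dots> = C * ((norm d)\<^sup>2 + (norm dc)\<^sup>2)" by (simp add: C_def algebra_simps)
    finally show ?thesis
      unfolding w_def[symmetric] eq using 1 2 3 4 by (simp add: algebra_simps)
  qed
  moreover have "0 < a / 2" "0 < C" using a by (auto simp: C_def add_pos_nonneg)
  ultimately show ?thesis using that by blast
qed

text \<open>The rate of v_1 . v_2. Its term - v_1 . grad P supplies, by (B1), the decay of the
  potential energy that the power balance lacks; all other terms are paid for by the dissipation or
  the disturbance.\<close>

lemma cross_rate:
  obtains a C where "0 < a" "0 < C"
    "\<forall>v1 v2 y dc. (Kc G *v v2) \<bullet> v2 + v1 \<bullet> v2_dot v1 v2 y dc
       \<le> - a * Pot G v1 + C * ((norm (Kc G *v v2))\<^sup>2 + (norm y)\<^sup>2 + (norm dc)\<^sup>2)"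
proof -
  obtain k where k: "0 < k" "\<forall>v. k * (norm v)\<^sup>2 \<le> v \<bullet> (Kc G *v v)" by (rule Kc_coercive)
  obtain c1 cl where c1: "0 < c1" "\<forall>v1. c1 * (v1 \<bullet> grad (Pot G) v1) \<ge> Pot G v1"
    and cl: "0 < cl" "\<forall>v1. Pot G v1 \<ge> cl * (norm v1)\<^sup>2" using B1 by blast
  obtain r where r: "0 < r" "\<forall>v2. (norm v2)\<^sup>2 \<ge> r * (norm (Res G v2))\<^sup>2" using B2 by blast
  define T where "T = norm (Bc G)"
  \<comment> \<open>With this weight in Young's inequality the lower bound in (B1) gives e |v_1|^2
    \<le> P/(2 c_1), half of the decay just obtained.\<close>
  define e where "e = cl / (2 * c1)"
  have e: "0 < e" using c1 cl by (simp add: e_def)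
  define K where "K = 4 * (1 / r + T\<^sup>2) / (4 * e)"
  have K: "0 < K" using e r by (simp add: K_def add_pos_nonneg)
  define C where "C = 1 / k + K"
  have "(Kc G *v v2) \<bullet> v2 + v1 \<bullet> v2_dot v1 v2 y dc
       \<le> - (1 / (2 * c1)) * Pot G v1 + C * ((norm (Kc G *v v2))\<^sup>2 + (norm y)\<^sup>2 + (norm dc)\<^sup>2)" for v1 v2 y dc
  proof -
    define w where "w = Kc G *v v2"
    have "k * (norm v2)\<^sup>2 \<le> norm v2 * norm w"
      using k(2)[rule_format, of v2] norm_cauchy_schwarz[of v2 w] unfolding w_def by linarith
    then have "k * norm v2 \<le> norm w"
      by (cases "v2 = 0") (auto simp: power2_eq_square mult.left_commute)
    then have "norm v2 \<le> norm w / k" using k by (simp add: pos_le_divide_eq mult.commute)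
    then have "norm w * norm v2 \<le> norm w * (norm w / k)" by (intro mult_left_mono) auto
    then have 1: "w \<bullet> v2 \<le> 1 / k * (norm w)\<^sup>2"
      using norm_cauchy_schwarz[of w v2] by (simp add: power2_eq_square)
    have 2: "Pot G v1 / c1 \<le> v1 \<bullet> grad (Pot G) v1" using c1 by (simp add: pos_divide_le_eq mult.commute)
    define R where "R = (norm (Res G w) + T * norm y) + T * norm dc"
    have "norm (- Res G w + Bc G *v y + Bc G *v dc) \<le> R"
      using norm_triangle_ineq[of "- Res G w + Bc G *v y" "Bc G *v dc"] norm_triangle_ineq[of "- Res G w" "Bc G *v y"]
        norm_matrix_vector_mult_le[of "Bc G" y] norm_matrix_vector_mult_le[of "Bc G" dc]
      by (simp add: R_def T_def)
    then have "v1 \<bullet> (- Res G w + Bc G *v y + Bc G *v dc) \<le> norm v1 * R"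
      using norm_cauchy_schwarz[of v1 "- Res G w + Bc G *v y + Bc G *v dc"] mult_left_mono[OF _ norm_ge_zero[of v1]]
      by (meson order_trans)
    also have "\<dots> \<le> e * (norm v1)\<^sup>2 + R\<^sup>2 / (4 * e)" by (rule young[OF e])
    also have "e * (norm v1)\<^sup>2 \<le> Pot G v1 / (2 * c1)"
      using cl(2)[rule_format, of v1] c1(1) by (simp add: e_def divide_right_mono)
    also have "R\<^sup>2 / (4 * e) \<le> K * ((norm w)\<^sup>2 + (norm y)\<^sup>2 + (norm dc)\<^sup>2)"
    proof -
      have Rw: "(norm (Res G w))\<^sup>2 \<le> 1 / r * (norm w)\<^sup>2" using r by (simp add: pos_le_divide_eq mult.commute)
      have "R\<^sup>2 \<le> 2 * (norm (Res G w) + T * norm y)\<^sup>2 + 2 * (T * norm dc)\<^sup>2"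
        unfolding R_def by (rule square_add_le)
      also have "\<dots> \<le> 2 * (2 * (norm (Res G w))\<^sup>2 + 2 * (T * norm y)\<^sup>2) + 2 * (T * norm dc)\<^sup>2"
        by (intro add_mono mult_left_mono square_add_le) auto
      also have "\<dots> \<le> 4 * (1 / r * (norm w)\<^sup>2 + T\<^sup>2 * (norm y)\<^sup>2 + T\<^sup>2 * (norm dc)\<^sup>2)"
      proof -
        have "2 * (2 * A + 2 * B) + 2 * D \<le> 4 * (E + B + D)" if "A \<le> E" "0 \<le> D" for A B D E :: real
          using that by (auto simp: distrib_left)
        from this[OF Rw mult_nonneg_nonneg[OF zero_le_power2[of T] zero_le_power2[of "norm dc"]]]
        show ?thesis unfolding power_mult_distrib .
      qed
      also have "\<dots> \<le> 4 * ((1 / r + T\<^sup>2) * (norm w)\<^sup>2 + (1 / r + T\<^sup>2) * (norm y)\<^sup>2 + (1 / r + T\<^sup>2) * (norm dc)\<^sup>2)"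
        using r by (intro mult_left_mono add_mono mult_right_mono) auto
      also have "\<dots> = 4 * (1 / r + T\<^sup>2) * ((norm w)\<^sup>2 + (norm y)\<^sup>2 + (norm dc)\<^sup>2)"
        by (simp add: algebra_simps)
      finally have "R\<^sup>2 \<le> 4 * (1 / r + T\<^sup>2) * ((norm w)\<^sup>2 + (norm y)\<^sup>2 + (norm dc)\<^sup>2)" .
      then have "R\<^sup>2 / (4 * e) \<le> 4 * (1 / r + T\<^sup>2) * ((norm w)\<^sup>2 + (norm y)\<^sup>2 + (norm dc)\<^sup>2) / (4 * e)"
        using e by (intro divide_right_mono) auto
      then show ?thesis by (simp only: K_def times_divide_eq_left)
    qed
    finally have 3: "v1 \<bullet> (- Res G w + Bc G *v y + Bc G *v dc) \<le> Pot G v1 / (2 * c1) + K * ((norm w)\<^sup>2 + (norm y)\<^sup>2 + (norm dc)\<^sup>2)"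
      by simp
    have 4: "v1 \<bullet> v2_dot v1 v2 y dc = - (v1 \<bullet> grad (Pot G) v1) + v1 \<bullet> (- Res G w + Bc G *v y + Bc G *v dc)"
      unfolding v2_dot_def w_def[symmetric] by (simp add: inner_diff_right inner_add_right)
    have 5: "1 / k * (norm w)\<^sup>2 \<le> 1 / k * ((norm w)\<^sup>2 + (norm y)\<^sup>2 + (norm dc)\<^sup>2)"
      using k by (intro mult_left_mono) auto
    have 6: "Pot G v1 / c1 = Pot G v1 / (2 * c1) + 1 / (2 * c1) * Pot G v1" using c1 by (simp add: field_simps)
    have "w \<bullet> v2 + v1 \<bullet> v2_dot v1 v2 y dc \<le> - (1 / (2 * c1) * Pot G v1) + (1 / k * ((norm w)\<^sup>2 + (norm y)\<^sup>2 + (norm dc)\<^sup>2) + K * ((norm w)\<^sup>2 + (norm y)\<^sup>2 + (norm dc)\<^sup>2))"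
      unfolding 4 using 1 2 3 5 6 by linarith
    then show ?thesis unfolding w_def[symmetric] C_def distrib_right by (simp only: mult_minus_left)
  qed
  moreover have "0 < 1 / (2 * c1)" "0 < C" using c1 k K by (auto simp: C_def add_pos_pos)
  ultimately show ?thesis using that by blast
qed

text \<open>What the Lyapunov argument asks of the controller: the correction is small compared with
  the energy, and the dissipated quantity |K v_2|^2 dominates the kinetic energy.\<close>

lemma cross_bound:
  obtains C where "0 < C" "\<forall>v1 v2. \<bar>v1 \<bullet> v2\<bar> \<le> C * (Pot G v1 + 1 / 2 * (v2 \<bullet> (Kc G *v v2)))"
    "\<forall>v2. v2 \<bullet> (Kc G *v v2) \<le> C * (norm (Kc G *v v2))\<^sup>2"
proof -
  obtain k where k: "0 < k" "\<forall>v. k * (norm v)\<^sup>2 \<le> v \<bullet> (Kc G *v v)" by (rule Kc_coercive)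
  obtain cl where cl: "0 < cl" "\<forall>v1. Pot G v1 \<ge> cl * (norm v1)\<^sup>2" using B1 by blast
  define C where "C = 1 / cl + 1 / k"
  have C: "0 < C" using k cl by (simp add: C_def add_pos_pos)
  have "\<bar>v1 \<bullet> v2\<bar> \<le> C * (Pot G v1 + 1 / 2 * (v2 \<bullet> (Kc G *v v2)))" for v1 v2
  proof -
    have 1: "(norm v1)\<^sup>2 \<le> 1 / cl * Pot G v1" using cl by (simp add: pos_le_divide_eq mult.commute)
    have 2: "(norm v2)\<^sup>2 \<le> 1 / k * (v2 \<bullet> (Kc G *v v2))" using k by (simp add: pos_le_divide_eq mult.commute)
    have "\<bar>v1 \<bullet> v2\<bar> \<le> (norm v1)\<^sup>2 + (norm v2)\<^sup>2 / 2"
      using Cauchy_Schwarz_ineq2[of v1 v2] sum_squares_bound[of "norm v1" "norm v2"] zero_le_power2[of "norm v1"] by linarith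
    also have "\<dots> \<le> 1 / cl * Pot G v1 + 1 / k * (1 / 2 * (v2 \<bullet> (Kc G *v v2)))" using 1 2 by simp
    also have "\<dots> \<le> C * Pot G v1 + C * (1 / 2 * (v2 \<bullet> (Kc G *v v2)))"
      using k cl Pot_nonneg[of v1] Kc_nonneg[of v2] by (intro add_mono mult_right_mono) (auto simp: C_def)
    finally show ?thesis by (simp add: distrib_left)
  qed
  moreover have "v2 \<bullet> (Kc G *v v2) \<le> C * (norm (Kc G *v v2))\<^sup>2" for v2
  proof -
    define w where "w = Kc G *v v2"
    have kk: "k * (norm v2)\<^sup>2 \<le> v2 \<bullet> w" using k unfolding w_def by blast
    have "k * norm v2 * norm v2 \<le> norm w * norm v2"
      using kk norm_cauchy_schwarz[of v2 w] unfolding power2_eq_square mult.assoc mult.commute[of "norm w"] by linarith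
    then have "norm v2 \<le> norm w / k"
      using k by (cases "v2 = 0") (auto simp: pos_le_divide_eq mult.commute)
    then have "norm v2 * norm w \<le> norm w / k * norm w" by (intro mult_right_mono) auto
    then have "v2 \<bullet> w \<le> 1 / k * (norm w)\<^sup>2"
      using norm_cauchy_schwarz[of v2 w] by (simp add: power2_eq_square)
    also have "\<dots> \<le> C * (norm w)\<^sup>2" using cl by (intro mult_right_mono) (auto simp: C_def)
    finally show ?thesis unfolding w_def .
  qed
  ultimately show ?thesis using C that by blast
qed

end

section \<open>Energy decay along solutions\<close>

lemma time_dom_infinity: "time_dom \<infinity> = {0..}"
  by (auto simp: time_dom_def)

locale closed_loop = phs S + ctrl G
  for S :: "('n::finite, 'm::finite) phs" and G :: "('m, 'c::finite) ctrl" +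
  assumes passivity: "impedance_passive S"
    and A1: "\<exists>\<kappa>>0. \<forall>x\<in>dom_A S.
               \<kappa> * ((norm (crep (Hmul S x) 0))\<^sup>2 + (norm (crep (wD (Hmul S x)) 0))\<^sup>2
                     + (norm (crep (Hmul S x) 1))\<^sup>2)
               \<le> (norm (op_B S x))\<^sup>2 + (norm (op_C S x))\<^sup>2"
begin

lemma norm_cl_square:
  "(norm_cl S G z)\<^sup>2 = inner_X S (fst z) (fst z) + (norm (fst (snd z)))\<^sup>2 + snd (snd z) \<bullet> (Kc G *v snd (snd z))"
  using norm_X_square[of "fst z"] Kc_nonneg[of "snd (snd z)"]
  by (simp add: norm_cl_def norm_V_def split_beta)

lemma norm_cl_nonneg: "0 \<le> norm_cl S G z"
  by (simp add: norm_cl_def)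

lemma parts_le_norm_cl:
  obtains K where "0 < K" "\<forall>z\<in>cl_space. l2 (fst z) \<le> K * norm_cl S G z"
    "\<forall>z. norm (fst (snd z)) \<le> K * norm_cl S G z" "\<forall>z. norm (snd (snd z)) \<le> K * norm_cl S G z"
proof -
  obtain m M where m: "0 < m" "\<forall>x\<in>X_space. m * (l2 x)\<^sup>2 \<le> inner_X S x x"
    by (rule inner_X_self_bounds)
  obtain k where k: "0 < k" "\<forall>v. k * (norm v)\<^sup>2 \<le> v \<bullet> (Kc G *v v)" by (rule Kc_coercive)
  \<comment> \<open>\<open>L\<close> is at least 1, 1/m and 1/k. Hence e u^2 \<le> N^2 yields u^2
    \<le> L N^2 \<le> (L N)^2 in each of the cases e = m, 1, k.\<close>
  define L where "L = 1 + 1 / m + 1 / k"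
  have L: "1 \<le> L" "1 \<le> L * m" "1 \<le> L * k" using m(1) k(1) by (auto simp: L_def distrib_right)
  have scale: "u \<le> L * N" if "0 \<le> u" "0 \<le> N" "e * u\<^sup>2 \<le> N\<^sup>2" "1 \<le> L * e" "0 < e" for u N e :: real
  proof (rule power2_le_imp_le)
    have "u\<^sup>2 \<le> (L * e) * u\<^sup>2" using that(4) by (simp add: mult_le_cancel_right1)
    also have "\<dots> \<le> L * N\<^sup>2" using mult_left_mono[OF that(3), of L] L(1) by (simp add: mult.assoc)
    also have "\<dots> \<le> L * (L * N\<^sup>2)" using L(1) by (intro mult_left_mono) (auto simp: mult_le_cancel_right1)
    finally show "u\<^sup>2 \<le> (L * N)\<^sup>2" by (simp add: power2_eq_square mult_ac)
  qed (use that L in auto)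
  show ?thesis
  proof (rule that[of L])
    show "0 < L" using L by simp
    show "\<forall>z\<in>cl_space. l2 (fst z) \<le> L * norm_cl S G z"
    proof
      fix z :: "('n, 'c) cl_state" assume "z \<in> cl_space"
      then have "m * (l2 (fst z))\<^sup>2 \<le> inner_X S (fst z) (fst z)" using m(2) by (auto simp: cl_space_def)
      also have "\<dots> \<le> (norm_cl S G z)\<^sup>2"
        unfolding norm_cl_square using Kc_nonneg[of "snd (snd z)"] zero_le_power2[of "norm (fst (snd z))"] by linarith
      finally show "l2 (fst z) \<le> L * norm_cl S G z"
        using scale[OF l2_nonneg norm_cl_nonneg _ L(2) m(1)] by blast
    qed
    show "\<forall>z. norm (fst (snd z)) \<le> L * norm_cl S G z"
    proof
      fix z :: "('n, 'c) cl_state"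
      have "1 * (norm (fst (snd z)))\<^sup>2 \<le> (norm_cl S G z)\<^sup>2"
        unfolding norm_cl_square using Kc_nonneg[of "snd (snd z)"] norm_X_square(2)[of "fst z"] by linarith
      then show "norm (fst (snd z)) \<le> L * norm_cl S G z"
        using scale[OF norm_ge_zero norm_cl_nonneg, of 1] L(1) by simp
    qed
    show "\<forall>z. norm (snd (snd z)) \<le> L * norm_cl S G z"
    proof
      fix z :: "('n, 'c) cl_state"
      have "k * (norm (snd (snd z)))\<^sup>2 \<le> snd (snd z) \<bullet> (Kc G *v snd (snd z))" using k(2) by blast
      also have "\<dots> \<le> (norm_cl S G z)\<^sup>2"
        unfolding norm_cl_square using norm_X_square(2)[of "fst z"] zero_le_power2[of "norm (fst (snd z))"] by linarith
      finally show "norm (snd (snd z)) \<le> L * norm_cl S G z"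
        using scale[OF norm_ge_zero norm_cl_nonneg _ L(3) k(1)] by blast
    qed
  qed
qed

text \<open>Translates derivatives in the state norm into ordinary derivatives of v_1, v_2 and of
  every bounded form in x, so that the Lyapunov function can be differentiated termwise. The
  derivatives exist from t = 0 on, the equations hold for t > 0.\<close>

lemma classical_solution_derivatives:
  assumes cs: "classical_solution S G \<infinity> z d dc y"
  obtains z' where
    "\<And>t. 0 \<le> t \<Longrightarrow> fst (z t) \<in> dom_A S"
    "\<And>t. 0 \<le> t \<Longrightarrow> fst (z' t) \<in> X_space"
    "\<And>t. 0 \<le> t \<Longrightarrow> ((\<lambda>s. fst (snd (z s))) has_vector_derivative fst (snd (z' t))) (at t within {0..})"
    "\<And>t. 0 \<le> t \<Longrightarrow> ((\<lambda>s. snd (snd (z s))) has_vector_derivative snd (snd (z' t))) (at t within {0..})"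
    "\<And>b C t. l2_form b C \<Longrightarrow> 0 \<le> t \<Longrightarrow> ((\<lambda>s. b (fst (z s)) (fst (z s))) has_real_derivative
        b (fst (z' t)) (fst (z t)) + b (fst (z t)) (fst (z' t))) (at t within {0..})"
    "\<And>t. 0 < t \<Longrightarrow> AE \<zeta> in unit_leb. fst (z' t) \<zeta> = op_A S (fst (z t)) \<zeta>"
    "\<And>t. 0 < t \<Longrightarrow> fst (snd (z' t)) = Kc G *v snd (snd (z t))"
    "\<And>t. 0 < t \<Longrightarrow> snd (snd (z' t)) = v2_dot (fst (snd (z t))) (snd (snd (z t))) (y t) (dc t)"
    "\<And>t. 0 < t \<Longrightarrow> op_B S (fst (z t)) = u_in (snd (snd (z t))) (y t) (d t) (dc t)"
    "\<And>t. 0 < t \<Longrightarrow> op_C S (fst (z t)) = y t"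
proof -
  obtain z' where z: "cont_into (graph_norm_cl S G) (dom_cl S) {0..} z"
    and D: "has_cl_derivative (norm_cl S G) {0..} z z'"
    and z': "cont_into (norm_cl S G) cl_space {0..} z'"
    and eqs: "\<And>t. 0 < t \<Longrightarrow> cl_eq (z' t) (cl_A S G (z t) + cl_f G (z t) + cl_Bc (Bc G *v dc t))"
      "\<And>t. 0 < t \<Longrightarrow> cl_B S G (z t) = d t - Sc G *v dc t" "\<And>t. 0 < t \<Longrightarrow> cl_C S (z t) = y t"
    using cs unfolding classical_solution_def time_dom_infinity by (auto simp: less_imp_le)
  have dom: "fst (z t) \<in> dom_A S" if "0 \<le> t" for t
    using z that by (simp add: cont_into_def dom_cl_def mem_Times_iff)
  then have X: "fst (z t) \<in> X_space" if "0 \<le> t" for t using that by (auto simp: dom_A_def)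
  have X': "fst (z' t) \<in> X_space" if "0 \<le> t" for t
    using z' that by (simp add: cont_into_def cl_space_def mem_Times_iff)
  obtain K where K: "0 < K" "\<forall>z\<in>cl_space. l2 (fst z) \<le> K * norm_cl S G z"
    "\<forall>z. norm (fst (snd z)) \<le> K * norm_cl S G z" "\<forall>z. norm (snd (snd z)) \<le> K * norm_cl S G z"
    by (rule parts_le_norm_cl)
  have Dt: "((\<lambda>s. K * norm_cl S G (cl_scale (1 / (s - t)) (z s - z t) - z' t)) \<longlongrightarrow> 0) (at t within {0..})" if "0 \<le> t" for t
    using D that tendsto_mult_right_zero[of _ _ K] by (auto simp: has_cl_derivative_def)
  have lim0: "((\<lambda>s. norm_cl S G (z s - z t)) \<longlongrightarrow> 0) (at t within {0..})" if "0 \<le> t" for t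
  proof (rule Lim_null_comparison)
    show "((\<lambda>s. graph_norm_cl S G (z s - z t)) \<longlongrightarrow> 0) (at t within {0..})"
      using z that by (auto simp: cont_into_def)
    show "\<forall>\<^sub>F s in at t within {0..}. norm (norm_cl S G (z s - z t)) \<le> graph_norm_cl S G (z s - z t)"
      using norm_cl_nonneg by (intro always_eventually allI) (simp add: graph_norm_cl_def)
  qed
  \<comment> \<open>Here \<open>p\<close> is one of the two coordinate projections onto the
    controller state.\<close>
  have vd: "((\<lambda>s. p (z s)) has_vector_derivative p (z' t)) (at t within {0..})"
    if t: "0 \<le> t" and p: "\<And>z. norm (p z) \<le> K * norm_cl S G z"
      and lin: "\<And>a s. p (cl_scale a (z s - z t) - z' t) = a *\<^sub>R (p (z s) - p (z t)) - p (z' t)"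
    for p :: "('n, 'c) cl_state \<Rightarrow> real^'c" and t
  proof -
    have "((\<lambda>s. p (cl_scale (1 / (s - t)) (z s - z t) - z' t)) \<longlongrightarrow> 0) (at t within {0..})"
      by (rule Lim_null_comparison[OF _ Dt[OF t]]) (intro always_eventually allI p)
    then have "((\<lambda>s. (p (z s) - p (z t)) /\<^sub>R (s - t) - p (z' t)) \<longlongrightarrow> 0) (at t within {0..})"
      unfolding lin by (simp add: divide_inverse)
    then show ?thesis unfolding has_vector_derivative_iff_tendsto by (rule LIM_zero_cancel)
  qed
  have form: "((\<lambda>s. b (fst (z s)) (fst (z s))) has_real_derivative
        b (fst (z' t)) (fst (z t)) + b (fst (z t)) (fst (z' t))) (at t within {0..})"
    if b: "l2_form b C" and t: "0 \<le> t" for b C t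
  proof -
    interpret l2_form b C by (rule b)
    have ev: "\<forall>\<^sub>F s in at t within {0..}. 0 \<le> s" by (simp add: eventually_at_filter)
    show ?thesis
    proof (rule has_real_derivative)
      show "\<And>s. s \<in> {0..} \<Longrightarrow> fst (z s) \<in> X_space" using X by simp
      show "t \<in> {0..}" using t by simp
      show "fst (z' t) \<in> X_space" by (rule X'[OF t])
      show "((\<lambda>s. l2 ((\<lambda>\<zeta>. (1 / (s - t)) *\<^sub>R (fst (z s) - fst (z t)) \<zeta>) - fst (z' t))) \<longlongrightarrow> 0) (at t within {0..})"
      proof (rule Lim_null_comparison[OF _ Dt[OF t]])
        show "\<forall>\<^sub>F s in at t within {0..}. norm (l2 ((\<lambda>\<zeta>. (1 / (s - t)) *\<^sub>R (fst (z s) - fst (z t)) \<zeta>) - fst (z' t)))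
            \<le> K * norm_cl S G (cl_scale (1 / (s - t)) (z s - z t) - z' t)"
          using ev
        proof eventually_elim
          fix s :: real assume s: "0 \<le> s"
          define w where "w = cl_scale (1 / (s - t)) (z s - z t) - z' t"
          have fw: "fst w = (\<lambda>\<zeta>. (1 / (s - t)) *\<^sub>R (fst (z s) - fst (z t)) \<zeta>) - fst (z' t)"
            by (simp add: w_def cl_scale_def)
          have "fst w \<in> X_space"
            unfolding fw by (intro X_space_diff X_space_scale X X' s t)
          then have "w \<in> cl_space" by (cases w) (simp add: cl_space_def)
          then have "l2 (fst w) \<le> K * norm_cl S G w" using K(2) by blast
          then show "norm (l2 ((\<lambda>\<zeta>. (1 / (s - t)) *\<^sub>R (fst (z s) - fst (z t)) \<zeta>) - fst (z' t)))
            \<le> K * norm_cl S G (cl_scale (1 / (s - t)) (z s - z t) - z' t)"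
            unfolding fw[symmetric] w_def[symmetric] using l2_nonneg[of "fst w"] by simp
        qed
      qed
      show "((\<lambda>s. l2 (fst (z s) - fst (z t))) \<longlongrightarrow> 0) (at t within {0..})"
      proof (rule Lim_null_comparison[OF _ tendsto_mult_right_zero[OF lim0[OF t], of K]])
        show "\<forall>\<^sub>F s in at t within {0..}. norm (l2 (fst (z s) - fst (z t))) \<le> K * norm_cl S G (z s - z t)"
          using ev
        proof eventually_elim
          fix s :: real assume s: "0 \<le> s"
          have "fst (z s - z t) \<in> X_space" using X_space_diff[OF X[OF s] X[OF t]] by simp
          then have "z s - z t \<in> cl_space" by (cases "z s - z t") (simp add: cl_space_def)
          then have "l2 (fst (z s - z t)) \<le> K * norm_cl S G (z s - z t)" using K(2) by blast
          then show "norm (l2 (fst (z s) - fst (z t))) \<le> K * norm_cl S G (z s - z t)"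
            using l2_nonneg[of "fst (z s) - fst (z t)"] by simp
        qed
      qed
    qed
  qed
  show ?thesis
  proof (rule that[of z'])
    fix t :: real
    show "0 \<le> t \<Longrightarrow> fst (z t) \<in> dom_A S" by (rule dom)
    show "0 \<le> t \<Longrightarrow> fst (z' t) \<in> X_space" by (rule X')
    show "((\<lambda>s. fst (snd (z s))) has_vector_derivative fst (snd (z' t))) (at t within {0..})" if "0 \<le> t"
      using that K(3) by (intro vd[where p = "\<lambda>z. fst (snd z)"]) (auto simp: cl_scale_def)
    show "((\<lambda>s. snd (snd (z s))) has_vector_derivative snd (snd (z' t))) (at t within {0..})" if "0 \<le> t"
      using that K(4) by (intro vd[where p = "\<lambda>z. snd (snd z)"]) (auto simp: cl_scale_def)
    show "\<And>b C. l2_form b C \<Longrightarrow> 0 \<le> t \<Longrightarrow> ((\<lambda>s. b (fst (z s)) (fst (z s))) has_real_derivative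
        b (fst (z' t)) (fst (z t)) + b (fst (z t)) (fst (z' t))) (at t within {0..})"
      by (rule form)
    assume t: "0 < t"
    obtain x v1 v2 where zt: "z t = (x, v1, v2)" by (cases "z t") auto
    show C: "op_C S (fst (z t)) = y t" using eqs(3)[OF t] by (simp add: zt cl_C_def)
    show "op_B S (fst (z t)) = u_in (snd (snd (z t))) (y t) (d t) (dc t)"
      using eqs(2)[OF t] C by (simp add: zt cl_B_def u_in_def algebra_simps)
    show "AE \<zeta> in unit_leb. fst (z' t) \<zeta> = op_A S (fst (z t)) \<zeta>"
      using eqs(1)[OF t] by (simp add: zt cl_eq_def cl_A_def cl_f_def cl_Bc_def)
    show "fst (snd (z' t)) = Kc G *v snd (snd (z t))"
      using eqs(1)[OF t] by (simp add: zt cl_eq_def cl_A_def cl_f_def cl_Bc_def)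
    show "snd (snd (z' t)) = v2_dot (fst (snd (z t))) (snd (snd (z t))) (y t) (dc t)"
      using eqs(1)[OF t] C by (simp add: zt cl_eq_def cl_A_def cl_f_def cl_Bc_def v2_dot_def algebra_simps)
  qed
qed

end

text \<open>The rate inequality makes \<open>k\<close> below nondecreasing on t > 0, where the
  equations of a classical solution hold; continuity of \<open>k\<close> includes the initial
  time.\<close>

lemma gronwall_decay:
  fixes h h' D :: "real \<Rightarrow> real" and c C T :: real
  assumes T: "0 \<le> T" and c: "0 \<le> c" and C: "0 \<le> C"
    and h: "\<And>t. 0 \<le> t \<Longrightarrow> (h has_real_derivative h' t) (at t within {0..})"
    and h': "\<And>t. 0 < t \<Longrightarrow> h' t \<le> - c * h t + C * D t"
    and D: "continuous_on {0..} D" "\<And>t. 0 \<le> D t"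
  shows "h T \<le> exp (- c * T) * h 0 + C * integral {0..T} D"
proof -
  have cD: "continuous_on {0..T} D" by (rule continuous_on_subset[OF D(1)]) auto
  have ceD: "continuous_on {0..T} (\<lambda>s. exp (c * s) * D s)" by (intro continuous_intros cD)
  define J where "J t = integral {0..t} (\<lambda>s. exp (c * s) * D s)" for t
  define k where "k t = C * J t - exp (c * t) * h t" for t
  have sub: "{0..T} \<subseteq> {0..}" by auto
  have dk: "(k has_real_derivative C * (exp (c * t) * D t) - (exp (c * t) * c * h t + h' t * exp (c * t))) (at t within {0..T})"
    if t: "t \<in> {0..T}" for t
  proof -
    have "(J has_real_derivative exp (c * t) * D t) (at t within {0..T})"
      unfolding J_def by (rule integral_has_real_derivative[OF ceD t])
    moreover have "(h has_real_derivative h' t) (at t within {0..T})"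
      using t by (intro DERIV_subset[OF h sub]) auto
    moreover have "((\<lambda>t. exp (c * t)) has_real_derivative exp (c * t) * c) (at t within {0..T})"
      by (rule derivative_eq_intros refl | simp)+
    ultimately show ?thesis unfolding k_def
      by (intro DERIV_diff DERIV_cmult DERIV_mult)
  qed
  have "k 0 \<le> k T"
  proof (rule DERIV_nonneg_imp_increasing_open[OF T])
    show "continuous_on {0..T} k" by (rule DERIV_continuous_on[OF dk])
    fix t assume t: "0 < t" "t < T"
    have "(k has_real_derivative C * (exp (c * t) * D t) - (exp (c * t) * c * h t + h' t * exp (c * t))) (at t)"
      using dk[of t] t by (simp add: at_within_Icc_at)
    moreover have "0 \<le> exp (c * t) * (- c * h t + C * D t - h' t)"
      using h'[OF t(1)] by simp
    then have "0 \<le> C * (exp (c * t) * D t) - (exp (c * t) * c * h t + h' t * exp (c * t))"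
      by (simp add: algebra_simps)
    ultimately show "\<exists>y. (k has_real_derivative y) (at t) \<and> 0 \<le> y" by blast
  qed
  then have "exp (c * T) * h T \<le> h 0 + C * J T" by (simp add: k_def J_def)
  then have "exp (- (c * T)) * (exp (c * T) * h T) \<le> exp (- (c * T)) * (h 0 + C * J T)"
    by (intro mult_left_mono) auto
  then have 1: "h T \<le> exp (- (c * T)) * h 0 + C * (exp (- (c * T)) * J T)"
    by (simp add: distrib_left mult.left_commute mult.assoc[symmetric] exp_minus_inverse mult.commute[of "exp (- (c * T))" "exp (c * T)"])
  \<comment> \<open>Bounding exp (c s) by exp (c T) gives up the fading memory of the input and
    leaves its plain integral, which becomes the squared L^2 norm of the disturbances.\<close>
  have "J T \<le> integral {0..T} (\<lambda>s. exp (c * T) * D s)"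
    unfolding J_def
  proof (rule integral_le)
    show "(\<lambda>s. exp (c * s) * D s) integrable_on {0..T}" by (rule integrable_continuous_real[OF ceD])
    show "(\<lambda>s. exp (c * T) * D s) integrable_on {0..T}"
      by (intro integrable_continuous_real continuous_intros cD)
    fix s assume "s \<in> {0..T}"
    then show "exp (c * s) * D s \<le> exp (c * T) * D s"
      using c D(2)[of s] by (intro mult_right_mono) (auto intro: mult_left_mono)
  qed
  then have "exp (- (c * T)) * J T \<le> exp (- (c * T)) * (exp (c * T) * integral {0..T} D)"
    by (intro mult_left_mono) auto
  also have "\<dots> = integral {0..T} D" by (simp add: mult.assoc[symmetric] exp_minus)
  finally have "C * (exp (- (c * T)) * J T) \<le> C * integral {0..T} D" using C by (intro mult_left_mono)
  then show ?thesis using 1 by simp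
qed

lemma C2_on_imp_continuous_on: "C2_on T f \<Longrightarrow> continuous_on T f"
  unfolding C2_on_def by (auto intro: continuous_on_vector_derivative)

context closed_loop
begin

lemma E_cl_eq:
  "E_cl S G z = 1 / 2 * inner_X S (fst z) (fst z) + Pot G (fst (snd z)) + 1 / 2 * (snd (snd z) \<bullet> (Kc G *v snd (snd z)))"
  by (simp add: E_cl_def E_X_def E_ctrl_def norm_X_square(1) split_beta)

lemma Pot_derivative:
  assumes v: "(v has_vector_derivative v') (at t within T)"
  shows "((\<lambda>s. Pot G (v s)) has_real_derivative grad (Pot G) (v t) \<bullet> v') (at t within T)"
proof -
  have "Pot G differentiable (at (v t))" using controller by (simp add: nonlinear_controller_def)
  then obtain f where f: "(Pot G has_derivative f) (at (v t))" by (auto simp: differentiable_def)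
  then have lin: "linear f" by (rule has_derivative_linear)
  \<comment> \<open>\<open>u\<close> represents the derivative through the inner product. Uniqueness
    of derivatives then identifies it with \<open>grad\<close>, which is a definite
    description.\<close>
  define u where "u = (\<Sum>b\<in>Basis. f b *\<^sub>R b)"
  have fu: "f = (\<lambda>h. h \<bullet> u)"
  proof
    fix h
    have "f h = f (\<Sum>b\<in>Basis. (h \<bullet> b) *\<^sub>R b)" by (simp add: euclidean_representation)
    also have "\<dots> = (\<Sum>b\<in>Basis. (h \<bullet> b) * f b)" by (simp add: linear_sum[OF lin] linear_cmul[OF lin])
    also have "\<dots> = h \<bullet> u" by (simp add: u_def inner_sum_right mult.commute)
    finally show "f h = h \<bullet> u" .
  qed
  have gd: "GDERIV (Pot G) (v t) :> u" using f unfolding gderiv_def fu .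
  have "grad (Pot G) (v t) = u"
    unfolding grad_def
  proof (rule the_equality[of "\<lambda>d. GDERIV (Pot G) (v t) :> d", OF gd])
    fix w assume "GDERIV (Pot G) (v t) :> w"
    then have "(\<lambda>h. h \<bullet> w) = (\<lambda>h. h \<bullet> u)"
      using has_derivative_unique gd unfolding gderiv_def by blast
    then have "(w - u) \<bullet> (w - u) = 0" by (simp add: inner_diff_right fun_eq_iff)
    then show "w = u" by simp
  qed
  then have g: "(Pot G has_derivative (\<lambda>h. h \<bullet> grad (Pot G) (v t))) (at (v t))"
    using gd by (simp add: gderiv_def)
  have "((\<lambda>s. Pot G (v s)) has_derivative (\<lambda>h. (h *\<^sub>R v') \<bullet> grad (Pot G) (v t))) (at t within T)"
    by (rule has_derivative_compose[OF v[unfolded has_vector_derivative_def] g])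
  moreover have "(\<lambda>h. (h *\<^sub>R v') \<bullet> grad (Pot G) (v t)) = (*) (grad (Pot G) (v t) \<bullet> v')"
    by (simp add: fun_eq_iff inner_commute)
  ultimately show ?thesis unfolding has_field_derivative_def by simp
qed

text \<open>Square integrability is inherited from the time derivative \<alpha> of the state, which
  lies in the state space and equals A x almost everywhere; \<open>op_A_integrable\<close> gives
  only L^1.\<close>

lemma op_A_X_space:
  assumes x: "x \<in> dom_A S" and \<alpha>: "\<alpha> \<in> X_space" and eq: "AE \<zeta> in unit_leb. \<alpha> \<zeta> = op_A S x \<zeta>"
  shows "op_A S x \<in> X_space"
proof -
  have m: "op_A S x \<in> borel_measurable unit_leb"
    using op_A_integrable[OF x] unfolding integrable_unit_leb_iff[symmetric] by (rule borel_measurable_integrable)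
  have "integrable unit_leb (\<lambda>s. (norm (op_A S x s))\<^sup>2)"
  proof (rule Bochner_Integration.integrable_cong_AE_imp[OF X_space_square[OF \<alpha>]])
    show "(\<lambda>s. (norm (op_A S x s))\<^sup>2) \<in> borel_measurable unit_leb"
      by (intro borel_measurable_power measurable_compose[OF m borel_measurable_norm])
    show "AE s in unit_leb. (norm (\<alpha> s))\<^sup>2 = (norm (op_A S x s))\<^sup>2"
      using eq by eventually_elim simp
  qed
  then show ?thesis using m by (simp add: X_space_def L2_on_def)
qed

lemma inner_X_op_A:
  assumes x: "x \<in> dom_A S" and \<alpha>: "\<alpha> \<in> X_space" and eq: "AE \<zeta> in unit_leb. \<alpha> \<zeta> = op_A S x \<zeta>"
  shows "inner_X S x \<alpha> = inner_X S x (op_A S x)"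
  unfolding inner_X_def
proof (rule integral_cong_AE)
  have X: "x \<in> X_space" using x by (simp add: dom_A_def)
  show "(\<lambda>\<zeta>. x \<zeta> \<bullet> (Ham S \<zeta> *v \<alpha> \<zeta>)) \<in> borel_measurable unit_leb"
    by (rule borel_measurable_integrable[OF inner_X_integrable[OF X \<alpha>]])
  show "(\<lambda>\<zeta>. x \<zeta> \<bullet> (Ham S \<zeta> *v op_A S x \<zeta>)) \<in> borel_measurable unit_leb"
    by (rule borel_measurable_integrable[OF inner_X_integrable[OF X op_A_X_space[OF assms]]])
  show "AE \<zeta> in unit_leb. x \<zeta> \<bullet> (Ham S \<zeta> *v \<alpha> \<zeta>) = x \<zeta> \<bullet> (Ham S \<zeta> *v op_A S x \<zeta>)"
    using eq by eventually_elim simp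
qed

lemma prim_form_cong_AE:
  assumes eq: "AE \<zeta> in unit_leb. \<alpha> \<zeta> = \<alpha>' \<zeta>"
  shows "prim_form q Q \<alpha> x = prim_form q Q \<alpha>' x" and "prim_form q Q x \<alpha> = prim_form q Q x \<alpha>'"
proof -
  show "prim_form q Q \<alpha> x = prim_form q Q \<alpha>' x"
    unfolding prim_form_def by (rule integral_cong_AE_unit(1)[OF eventually_mono[OF eq]]) auto
  have "integral {0..t} \<alpha> = integral {0..t} \<alpha>'" if "t \<in> {0..1}" for t
    using that by (intro integral_cong_AE_unit(1)[OF eq]) auto
  then show "prim_form q Q x \<alpha> = prim_form q Q x \<alpha>'"
    unfolding prim_form_def by (intro integral_cong) simp
qed

lemma multiplier_rate:
  obtains q c C where "continuous_on {0..1} q" "0 < c" "0 < C"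
    "\<forall>x\<in>dom_A S. prim_form q (matrix_inv (P2 S)) (op_A S x) x + prim_form q (matrix_inv (P2 S)) x (op_A S x)
       \<le> - c * (l2 x)\<^sup>2 + C * ((norm (op_B S x))\<^sup>2 + (norm (op_C S x))\<^sup>2)"
proof -
  obtain q c C where q: "continuous_on {0..1} q" "0 < c" "0 < C"
    and main: "\<forall>x\<in>dom_A S. prim_form q (matrix_inv (P2 S)) (op_A S x) x + prim_form q (matrix_inv (P2 S)) x (op_A S x)
       \<le> - c * integral {0..1} (\<lambda>\<zeta>. (norm (x \<zeta>))\<^sup>2)
          + C * ((norm (W x 0))\<^sup>2 + (norm (V x 0))\<^sup>2 + (norm (W x 1))\<^sup>2)"
    by (rule multiplier_form)
  obtain \<kappa> where \<kappa>: "0 < \<kappa>" "\<forall>x\<in>dom_A S. \<kappa> * ((norm (W x 0))\<^sup>2 + (norm (V x 0))\<^sup>2 + (norm (W x 1))\<^sup>2)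
               \<le> (norm (op_B S x))\<^sup>2 + (norm (op_C S x))\<^sup>2"
    using A1 unfolding W_def V_def by blast
  have "prim_form q (matrix_inv (P2 S)) (op_A S x) x + prim_form q (matrix_inv (P2 S)) x (op_A S x)
       \<le> - c * (l2 x)\<^sup>2 + C / \<kappa> * ((norm (op_B S x))\<^sup>2 + (norm (op_C S x))\<^sup>2)" if x: "x \<in> dom_A S" for x
  proof -
    have X: "x \<in> X_space" using x by (simp add: dom_A_def)
    have "(l2 x)\<^sup>2 = integral {0..1} (\<lambda>\<zeta>. (norm (x \<zeta>))\<^sup>2)"
      by (simp add: l2_square LINT_unit_leb_eq_integral[OF X_space_square[OF X]])
    moreover have "C * ((norm (W x 0))\<^sup>2 + (norm (V x 0))\<^sup>2 + (norm (W x 1))\<^sup>2)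
        \<le> C / \<kappa> * ((norm (op_B S x))\<^sup>2 + (norm (op_C S x))\<^sup>2)"
    proof -
      have "C / \<kappa> * (\<kappa> * ((norm (W x 0))\<^sup>2 + (norm (V x 0))\<^sup>2 + (norm (W x 1))\<^sup>2))
        \<le> C / \<kappa> * ((norm (op_B S x))\<^sup>2 + (norm (op_C S x))\<^sup>2)"
        using \<kappa> q x by (intro mult_left_mono) auto
      then show ?thesis using \<kappa>(1) by simp
    qed
    ultimately show ?thesis using main x by fastforce
  qed
  then show ?thesis using q \<kappa> by (intro that[of q c "C / \<kappa>"]) auto
qed

lemma classical_energy_decay:
  obtains c C where "0 < c" "0 < C"
    "\<And>z d dc y t. classical_solution S G \<infinity> z d dc y \<Longrightarrow> 0 \<le> t \<Longrightarrow>
       E_cl S G (z t) \<le> 3 / 2 * exp (- c * t) * E_cl S G (z 0)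
         + C * integral {0..t} (\<lambda>s. (norm (d s))\<^sup>2 + (norm (dc s))\<^sup>2)"
proof -
  define Q where "Q = matrix_inv (P2 S)"
  obtain q cF CF where q: "continuous_on {0..1} q" and cF: "0 < cF" and CF: "0 < CF"
    and F: "\<forall>x\<in>dom_A S. prim_form q Q (op_A S x) x + prim_form q Q x (op_A S x)
       \<le> - cF * (l2 x)\<^sup>2 + CF * ((norm (op_B S x))\<^sup>2 + (norm (op_C S x))\<^sup>2)"
    unfolding Q_def by (rule multiplier_rate)
  obtain KF where KF: "0 \<le> KF" "l2_form (prim_form q Q) KF" by (rule prim_form_l2_form[OF q])
  obtain m M where m: "0 < m" and M: "0 \<le> M" and lower: "\<forall>x\<in>X_space. m * (l2 x)\<^sup>2 \<le> inner_X S x x"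
    and form: "l2_form (inner_X S) M" by (rule inner_X_self_bounds)
  obtain a C1 where a: "0 < a" and C1: "0 < C1" and energy: "\<forall>v1 v2 y d dc. u_in v2 y d dc \<bullet> y + grad (Pot G) v1 \<bullet> (Kc G *v v2) + (Kc G *v v2) \<bullet> v2_dot v1 v2 y dc
       \<le> - a * ((norm (Kc G *v v2))\<^sup>2 + (norm y)\<^sup>2) + C1 * ((norm d)\<^sup>2 + (norm dc)\<^sup>2)"
    by (rule energy_rate)
  obtain a2 C2 where a2: "0 < a2" and C2: "0 < C2" and cross: "\<forall>v1 v2 y dc. (Kc G *v v2) \<bullet> v2 + v1 \<bullet> v2_dot v1 v2 y dc
       \<le> - a2 * Pot G v1 + C2 * ((norm (Kc G *v v2))\<^sup>2 + (norm y)\<^sup>2 + (norm dc)\<^sup>2)"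
    by (rule cross_rate)
  obtain C3 where C3: "0 < C3" and ub: "\<forall>v2 y d dc. (norm (u_in v2 y d dc))\<^sup>2 \<le> C3 * ((norm (Kc G *v v2))\<^sup>2 + (norm y)\<^sup>2 + (norm d)\<^sup>2 + (norm dc)\<^sup>2)"
    by (rule u_in_bound)
  obtain C4 where C4: "0 < C4" and cb: "\<forall>v1 v2. \<bar>v1 \<bullet> v2\<bar> \<le> C4 * (Pot G v1 + 1 / 2 * (v2 \<bullet> (Kc G *v v2)))"
    and kb: "\<forall>v2. v2 \<bullet> (Kc G *v v2) \<le> C4 * (norm (Kc G *v v2))\<^sup>2"
    by (rule cross_bound)
  define b where "b = min a2 cF"
  \<comment> \<open>A sum that dominates the four constants required below: for the energy rate, the
    rate of the correction, the bound of the energy and the bound of the correction.\<close>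
  define C where "C = C1 + (C2 + CF * (C3 + 1)) + (M + 1 + C4) + (C4 + 2 * KF / m)"
  have b: "0 < b" "b \<le> a2" "b \<le> cF" using a2 cF by (auto simp: b_def)
  have pos: "0 < CF * (C3 + 1)" "0 \<le> 2 * KF / m" using CF C3 KF m by auto
  have C: "0 < C" "C1 \<le> C" "C2 + CF * (C3 + 1) \<le> C" "M + 1 + C4 \<le> C" "C4 + 2 * KF / m \<le> C"
    using C1 C2 C4 M pos unfolding C_def by linarith+
  obtain \<epsilon> c C' where \<epsilon>: "0 < \<epsilon>" and c: "0 < c" and C': "0 < C'"
    and lyap: "\<And>E g e' g' s P n D :: real. 0 \<le> s \<Longrightarrow> 0 \<le> P \<Longrightarrow> 0 \<le> n \<Longrightarrow> 0 \<le> D \<Longrightarrow> 0 \<le> E \<Longrightarrow>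
       e' \<le> - a * s + C * D \<Longrightarrow> g' \<le> - b * (P + n) + C * (s + D) \<Longrightarrow> E \<le> C * (s + P + n) \<Longrightarrow> \<bar>g\<bar> \<le> C * E \<Longrightarrow>
       e' + \<epsilon> * g' \<le> - c * (E + \<epsilon> * g) + C' * D"
    and small: "\<And>E g :: real. \<bar>g\<bar> \<le> C * E \<Longrightarrow> \<bar>\<epsilon> * g\<bar> \<le> E / 5"
    by (rule lyapunov_combination[OF a b(1) C(1)]) blast
  show ?thesis
  proof (rule that[of c "5 / 4 * C'"])
    show "0 < c" "0 < 5 / 4 * C'" using c C' by auto
    fix z d dc y and t :: real
    assume cs: "classical_solution S G \<infinity> z d dc y" and t: "0 \<le> t"
    obtain z' where
      dom: "\<And>t. 0 \<le> t \<Longrightarrow> fst (z t) \<in> dom_A S"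
      and X': "\<And>t. 0 \<le> t \<Longrightarrow> fst (z' t) \<in> X_space"
      and v1': "\<And>t. 0 \<le> t \<Longrightarrow> ((\<lambda>s. fst (snd (z s))) has_vector_derivative fst (snd (z' t))) (at t within {0..})"
      and v2': "\<And>t. 0 \<le> t \<Longrightarrow> ((\<lambda>s. snd (snd (z s))) has_vector_derivative snd (snd (z' t))) (at t within {0..})"
      and form': "\<And>b C t. l2_form b C \<Longrightarrow> 0 \<le> t \<Longrightarrow> ((\<lambda>s. b (fst (z s)) (fst (z s))) has_real_derivative
          b (fst (z' t)) (fst (z t)) + b (fst (z t)) (fst (z' t))) (at t within {0..})"
      and x_eq: "\<And>t. 0 < t \<Longrightarrow> AE \<zeta> in unit_leb. fst (z' t) \<zeta> = op_A S (fst (z t)) \<zeta>"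
      and v1_eq: "\<And>t. 0 < t \<Longrightarrow> fst (snd (z' t)) = Kc G *v snd (snd (z t))"
      and v2_eq: "\<And>t. 0 < t \<Longrightarrow> snd (snd (z' t)) = v2_dot (fst (snd (z t))) (snd (snd (z t))) (y t) (dc t)"
      and B_eq: "\<And>t. 0 < t \<Longrightarrow> op_B S (fst (z t)) = u_in (snd (snd (z t))) (y t) (d t) (dc t)"
      and C_eq: "\<And>t. 0 < t \<Longrightarrow> op_C S (fst (z t)) = y t"
      by (rule classical_solution_derivatives[OF cs]) blast
    define x where "x s = fst (z s)" for s
    define v1 where "v1 s = fst (snd (z s))" for s
    define v2 where "v2 s = snd (snd (z s))" for s
    define E where "E s = 1 / 2 * inner_X S (x s) (x s) + Pot G (v1 s) + 1 / 2 * (v2 s \<bullet> (Kc G *v v2 s))" for s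
    define g where "g s = v1 s \<bullet> v2 s + prim_form q Q (x s) (x s)" for s
    define D where "D s = (norm (d s))\<^sup>2 + (norm (dc s))\<^sup>2" for s
    define e' where "e' s = inner_X S (x s) (fst (z' s)) + grad (Pot G) (v1 s) \<bullet> fst (snd (z' s)) + (Kc G *v v2 s) \<bullet> snd (snd (z' s))" for s
    define g' where "g' s = v1 s \<bullet> snd (snd (z' s)) + fst (snd (z' s)) \<bullet> v2 s
        + (prim_form q Q (fst (z' s)) (x s) + prim_form q Q (x s) (fst (z' s)))" for s
    have X: "x s \<in> X_space" if "0 \<le> s" for s using dom[OF that] by (simp add: dom_A_def x_def)
    have E_eq: "E_cl S G (z s) = E s" for s by (simp add: E_cl_eq E_def x_def v1_def v2_def)
    have inner': "((\<lambda>s. f s \<bullet> h s) has_real_derivative f s \<bullet> h' + f' \<bullet> h s) (at s within {0..})"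
      if "(f has_vector_derivative f') (at s within {0..})" "(h has_vector_derivative h') (at s within {0..})"
      for f h :: "real \<Rightarrow> real^'c" and f' h' s
      unfolding has_real_derivative_iff_has_vector_derivative
      by (rule bounded_bilinear.has_vector_derivative[OF bounded_bilinear_inner that])
    have E': "(E has_real_derivative e' s) (at s within {0..})" if s: "0 \<le> s" for s
    proof -
      have 1: "((\<lambda>s. inner_X S (x s) (x s)) has_real_derivative 2 * inner_X S (x s) (fst (z' s))) (at s within {0..})"
        using form'[OF form s] inner_X_commute[of "fst (z' s)" "x s"] by (simp add: x_def)
      have 2: "((\<lambda>s. Pot G (v1 s)) has_real_derivative grad (Pot G) (v1 s) \<bullet> fst (snd (z' s))) (at s within {0..})"
        using Pot_derivative[OF v1'[OF s]] by (simp add: v1_def)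
      have "((\<lambda>s. Kc G *v v2 s) has_vector_derivative Kc G *v snd (snd (z' s))) (at s within {0..})"
        using bounded_linear.has_vector_derivative[OF matrix_vector_mul_bounded_linear v2'[OF s]] by (simp add: v2_def)
      then have "((\<lambda>s. v2 s \<bullet> (Kc G *v v2 s)) has_real_derivative v2 s \<bullet> (Kc G *v snd (snd (z' s))) + snd (snd (z' s)) \<bullet> (Kc G *v v2 s)) (at s within {0..})"
        using v2'[OF s] by (intro inner') (simp_all add: v2_def)
      also have "v2 s \<bullet> (Kc G *v snd (snd (z' s))) = (Kc G *v v2 s) \<bullet> snd (snd (z' s))" by (rule Kc_symmetric)
      also have "snd (snd (z' s)) \<bullet> (Kc G *v v2 s) = (Kc G *v v2 s) \<bullet> snd (snd (z' s))" by (rule inner_commute)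
      finally have 3: "((\<lambda>s. v2 s \<bullet> (Kc G *v v2 s)) has_real_derivative
          (Kc G *v v2 s) \<bullet> snd (snd (z' s)) + (Kc G *v v2 s) \<bullet> snd (snd (z' s))) (at s within {0..})" .
      have "1 / 2 * (2 * inner_X S (x s) (fst (z' s))) + grad (Pot G) (v1 s) \<bullet> fst (snd (z' s))
          + 1 / 2 * ((Kc G *v v2 s) \<bullet> snd (snd (z' s)) + (Kc G *v v2 s) \<bullet> snd (snd (z' s))) = e' s"
        by (simp add: e'_def)
      from DERIV_cong[OF DERIV_add[OF DERIV_add[OF DERIV_cmult[OF 1] 2] DERIV_cmult[OF 3]] this]
      show ?thesis unfolding E_def .
    qed
    have g'_deriv: "(g has_real_derivative g' s) (at s within {0..})" if s: "0 \<le> s" for s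
      unfolding g_def g'_def v1_def v2_def x_def
      by (rule DERIV_add[OF inner'[OF v1'[OF s] v2'[OF s]] form'[OF KF(2) s]])
    have g_le: "\<bar>g s\<bar> \<le> C * E s" and E0: "0 \<le> E s" if s: "0 \<le> s" for s
    proof -
      have nn: "0 \<le> inner_X S (x s) (x s)" "0 \<le> v2 s \<bullet> (Kc G *v v2 s)" "0 \<le> Pot G (v1 s)"
        using norm_X_square(2) Kc_nonneg Pot_nonneg by auto
      then show "0 \<le> E s" by (simp add: E_def)
      have "\<bar>prim_form q Q (x s) (x s)\<bar> \<le> KF * (l2 (x s))\<^sup>2"
        using l2_form.bound[OF KF(2) X[OF s] X[OF s]] by (simp add: power2_eq_square mult.assoc)
      also have "\<dots> \<le> KF * (inner_X S (x s) (x s) / m)"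
        using lower X[OF s] m KF by (intro mult_left_mono) (auto simp: pos_le_divide_eq mult.commute)
      also have "\<dots> = 2 * KF / m * (1 / 2 * inner_X S (x s) (x s))" by simp
      also have "\<dots> \<le> (C4 + 2 * KF / m) * (1 / 2 * inner_X S (x s) (x s))"
        using nn C4 by (intro mult_right_mono) auto
      finally have 1: "\<bar>prim_form q Q (x s) (x s)\<bar> \<le> (C4 + 2 * KF / m) * (1 / 2 * inner_X S (x s) (x s))" .
      have "\<bar>v1 s \<bullet> v2 s\<bar> \<le> C4 * (Pot G (v1 s) + 1 / 2 * (v2 s \<bullet> (Kc G *v v2 s)))" using cb by blast
      also have "\<dots> \<le> (C4 + 2 * KF / m) * (Pot G (v1 s) + 1 / 2 * (v2 s \<bullet> (Kc G *v v2 s)))"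
        using nn pos by (intro mult_right_mono) auto
      finally have "\<bar>g s\<bar> \<le> (C4 + 2 * KF / m) * (Pot G (v1 s) + 1 / 2 * (v2 s \<bullet> (Kc G *v v2 s)))
          + (C4 + 2 * KF / m) * (1 / 2 * inner_X S (x s) (x s))"
        unfolding g_def using 1 abs_triangle_ineq[of "v1 s \<bullet> v2 s" "prim_form q Q (x s) (x s)"] by linarith
      also have "\<dots> = (C4 + 2 * KF / m) * E s" unfolding E_def distrib_left by simp
      also have "\<dots> \<le> C * E s" using C \<open>0 \<le> E s\<close> by (intro mult_right_mono) auto
      finally show "\<bar>g s\<bar> \<le> C * E s" .
    qed
    have rate: "e' s + \<epsilon> * g' s \<le> - c * (E s + \<epsilon> * g s) + C' * D s" if s: "0 < s" for s
    proof -
      have s0: "0 \<le> s" using s by simp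
      note xs = dom[OF s0, folded x_def]
      define w where "w = Kc G *v v2 s"
      define n where "n = (l2 (x s))\<^sup>2"
      define \<sigma> where "\<sigma> = (norm w)\<^sup>2 + (norm (y s))\<^sup>2"
      have nn: "0 \<le> \<sigma>" "0 \<le> n" "0 \<le> D s" by (auto simp: \<sigma>_def n_def D_def)
      have pas: "inner_X S (x s) (fst (z' s)) \<le> u_in (v2 s) (y s) (d s) (dc s) \<bullet> y s"
      proof -
        have "inner_X S (x s) (fst (z' s)) = inner_X S (x s) (op_A S (x s))"
          by (rule inner_X_op_A[OF xs X'[OF s0] x_eq[OF s, folded x_def]])
        also have "\<dots> \<le> op_B S (x s) \<bullet> op_C S (x s)"
          using passivity xs unfolding impedance_passive_def by blast
        also have "\<dots> = u_in (v2 s) (y s) (d s) (dc s) \<bullet> y s"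
          using B_eq[OF s] C_eq[OF s] by (simp add: x_def v2_def)
        finally show ?thesis .
      qed
      have "e' s \<le> u_in (v2 s) (y s) (d s) (dc s) \<bullet> y s + grad (Pot G) (v1 s) \<bullet> w + w \<bullet> v2_dot (v1 s) (v2 s) (y s) (dc s)"
        using pas v1_eq[OF s] v2_eq[OF s] by (simp add: e'_def w_def v1_def v2_def)
      also have "\<dots> \<le> - a * \<sigma> + C1 * D s" using energy unfolding w_def \<sigma>_def D_def by blast
      also have "\<dots> \<le> - a * \<sigma> + C * D s" using C nn by (intro add_mono mult_right_mono) auto
      finally have e'_le: "e' s \<le> - a * \<sigma> + C * D s" .
      have "v1 s \<bullet> snd (snd (z' s)) + fst (snd (z' s)) \<bullet> v2 s = w \<bullet> v2 s + v1 s \<bullet> v2_dot (v1 s) (v2 s) (y s) (dc s)"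
        using v1_eq[OF s] v2_eq[OF s] by (simp add: w_def v1_def v2_def)
      also have "\<dots> \<le> - a2 * Pot G (v1 s) + C2 * (\<sigma> + (norm (dc s))\<^sup>2)"
        using cross unfolding w_def \<sigma>_def by blast
      also have "\<dots> \<le> - b * Pot G (v1 s) + C2 * (\<sigma> + D s)"
        using b C2 Pot_nonneg[of "v1 s"] by (intro add_mono mult_left_mono mult_right_mono) (auto simp: D_def)
      finally have g1: "v1 s \<bullet> snd (snd (z' s)) + fst (snd (z' s)) \<bullet> v2 s \<le> - b * Pot G (v1 s) + C2 * (\<sigma> + D s)" .
      have "prim_form q Q (fst (z' s)) (x s) + prim_form q Q (x s) (fst (z' s))
          = prim_form q Q (op_A S (x s)) (x s) + prim_form q Q (x s) (op_A S (x s))"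
        using prim_form_cong_AE[OF x_eq[OF s]] by (simp add: x_def)
      also have "\<dots> \<le> - cF * n + CF * ((norm (op_B S (x s)))\<^sup>2 + (norm (op_C S (x s)))\<^sup>2)"
        using F xs unfolding n_def by blast
      \<comment> \<open>The input contributes C_3 through \<open>u_in_bound\<close>, the output
        contributes 1: these are the two squares that (A1) left over.\<close>
      also have "\<dots> \<le> - b * n + CF * (C3 * (\<sigma> + D s) + 1 * (\<sigma> + D s))"
      proof (intro add_mono mult_left_mono mult_right_mono)
        have "(norm (u_in (v2 s) (y s) (d s) (dc s)))\<^sup>2 \<le> C3 * ((norm (Kc G *v v2 s))\<^sup>2 + (norm (y s))\<^sup>2 + (norm (d s))\<^sup>2 + (norm (dc s))\<^sup>2)"
          using ub by blast
        then show "(norm (op_B S (x s)))\<^sup>2 \<le> C3 * (\<sigma> + D s)"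
          using B_eq[OF s] by (simp add: x_def v2_def \<sigma>_def D_def w_def add.assoc)
        have "(norm (y s))\<^sup>2 \<le> \<sigma> + D s" using nn by (simp add: \<sigma>_def)
        then show "(norm (op_C S (x s)))\<^sup>2 \<le> 1 * (\<sigma> + D s)" using C_eq[OF s] by (simp add: x_def)
      qed (use b CF nn in auto)
      finally have g2: "prim_form q Q (fst (z' s)) (x s) + prim_form q Q (x s) (fst (z' s))
          \<le> - b * n + CF * (C3 * (\<sigma> + D s) + 1 * (\<sigma> + D s))" .
      have "g' s \<le> - b * (Pot G (v1 s) + n) + (C2 + CF * (C3 + 1)) * (\<sigma> + D s)"
        using add_mono[OF g1 g2] unfolding g'_def by (simp add: algebra_simps)
      also have "\<dots> \<le> - b * (Pot G (v1 s) + n) + C * (\<sigma> + D s)"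
        using C nn by (intro add_left_mono mult_right_mono) auto
      finally have g'_le: "g' s \<le> - b * (Pot G (v1 s) + n) + C * (\<sigma> + D s)" .
      have "inner_X S (x s) (x s) \<le> M * n"
        using l2_form.bound[OF form X[OF s0] X[OF s0]] by (simp add: n_def power2_eq_square mult.assoc abs_le_iff)
      moreover have "v2 s \<bullet> (Kc G *v v2 s) \<le> C4 * \<sigma>"
      proof -
        have "C4 * (norm w)\<^sup>2 \<le> C4 * \<sigma>" using C4 by (intro mult_left_mono) (auto simp: \<sigma>_def)
        then show ?thesis using kb[rule_format, of "v2 s"] unfolding w_def by linarith
      qed
      moreover have "0 \<le> M * n" "0 \<le> C4 * \<sigma>" "0 \<le> Pot G (v1 s)" using nn M C4 Pot_nonneg by auto
      ultimately have "E s \<le> M * n + Pot G (v1 s) + C4 * \<sigma>" unfolding E_def by linarith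
      also have "\<dots> \<le> (M + 1 + C4) * n + (M + 1 + C4) * Pot G (v1 s) + (M + 1 + C4) * \<sigma>"
        using nn M C4 Pot_nonneg[of "v1 s"] by (intro add_mono mult_right_mono mult_right_mono[of 1 _ "Pot G (v1 s)", simplified]) auto
      also have "\<dots> = (M + 1 + C4) * (\<sigma> + Pot G (v1 s) + n)" by (simp add: algebra_simps)
      also have "\<dots> \<le> C * (\<sigma> + Pot G (v1 s) + n)"
        using C nn Pot_nonneg[of "v1 s"] by (intro mult_right_mono) auto
      finally have E_le: "E s \<le> C * (\<sigma> + Pot G (v1 s) + n)" .
      show ?thesis
        by (rule lyap[OF nn(1) Pot_nonneg nn(2,3) E0[OF s0] e'_le g'_le E_le g_le[OF s0]])
    qed
    have dcont: "continuous_on {0..} d" "continuous_on {0..} dc"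
      using cs C2_on_imp_continuous_on unfolding classical_solution_def time_dom_infinity by blast+
    have "E t + \<epsilon> * g t \<le> exp (- c * t) * (E 0 + \<epsilon> * g 0) + C' * integral {0..t} D"
    proof (rule gronwall_decay[OF t])
      show "((\<lambda>s. E s + \<epsilon> * g s) has_real_derivative e' s + \<epsilon> * g' s) (at s within {0..})" if "0 \<le> s" for s
        by (rule DERIV_add[OF E'[OF that] DERIV_cmult[OF g'_deriv[OF that]]])
      show "continuous_on {0..} D" unfolding D_def by (intro continuous_intros dcont)
    qed (use c C' rate in \<open>auto simp: D_def\<close>)
    \<comment> \<open>E + \<epsilon> g lies between 4/5 E and 6/5 E. This is the origin of 3/2 =
      (6/5)/(4/5) and of the gain 5/4 C'.\<close>
    moreover have "4 / 5 * E t \<le> E t + \<epsilon> * g t" using small[OF g_le[OF t]] by (simp add: abs_le_iff)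
    moreover have "exp (- c * t) * (E 0 + \<epsilon> * g 0) \<le> exp (- c * t) * (6 / 5 * E 0)"
      using small[OF g_le[of 0]] by (intro mult_left_mono) (auto simp: abs_le_iff)
    ultimately have "4 / 5 * E t \<le> exp (- c * t) * (6 / 5 * E 0) + C' * integral {0..t} D" by linarith
    then have "E t \<le> 3 / 2 * exp (- c * t) * E 0 + 5 / 4 * C' * integral {0..t} D" by (simp add: mult_ac)
    then show "E_cl S G (z t) \<le> 3 / 2 * exp (- c * t) * E_cl S G (z 0)
         + 5 / 4 * C' * integral {0..t} (\<lambda>s. (norm (d s))\<^sup>2 + (norm (dc s))\<^sup>2)"
      unfolding E_eq D_def .
  qed
qed

end

section \<open>Comparison functions\<close>

text \<open>Expansion about x; it makes the quadratic energy of x continuous along approximating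
  solutions.\<close>

lemma (in l2_form) tendsto_diagonal:
  assumes x: "x \<in> X_space" and xs: "\<And>k. xs k \<in> X_space" and lim: "((\<lambda>k. l2 (xs k - x)) \<longlongrightarrow> 0) F"
  shows "((\<lambda>k. b (xs k) (xs k)) \<longlongrightarrow> b x x) F"
proof -
  have d: "xs k - x \<in> X_space" for k by (intro X_space_diff x xs)
  have "((\<lambda>k. b (xs k - x) (xs k - x) + b (xs k - x) x + b x (xs k - x) + b x x) \<longlongrightarrow> 0 + 0 + 0 + b x x) F"
    by (intro tendsto_add tendsto_const tendsto_zero[OF _ _ lim lim] tendsto_zero[OF _ _ lim tendsto_const]
        tendsto_zero[OF _ _ tendsto_const lim] always_eventually allI d x) simp_all
  moreover have "b (xs k - x) (xs k - x) + b (xs k - x) x + b x (xs k - x) + b x x = b (xs k) (xs k)" for k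
    using d[of k] xs[of k] x by (simp add: diff_left diff_right)
  ultimately show ?thesis by simp
qed

lemma class_K_less: "class_K f \<Longrightarrow> 0 \<le> r \<Longrightarrow> r < s \<Longrightarrow> f r < f s"
  by (auto simp: class_K_def strict_mono_on_def)

lemma class_K_mono: "class_K f \<Longrightarrow> 0 \<le> r \<Longrightarrow> r \<le> s \<Longrightarrow> f r \<le> f s"
  using class_K_less[of f r s] by (cases "r = s") auto

lemma class_K_nonneg: "class_K f \<Longrightarrow> 0 \<le> r \<Longrightarrow> 0 \<le> f r"
  by (auto simp: class_K_def)

lemma class_K_inf_surj:
  assumes f: "class_K_inf f" and s: "0 \<le> s"
  obtains r where "0 \<le> r" "f r = s"
proof -
  have K: "class_K f" and unb: "\<not> bdd_above (f ` {0..})" using f by (auto simp: class_K_inf_def)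
  obtain R where R: "0 \<le> R" "s \<le> f R"
    using unb by (auto simp: bdd_above_def not_le intro: less_imp_le)
  have "\<exists>r. 0 \<le> r \<and> r \<le> R \<and> f r = s"
  proof (rule IVT')
    show "f 0 \<le> s" using K s by (simp add: class_K_def)
    show "continuous_on {0..R} f" using K by (auto simp: class_K_def intro: continuous_on_subset)
  qed (use R in auto)
  then show ?thesis using that by blast
qed

context
  fixes f assumes f: "class_K_inf f"
begin

lemma class_K_inf_K: "class_K f"
  using f by (simp add: class_K_inf_def)

lemma inv_class_K_inf_left: "0 \<le> r \<Longrightarrow> inv_into {0..} f (f r) = r"
  using class_K_inf_K by (intro inv_into_f_f) (auto simp: class_K_def strict_mono_on_imp_inj_on)

lemma inv_class_K_inf_right: "0 \<le> s \<Longrightarrow> f (inv_into {0..} f s) = s"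
  using class_K_inf_surj[OF f] by (metis atLeast_iff f_inv_into_f image_eqI)

lemma inv_class_K_inf_nonneg: "0 \<le> s \<Longrightarrow> 0 \<le> inv_into {0..} f s"
  using class_K_inf_surj[OF f] by (metis atLeast_iff inv_into_into image_eqI)

lemma inv_class_K_inf_less:
  assumes "0 \<le> r" "r < s"
  shows "inv_into {0..} f r < inv_into {0..} f s"
proof (rule ccontr)
  assume "\<not> ?thesis"
  then have "f (inv_into {0..} f s) \<le> f (inv_into {0..} f r)"
    using assms by (intro class_K_mono[OF class_K_inf_K] inv_class_K_inf_nonneg) auto
  then show False using assms by (simp add: inv_class_K_inf_right)
qed

lemma inv_class_K_inf_less_iff:
  assumes "0 \<le> s" "0 \<le> r"
  shows "inv_into {0..} f s < r \<longleftrightarrow> s < f r" and "r < inv_into {0..} f s \<longleftrightarrow> f r < s"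
proof -
  have r: "inv_into {0..} f (f r) = r" "0 \<le> f r"
    using assms inv_class_K_inf_left class_K_nonneg[OF class_K_inf_K] by auto
  show "inv_into {0..} f s < r \<longleftrightarrow> s < f r"
    using inv_class_K_inf_less[of s "f r"] inv_class_K_inf_less[of "f r" s] assms r
    by (cases s "f r" rule: linorder_cases) auto
  show "r < inv_into {0..} f s \<longleftrightarrow> f r < s"
    using inv_class_K_inf_less[of s "f r"] inv_class_K_inf_less[of "f r" s] assms r
    by (cases s "f r" rule: linorder_cases) auto
qed

text \<open>Continuity of the inverse is a matter of order alone: values strictly between f (r - e)
  and f (r + e) have preimages strictly between r - e and r + e.\<close>

lemma class_K_inf_inv: "class_K_inf (inv_into {0..} f)"
proof -
  define g where "g = inv_into {0..} f"
  have g0: "g 0 = 0" using inv_class_K_inf_left[of 0] class_K_inf_K by (simp add: g_def class_K_def)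
  have "continuous_on {0..} g"
    unfolding continuous_on_iff
  proof (intro ballI allI impI)
    fix s e :: real assume s: "s \<in> {0..}" and e: "0 < e"
    define r where "r = g s"
    have r: "0 \<le> r" "f r = s" using s inv_class_K_inf_nonneg inv_class_K_inf_right by (auto simp: r_def g_def)
    define u where "u = f (r + e) - s"
    \<comment> \<open>If r < e, the bound r - e < g s' is automatic because \<open>g\<close> is
      nonnegative, so any positive number will do.\<close>
    define l where "l = (if e \<le> r then s - f (r - e) else 1)"
    have u: "0 < u" using class_K_less[OF class_K_inf_K, of r "r + e"] r e by (simp add: u_def)
    have l: "0 < l" using class_K_less[OF class_K_inf_K, of "r - e" r] r e by (simp add: l_def)
    have "dist (g s') (g s) < e" if s': "s' \<in> {0..}" "dist s' s < min u l" for s'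
    proof -
      have d: "s' - s < u" "s - s' < l" using s'(2) by (simp_all add: dist_real_def abs_less_iff)
      then have "s' < f (r + e)" by (simp add: u_def)
      then have 1: "g s' < r + e"
        using inv_class_K_inf_less_iff(1)[of s' "r + e"] s' r e by (simp add: g_def)
      have 2: "r - e < g s'"
      proof (cases "e \<le> r")
        case True
        then have "f (r - e) < s'" using d(2) by (simp add: l_def)
        then show ?thesis using inv_class_K_inf_less_iff(2)[of s' "r - e"] s' True by (simp add: g_def)
      next
        case False
        then show ?thesis using inv_class_K_inf_nonneg[of s'] s' by (simp add: g_def)
      qed
      show ?thesis using 1 2 by (simp add: dist_real_def r_def[symmetric] abs_less_iff)
    qed
    then show "\<exists>d>0. \<forall>s'\<in>{0..}. dist s' s < d \<longrightarrow> dist (g s') (g s) < e"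
      using u l by (intro exI[of _ "min u l"]) auto
  qed
  moreover have "strict_mono_on {0..} g"
    unfolding g_def by (auto intro!: strict_mono_onI inv_class_K_inf_less)
  moreover have "g ` {0..} \<subseteq> {0..}" using inv_class_K_inf_nonneg by (auto simp: g_def)
  moreover have "\<not> bdd_above (g ` {0..})"
  proof
    assume "bdd_above (g ` {0..})"
    then obtain B where B: "\<And>s. 0 \<le> s \<Longrightarrow> g s \<le> B" by (auto simp: bdd_above_def)
    have "\<bar>B\<bar> + 1 \<le> B"
      using B[of "f (\<bar>B\<bar> + 1)"] inv_class_K_inf_left[of "\<bar>B\<bar> + 1"] class_K_nonneg[OF class_K_inf_K, of "\<bar>B\<bar> + 1"]
      by (simp add: g_def)
    then show False by simp
  qed
  ultimately show ?thesis using g0 unfolding class_K_inf_def class_K_def g_def by blast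
qed

end

lemma class_K_compose:
  assumes f: "class_K f" and g: "class_K g"
  shows "class_K (\<lambda>r. f (g r))"
proof -
  have "continuous_on {0..} (\<lambda>r. f (g r))"
    using f g by (auto simp: class_K_def intro: continuous_on_compose2)
  moreover have "strict_mono_on {0..} (\<lambda>r. f (g r))"
    by (intro strict_mono_onI class_K_less[OF f] class_K_less[OF g] class_K_nonneg[OF g]) auto
  ultimately show ?thesis using f g by (auto simp: class_K_def)
qed

lemma class_K_inf_compose:
  assumes f: "class_K_inf f" and g: "class_K_inf g"
  shows "class_K_inf (\<lambda>r. f (g r))"
proof -
  have "\<not> bdd_above ((\<lambda>r. f (g r)) ` {0..})"
  proof
    assume "bdd_above ((\<lambda>r. f (g r)) ` {0..})"
    then obtain B where B: "\<And>r. 0 \<le> r \<Longrightarrow> f (g r) \<le> B" by (auto simp: bdd_above_def)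
    have "f s \<le> B" if s: "0 \<le> s" for s
    proof -
      obtain r where "0 \<le> r" "g r = s" by (rule class_K_inf_surj[OF g s])
      then show ?thesis using B[of r] by simp
    qed
    then have "bdd_above (f ` {0..})" by (auto intro!: bdd_aboveI)
    then show False using f by (simp add: class_K_inf_def)
  qed
  then show ?thesis using class_K_compose f g by (auto simp: class_K_inf_def)
qed

lemma class_K_cmult: "0 < c \<Longrightarrow> class_K f \<Longrightarrow> class_K (\<lambda>r. c * f r)"
  by (auto simp: class_K_def strict_mono_on_def intro!: continuous_intros)

lemma class_K_inf_square:
  assumes c: "0 < c"
  shows "class_K_inf (\<lambda>r. c * r\<^sup>2)"
proof -
  have "strict_mono_on {0..} (\<lambda>r. c * r\<^sup>2)"
    using c by (intro strict_mono_onI) (auto intro!: mult_strict_left_mono power_strict_mono)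
  moreover have "\<not> bdd_above ((\<lambda>r. c * r\<^sup>2) ` {0..})"
  proof
    assume "bdd_above ((\<lambda>r. c * r\<^sup>2) ` {0..})"
    then obtain B where B: "\<And>r. 0 \<le> r \<Longrightarrow> c * r\<^sup>2 \<le> B" by (auto simp: bdd_above_def)
    have "c * (sqrt ((\<bar>B\<bar> + 1) / c))\<^sup>2 = \<bar>B\<bar> + 1" using c by simp
    then show False using B[of "sqrt ((\<bar>B\<bar> + 1) / c)"] c by simp
  qed
  ultimately show ?thesis
    using c by (auto simp: class_K_inf_def class_K_def intro!: continuous_intros)
qed

text \<open>The quotient \<open>t / 1\<close> keeps the shape of \<beta> in the theorem, with time
  constant T_0 = 1.\<close>

lemma class_KL_exp:
  assumes g: "class_K_inf g" and \<phi>: "class_K \<phi>" and b: "0 < b" "b < 1"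
  shows "class_KL (\<lambda>r t. g (3 * b powr (t / 1) * \<phi> r))"
proof -
  have gK: "class_K g" using g by (simp add: class_K_inf_def)
  have cg: "continuous_on {0..} g" and c\<phi>: "continuous_on {0..} \<phi>"
    using gK \<phi> by (auto simp: class_K_def)
  have nn: "0 \<le> 3 * b powr t * \<phi> r" if "0 \<le> r" for r t
    using class_K_nonneg[OF \<phi> that] by simp
  have "continuous_on ({0..} \<times> {0..}) (\<lambda>p. g (3 * b powr (snd p) * \<phi> (fst p)))"
  proof (rule continuous_on_compose2[OF cg])
    show "continuous_on ({0..} \<times> {0..}) (\<lambda>p. 3 * b powr (snd p) * \<phi> (fst p))"
      using b by (intro continuous_intros continuous_on_compose2[OF c\<phi>]) auto
  qed (use nn in auto)
  moreover have "class_K (\<lambda>r. g (3 * b powr t * \<phi> r))" for t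
    using class_K_compose[OF gK class_K_cmult[OF _ \<phi>, of "3 * b powr t"]] b by simp
  moreover have "class_L (\<lambda>t. g (3 * b powr t * \<phi> r))" if r: "0 < r" for r
  proof -
    have \<phi>r: "0 < \<phi> r" using class_K_less[OF \<phi>, of 0 r] r \<phi> by (simp add: class_K_def)
    have "continuous_on {0..} (\<lambda>t. g (3 * b powr t * \<phi> r))"
    proof (rule continuous_on_compose2[OF cg])
      show "continuous_on {0..} (\<lambda>t. 3 * b powr t * \<phi> r)" using b by (intro continuous_intros) auto
    qed (use nn r in auto)
    moreover have "g (3 * b powr t * \<phi> r) < g (3 * b powr s * \<phi> r)" if "s < t" for s t
      using powr_less_mono'[OF b that] \<phi>r b by (intro class_K_less[OF gK]) auto
    moreover have "((\<lambda>t. g (3 * b powr t * \<phi> r)) \<longlongrightarrow> 0) at_top"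
    proof -
      have "((\<lambda>t. b powr t) \<longlongrightarrow> 0) at_top"
      proof -
        have "((\<lambda>t. exp (ln b * t)) \<longlongrightarrow> 0) at_top"
          using b by (intro filterlim_compose[OF exp_at_bot] filterlim_tendsto_neg_mult_at_bot[OF tendsto_const _ filterlim_ident]) auto
        then show ?thesis using b by (simp add: powr_def mult.commute)
      qed
      then have "((\<lambda>t. 3 * b powr t * \<phi> r) \<longlongrightarrow> 3 * 0 * \<phi> r) at_top" by (intro tendsto_intros)
      then have lim: "((\<lambda>t. 3 * b powr t * \<phi> r) \<longlongrightarrow> 0) at_top" by simp
      have "((\<lambda>t. g (3 * b powr t * \<phi> r)) \<longlongrightarrow> g 0) at_top"
        by (rule continuous_on_tendsto_compose[OF cg lim]) (use nn r in \<open>auto intro: always_eventually\<close>)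
      then show ?thesis using gK by (simp add: class_K_def)
    qed
    ultimately show ?thesis
      using class_K_nonneg[OF gK nn] r unfolding class_L_def by (auto simp: less_imp_le)
  qed
  ultimately show ?thesis unfolding class_KL_def by (simp add: split_beta)
qed

text \<open>For the limit of the energy estimate an upper bound of the input integrals is enough.
  The crude inequality spares a proof that the norms converge; its factor 2 goes into the
  gain.\<close>

lemma L2_on_continuous_bound:
  fixes f g :: "real \<Rightarrow> 'a::euclidean_space"
  assumes f: "continuous_on {0..t} f" and g: "g \<in> L2_on {0..t}"
  shows "integral {0..t} (\<lambda>s. (norm (f s))\<^sup>2) \<le> 2 * (L2_norm_on {0..t} (\<lambda>s. f s - g s))\<^sup>2 + 2 * (L2_norm_on {0..t} g)\<^sup>2"
proof -
  let ?M = "lebesgue_on {0..t}"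
  have fm: "f \<in> borel_measurable ?M" by (intro continuous_imp_measurable_on_sets_lebesgue f) auto
  have gm: "g \<in> borel_measurable ?M" and gi: "integrable ?M (\<lambda>s. (norm (g s))\<^sup>2)"
    using g by (auto simp: L2_on_def)
  have fi: "integrable ?M (\<lambda>s. (norm (f s))\<^sup>2)"
    by (intro continuous_imp_integrable_real continuous_intros f)
  have tri: "(norm (u + v))\<^sup>2 \<le> 2 * (norm u)\<^sup>2 + 2 * (norm v)\<^sup>2" for u v :: 'a
  proof -
    have "(norm (u + v))\<^sup>2 \<le> (norm u + norm v)\<^sup>2" by (intro power_mono norm_triangle_ineq) auto
    also have "\<dots> \<le> 2 * (norm u)\<^sup>2 + 2 * (norm v)\<^sup>2" by (rule square_add_le)
    finally show ?thesis .
  qed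
  have di: "integrable ?M (\<lambda>s. (norm (f s - g s))\<^sup>2)"
  proof (rule Bochner_Integration.integrable_bound)
    show "integrable ?M (\<lambda>s. 2 * (norm (f s))\<^sup>2 + 2 * (norm (g s))\<^sup>2)"
      by (intro Bochner_Integration.integrable_add integrable_mult_right fi gi)
    show "(\<lambda>s. (norm (f s - g s))\<^sup>2) \<in> borel_measurable ?M"
      by (intro borel_measurable_power measurable_compose[OF borel_measurable_diff[OF fm gm] borel_measurable_norm])
    show "AE s in ?M. norm ((norm (f s - g s))\<^sup>2) \<le> norm (2 * (norm (f s))\<^sup>2 + 2 * (norm (g s))\<^sup>2)"
    proof (rule AE_I2)
      fix s
      show "norm ((norm (f s - g s))\<^sup>2) \<le> norm (2 * (norm (f s))\<^sup>2 + 2 * (norm (g s))\<^sup>2)"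
        using tri[of "f s" "- g s"] by simp
    qed
  qed
  have "integral {0..t} (\<lambda>s. (norm (f s))\<^sup>2) = (LINT s|?M. (norm (f s))\<^sup>2)"
    using lebesgue_integral_eq_integral[OF fi] by simp
  also have "\<dots> \<le> (LINT s|?M. 2 * (norm (f s - g s))\<^sup>2 + 2 * (norm (g s))\<^sup>2)"
  proof (rule integral_mono[OF fi])
    show "integrable ?M (\<lambda>s. 2 * (norm (f s - g s))\<^sup>2 + 2 * (norm (g s))\<^sup>2)"
      by (intro Bochner_Integration.integrable_add integrable_mult_right di gi)
    show "(norm (f s))\<^sup>2 \<le> 2 * (norm (f s - g s))\<^sup>2 + 2 * (norm (g s))\<^sup>2" for s
      using tri[of "f s - g s" "g s"] by simp
  qed
  also have "\<dots> = 2 * (LINT s|?M. (norm (f s - g s))\<^sup>2) + 2 * (LINT s|?M. (norm (g s))\<^sup>2)"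
    using di gi by simp
  finally show ?thesis by (simp add: L2_norm_on_def)
qed

section \<open>Passage to generalized solutions\<close>

context closed_loop
begin

text \<open>Initial states are prescribed only up to \<open>cl_eq\<close>, hence up to null sets in
  the first component.\<close>

lemma E_cl_cong:
  assumes z: "z \<in> cl_space" and w: "w \<in> cl_space" and eq: "cl_eq z w"
  shows "E_cl S G z = E_cl S G w"
proof -
  have zX: "fst z \<in> X_space" and wX: "fst w \<in> X_space"
    using z w by (simp_all add: cl_space_def mem_Times_iff)
  have ae: "AE \<zeta> in unit_leb. fst z \<zeta> = fst w \<zeta>" and snd: "snd z = snd w"
    using eq by (simp_all add: cl_eq_def)
  have "inner_X S (fst z) (fst z) = inner_X S (fst w) (fst w)"
    unfolding inner_X_def
  proof (rule integral_cong_AE)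
    show "(\<lambda>\<zeta>. fst z \<zeta> \<bullet> (Ham S \<zeta> *v fst z \<zeta>)) \<in> borel_measurable unit_leb"
      by (rule borel_measurable_integrable[OF inner_X_integrable[OF zX zX]])
    show "(\<lambda>\<zeta>. fst w \<zeta> \<bullet> (Ham S \<zeta> *v fst w \<zeta>)) \<in> borel_measurable unit_leb"
      by (rule borel_measurable_integrable[OF inner_X_integrable[OF wX wX]])
    show "AE \<zeta> in unit_leb. fst z \<zeta> \<bullet> (Ham S \<zeta> *v fst z \<zeta>) = fst w \<zeta> \<bullet> (Ham S \<zeta> *v fst w \<zeta>)"
      using ae by eventually_elim simp
  qed
  then show ?thesis by (simp add: E_cl_eq snd)
qed

lemma E_cl_tendsto:
  assumes z: "z \<in> cl_space" and zs: "\<And>k. zs k \<in> cl_space"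
    and lim: "(\<lambda>k. norm_cl S G (zs k - z)) \<longlonglongrightarrow> 0"
  shows "(\<lambda>k. E_cl S G (zs k)) \<longlonglongrightarrow> E_cl S G z"
proof -
  obtain K where K: "0 < K" "\<forall>z\<in>cl_space. l2 (fst z) \<le> K * norm_cl S G z"
    "\<forall>z. norm (fst (snd z)) \<le> K * norm_cl S G z" "\<forall>z. norm (snd (snd z)) \<le> K * norm_cl S G z"
    by (rule parts_le_norm_cl)
  obtain m M where form: "l2_form (inner_X S) M" by (rule inner_X_self_bounds)
  have zX: "fst z \<in> X_space" and zsX: "fst (zs k) \<in> X_space" for k
    using z zs[of k] by (simp_all add: cl_space_def mem_Times_iff)
  have Klim: "(\<lambda>k. K * norm_cl S G (zs k - z)) \<longlonglongrightarrow> 0" by (rule tendsto_mult_right_zero[OF lim])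
  have "(\<lambda>k. l2 (fst (zs k) - fst z)) \<longlonglongrightarrow> 0"
  proof (rule Lim_null_comparison[OF _ Klim], intro always_eventually allI)
    fix k
    have "zs k - z \<in> cl_space" using X_space_diff[OF zsX[of k] zX] by (simp add: cl_space_def mem_Times_iff)
    then have "l2 (fst (zs k - z)) \<le> K * norm_cl S G (zs k - z)" using K(2) by blast
    then show "norm (l2 (fst (zs k) - fst z)) \<le> K * norm_cl S G (zs k - z)"
      using l2_nonneg[of "fst (zs k) - fst z"] by simp
  qed
  then have 1: "(\<lambda>k. inner_X S (fst (zs k)) (fst (zs k))) \<longlonglongrightarrow> inner_X S (fst z) (fst z)"
    by (rule l2_form.tendsto_diagonal[OF form zX zsX])
  have "(\<lambda>k. fst (snd (zs k)) - fst (snd z)) \<longlonglongrightarrow> 0"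
  proof (rule Lim_null_comparison[OF _ Klim], intro always_eventually allI)
    show "norm (fst (snd (zs k)) - fst (snd z)) \<le> K * norm_cl S G (zs k - z)" for k
      using K(3)[rule_format, of "zs k - z"] by simp
  qed
  then have v1: "(\<lambda>k. fst (snd (zs k))) \<longlonglongrightarrow> fst (snd z)" by (rule LIM_zero_cancel)
  have "Pot G differentiable (at (fst (snd z)))" using controller by (simp add: nonlinear_controller_def)
  then have "isCont (Pot G) (fst (snd z))" by (rule differentiable_imp_continuous_within)
  then have 2: "(\<lambda>k. Pot G (fst (snd (zs k)))) \<longlonglongrightarrow> Pot G (fst (snd z))"
    by (rule isCont_tendsto_compose[OF _ v1])
  have "(\<lambda>k. snd (snd (zs k)) - snd (snd z)) \<longlonglongrightarrow> 0"
  proof (rule Lim_null_comparison[OF _ Klim], intro always_eventually allI)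
    show "norm (snd (snd (zs k)) - snd (snd z)) \<le> K * norm_cl S G (zs k - z)" for k
      using K(4)[rule_format, of "zs k - z"] by simp
  qed
  then have v2: "(\<lambda>k. snd (snd (zs k))) \<longlonglongrightarrow> snd (snd z)" by (rule LIM_zero_cancel)
  have 3: "(\<lambda>k. snd (snd (zs k)) \<bullet> (Kc G *v snd (snd (zs k)))) \<longlonglongrightarrow> snd (snd z) \<bullet> (Kc G *v snd (snd z))"
    by (rule tendsto_inner[OF v2 bounded_linear.tendsto[OF matrix_vector_mul_bounded_linear v2]])
  show ?thesis unfolding E_cl_eq
    by (rule tendsto_add[OF tendsto_add[OF tendsto_mult[OF tendsto_const 1] 2] tendsto_mult[OF tendsto_const 3]])
qed

text \<open>At a fixed time both sides of the classical estimate pass to the limit, since the energy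
  is continuous in the state norm and the approximation errors \<open>Dk\<close> of the inputs tend
  to 0.\<close>

lemma generalized_energy_decay:
  obtains c C where "0 < c" "0 < C"
    "\<And>z d dc y t. generalized_solution S G \<infinity> z d dc y \<Longrightarrow> 0 \<le> t \<Longrightarrow>
       E_cl S G (z t) \<le> 3 / 2 * exp (- c * t) * E_cl S G (z 0)
         + C * ((L2_norm_on {0..t} d)\<^sup>2 + (L2_norm_on {0..t} dc)\<^sup>2)"
proof -
  obtain c C where c: "0 < c" and C: "0 < C"
    and decay: "\<And>z d dc y t. classical_solution S G \<infinity> z d dc y \<Longrightarrow> 0 \<le> t \<Longrightarrow>
       E_cl S G (z t) \<le> 3 / 2 * exp (- c * t) * E_cl S G (z 0)
         + C * integral {0..t} (\<lambda>s. (norm (d s))\<^sup>2 + (norm (dc s))\<^sup>2)"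
    by (rule classical_energy_decay) blast
  show ?thesis
  proof (rule that[of c "2 * C"])
    show "0 < c" "0 < 2 * C" using c C by auto
    fix z d dc y and t :: real
    assume gs: "generalized_solution S G \<infinity> z d dc y" and t: "0 \<le> t"
    obtain zs ds dcs ys where cs: "\<And>k. classical_solution S G \<infinity> (zs k) (ds k) (dcs k) (ys k)"
      and conv: "\<forall>T\<in>{0..}. \<forall>\<epsilon>>0. \<forall>\<^sub>F k in sequentially. \<forall>t\<in>{0..T}. norm_cl S G (zs k t - z t) < \<epsilon>"
      and dl: "L2_loc_tendsto \<infinity> ds d" "L2_loc_tendsto \<infinity> dcs dc"
      using gs unfolding generalized_solution_def time_dom_infinity by blast
    have dL: "d \<in> L2_on {0..t}" "dc \<in> L2_on {0..t}"
      using gs t by (auto simp: generalized_solution_def L2_loc_def time_dom_infinity)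
    have zX: "z s \<in> cl_space" if "0 \<le> s" for s
      using gs that by (simp add: generalized_solution_def cont_into_def time_dom_infinity)
    have zsX: "zs k s \<in> cl_space" if "0 \<le> s" for k s
      using cs[of k] that by (simp add: classical_solution_def cont_into_def time_dom_infinity dom_cl_def dom_A_def cl_space_def mem_Times_iff)
    have zlim: "(\<lambda>k. norm_cl S G (zs k s - z s)) \<longlonglongrightarrow> 0" if s: "0 \<le> s" for s
    proof (rule tendstoI)
      fix e :: real assume "0 < e"
      then have "\<forall>\<^sub>F k in sequentially. \<forall>t\<in>{0..s}. norm_cl S G (zs k t - z t) < e" using conv s by simp
      then show "\<forall>\<^sub>F k in sequentially. dist (norm_cl S G (zs k s - z s)) 0 < e"
        by eventually_elim (use s norm_cl_nonneg in auto)
    qed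
    have E_lim: "(\<lambda>k. E_cl S G (zs k s)) \<longlonglongrightarrow> E_cl S G (z s)" if "0 \<le> s" for s
      by (rule E_cl_tendsto[OF zX[OF that] zsX[OF that] zlim[OF that]])
    define Dk where "Dk k = (L2_norm_on {0..t} (\<lambda>s. ds k s - d s))\<^sup>2 + (L2_norm_on {0..t} (\<lambda>s. dcs k s - dc s))\<^sup>2" for k
    define D where "D = (L2_norm_on {0..t} d)\<^sup>2 + (L2_norm_on {0..t} dc)\<^sup>2"
    have bound: "E_cl S G (zs k t) \<le> 3 / 2 * exp (- c * t) * E_cl S G (zs k 0) + C * (2 * Dk k + 2 * D)" for k
    proof -
      have cont: "continuous_on {0..t} (ds k)" "continuous_on {0..t} (dcs k)"
      proof -
        have "continuous_on {0..} (ds k)" "continuous_on {0..} (dcs k)"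
          using cs[of k] C2_on_imp_continuous_on unfolding classical_solution_def time_dom_infinity by blast+
        then show "continuous_on {0..t} (ds k)" "continuous_on {0..t} (dcs k)"
          by (auto intro: continuous_on_subset)
      qed
      have "integral {0..t} (\<lambda>s. (norm (ds k s))\<^sup>2 + (norm (dcs k s))\<^sup>2)
          = integral {0..t} (\<lambda>s. (norm (ds k s))\<^sup>2) + integral {0..t} (\<lambda>s. (norm (dcs k s))\<^sup>2)"
        by (intro Henstock_Kurzweil_Integration.integral_add integrable_continuous_real continuous_intros cont)
      also have "\<dots> \<le> 2 * Dk k + 2 * D"
        using add_mono[OF L2_on_continuous_bound[OF cont(1) dL(1)] L2_on_continuous_bound[OF cont(2) dL(2)]]
        by (simp add: Dk_def D_def)
      finally have "C * integral {0..t} (\<lambda>s. (norm (ds k s))\<^sup>2 + (norm (dcs k s))\<^sup>2) \<le> C * (2 * Dk k + 2 * D)"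
        using C by (intro mult_left_mono) auto
      then show ?thesis using decay[OF cs[of k] t] by linarith
    qed
    have "Dk \<longlonglongrightarrow> 0\<^sup>2 + 0\<^sup>2"
      unfolding Dk_def using dl t by (intro tendsto_intros) (auto simp: L2_loc_tendsto_def time_dom_infinity)
    then have "(\<lambda>k. 3 / 2 * exp (- c * t) * E_cl S G (zs k 0) + C * (2 * Dk k + 2 * D))
        \<longlonglongrightarrow> 3 / 2 * exp (- c * t) * E_cl S G (z 0) + C * (2 * (0\<^sup>2 + 0\<^sup>2) + 2 * D)"
      by (intro tendsto_add tendsto_mult tendsto_const E_lim) simp_all
    from LIMSEQ_le[OF E_lim[OF t] this] bound
    show "E_cl S G (z t) \<le> 3 / 2 * exp (- c * t) * E_cl S G (z 0)
         + 2 * C * ((L2_norm_on {0..t} d)\<^sup>2 + (L2_norm_on {0..t} dc)\<^sup>2)"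
      by (simp add: D_def mult.assoc mult.left_commute)
  qed
qed

end

text \<open>A weak triangle inequality: \<open>g\<close> need not be subadditive, so the sum is
  replaced by twice its dominant part. If 3/2 a dominates, doubling gives exactly the factor 3 of
  \<beta>; otherwise b + c is doubled and then replaced by twice its larger term.\<close>

lemma class_K_inf_sum_le:
  assumes g: "class_K_inf g" and nonneg: "0 \<le> a" "0 \<le> b" "0 \<le> c"
    and e: "0 \<le> e" "e \<le> 3 / 2 * a + (b + c)"
  shows "g e \<le> g (3 * a) + g (2 * (2 * b)) + g (2 * (2 * c))"
proof -
  have K: "class_K g" using g by (simp add: class_K_inf_def)
  have nn: "0 \<le> g (3 * a)" "0 \<le> g (2 * (2 * b))" "0 \<le> g (2 * (2 * c))"
    using nonneg by (auto intro: class_K_nonneg[OF K])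
  consider "b + c \<le> 3 / 2 * a" | "3 / 2 * a \<le> b + c" "b \<le> c" | "3 / 2 * a \<le> b + c" "c \<le> b" by linarith
  then show ?thesis
  proof cases
    case 1
    then show ?thesis using class_K_mono[OF K e(1), of "3 * a"] e nn by simp
  next
    case 2
    then show ?thesis using class_K_mono[OF K e(1), of "2 * (2 * c)"] e nn by simp
  next
    case 3
    then show ?thesis using class_K_mono[OF K e(1), of "2 * (2 * b)"] e nn by simp
  qed
qed

theorem theorem4p4:
  fixes S :: "('n::finite, 'm::finite) phs"
    and G :: "('m, 'c::finite) ctrl"
    and \<phi>1 \<phi>2 :: "real \<Rightarrow> real"
  assumes system: "port_Hamiltonian S"
    and passivity: "impedance_passive S"
    and controller: "nonlinear_controller G"
    and \<phi>1: "class_K_inf \<phi>1"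
    and \<phi>2: "class_K_inf \<phi>2"
    and \<phi>_E: "\<forall>z\<in>(cl_space :: ('n, 'c) cl_state set).
                \<phi>1 (norm_cl S G z) \<le> E_cl S G z \<and> E_cl S G z \<le> \<phi>2 (norm_cl S G z)"
    and A1: "\<exists>\<kappa>>0. \<forall>x\<in>dom_A S.
               \<kappa> * ((norm (crep (Hmul S x) 0))\<^sup>2 + (norm (crep (wD (Hmul S x)) 0))\<^sup>2
                     + (norm (crep (Hmul S x) 1))\<^sup>2)
               \<le> (norm (op_B S x))\<^sup>2 + (norm (op_C S x))\<^sup>2"
    and A2: "2 > esssup unit_leb (\<lambda>\<zeta>. ereal (opnorm
                   ((\<zeta> - 1) *\<^sub>R (wD (Ham S) \<zeta> ** matrix_inv (Ham S \<zeta>) + matrix_inv (P2 S) ** P1 S))))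
               + ereal (1 / sqrt 2 * opnorm
                   (transpose (P0 S) ** matrix_inv (P2 S)
                    + matrix_inv (P2 S) ** P0 S ** P1 S ** matrix_inv (P2 S) ** P1 S ** matrix_inv (P2 S)))
               + ereal (1 / 2 * opnorm
                   (transpose (matrix_inv (P2 S) ** P0 S) ** (matrix_inv (P2 S) ** P0 S)))"
    and B1: "\<exists>c1_up>0. \<exists>c1_low>0. \<forall>v1.
               c1_up * (v1 \<bullet> grad (Pot G) v1) \<ge> Pot G v1 \<and> Pot G v1 \<ge> c1_low * (norm v1)\<^sup>2"
    and B2: "\<exists>c2_up>0. \<exists>c2_low>0. \<forall>v2.
               c2_up * (v2 \<bullet> Res G v2) \<ge> (norm v2)\<^sup>2 \<and> (norm v2)\<^sup>2 \<ge> c2_low * (norm (Res G v2))\<^sup>2"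
  shows "\<exists>T0 \<beta>0 C1 C2. 0 < T0 \<and> 0 < \<beta>0 \<and> \<beta>0 < 1 \<and> 0 < C1 \<and> 0 < C2 \<and>
    (let \<phi>1_inv = inv_into {0..} \<phi>1;
         \<beta> = (\<lambda>r t. \<phi>1_inv (3 * \<beta>0 powr (t / T0) * \<phi>2 r));
         \<gamma>1 = (\<lambda>r. \<phi>1_inv (3 * C1 * r\<^sup>2));
         \<gamma>2 = (\<lambda>r. \<phi>1_inv (3 * C2 * r\<^sup>2))
     in class_KL \<beta> \<and> class_K_inf \<gamma>1 \<and> class_K_inf \<gamma>2 \<and>
        (\<forall>z0 \<in> (cl_space :: ('n, 'c) cl_state set). \<forall>d \<in> L2_loc \<infinity>. \<forall>dc \<in> L2_loc \<infinity>. \<forall>z y.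
           generalized_solution S G \<infinity> z d dc y \<and> cl_eq (z 0) z0 \<longrightarrow>
           (\<forall>t>0. norm_cl S G (z t)
                  \<le> \<beta> (norm_cl S G z0) t + \<gamma>1 (L2_norm_on {0..t} d) + \<gamma>2 (L2_norm_on {0..t} dc))))"
proof -
  interpret closed_loop S G
    by unfold_locales (fact system controller B1 B2 passivity A1)+
  obtain c C where c: "0 < c" and C: "0 < C"
    and decay: "\<And>z d dc y t. generalized_solution S G \<infinity> z d dc y \<Longrightarrow> 0 \<le> t \<Longrightarrow>
       E_cl S G (z t) \<le> 3 / 2 * exp (- c * t) * E_cl S G (z 0)
         + C * ((L2_norm_on {0..t} d)\<^sup>2 + (L2_norm_on {0..t} dc)\<^sup>2)"
    by (rule generalized_energy_decay) blast
  define g where "g = inv_into {0..} \<phi>1"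
  \<comment> \<open>With T_0 = 1 the exponential rate c becomes the decay factor per unit of
    time.\<close>
  define b where "b = exp (- c)"
  have b: "0 < b" "b < 1" using c by (auto simp: b_def)
  have g: "class_K_inf g" unfolding g_def by (rule class_K_inf_inv[OF \<phi>1])
  have \<phi>2K: "class_K \<phi>2" using \<phi>2 by (simp add: class_K_inf_def)
  have gam: "class_K_inf (\<lambda>r. g (3 * (2 * C) * r\<^sup>2))"
    using C by (intro class_K_inf_compose[OF g] class_K_inf_square) auto
  have main: "norm_cl S G (z t) \<le> g (3 * b powr (t / 1) * \<phi>2 (norm_cl S G z0))
      + g (3 * (2 * C) * (L2_norm_on {0..t} d)\<^sup>2) + g (3 * (2 * C) * (L2_norm_on {0..t} dc)\<^sup>2)"
    if z0: "z0 \<in> cl_space" and gs: "generalized_solution S G \<infinity> z d dc y" and eq: "cl_eq (z 0) z0" and t: "0 < t"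
    for z0 :: "('n, 'c) cl_state" and z d dc y t
  proof -
    have z: "z s \<in> cl_space" if "0 \<le> s" for s
      using gs that by (simp add: generalized_solution_def cont_into_def time_dom_infinity)
    have b_t: "b powr (t / 1) = exp (- c * t)" by (simp add: b_def powr_def mult.commute)
    define A where "A = exp (- c * t) * \<phi>2 (norm_cl S G z0)"
    define X where "X = C * (L2_norm_on {0..t} d)\<^sup>2"
    define Y where "Y = C * (L2_norm_on {0..t} dc)\<^sup>2"
    have nn: "0 \<le> A" "0 \<le> X" "0 \<le> Y"
      using class_K_nonneg[OF \<phi>2K norm_cl_nonneg] C by (auto simp: A_def X_def Y_def)
    have "E_cl S G (z 0) = E_cl S G z0" by (rule E_cl_cong[OF z z0 eq]) simp
    also have "\<dots> \<le> \<phi>2 (norm_cl S G z0)" using \<phi>_E z0 by blast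
    finally have "3 / 2 * exp (- c * t) * E_cl S G (z 0) \<le> 3 / 2 * exp (- c * t) * \<phi>2 (norm_cl S G z0)"
      by (intro mult_left_mono) auto
    then have E: "E_cl S G (z t) \<le> 3 / 2 * A + (X + Y)"
    proof -
      have "3 / 2 * exp (- c * t) * \<phi>2 (norm_cl S G z0) = 3 / 2 * A" by (simp add: A_def)
      moreover have "C * ((L2_norm_on {0..t} d)\<^sup>2 + (L2_norm_on {0..t} dc)\<^sup>2) = X + Y"
        by (simp add: X_def Y_def distrib_left)
      ultimately show ?thesis
        using \<open>3 / 2 * exp (- c * t) * E_cl S G (z 0) \<le> _\<close> decay[OF gs less_imp_le[OF t]] by linarith
    qed
    have low: "\<phi>1 (norm_cl S G (z t)) \<le> E_cl S G (z t)" using \<phi>_E z[of t] t by simp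
    have E0: "0 \<le> \<phi>1 (norm_cl S G (z t))"
      by (rule class_K_nonneg[OF class_K_inf_K[OF \<phi>1] norm_cl_nonneg])
    have "norm_cl S G (z t) = g (\<phi>1 (norm_cl S G (z t)))"
      unfolding g_def by (rule inv_class_K_inf_left[OF \<phi>1 norm_cl_nonneg, symmetric])
    also have "\<dots> \<le> g (3 * A) + g (2 * (2 * X)) + g (2 * (2 * Y))"
      by (rule class_K_inf_sum_le[OF g nn E0 order_trans[OF low E]])
    \<comment> \<open>The factor 4 C from the splitting is enlarged to 6 C, which has the required
      form 3 C_1 with C_1 = 2 C, and likewise for C_2.\<close>
    also have "\<dots> \<le> g (3 * A) + g (3 * (2 * X)) + g (3 * (2 * Y))"
      using nn by (intro add_mono class_K_mono[OF class_K_inf_K[OF g]]) auto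
    finally show ?thesis unfolding b_t A_def X_def Y_def by (simp add: mult.assoc)
  qed
  show ?thesis
    unfolding Let_def g_def[symmetric]
  proof (rule exI[of _ 1], rule exI[of _ b], rule exI[of _ "2 * C"], rule exI[of _ "2 * C"],
      intro conjI ballI allI impI)
    show "(0::real) < 1" "0 < b" "b < 1" "0 < 2 * C" "0 < 2 * C" using b C by auto
    show "class_KL (\<lambda>r t. g (3 * b powr (t / 1) * \<phi>2 r))" by (rule class_KL_exp[OF g \<phi>2K b])
    show "class_K_inf (\<lambda>r. g (3 * (2 * C) * r\<^sup>2))" "class_K_inf (\<lambda>r. g (3 * (2 * C) * r\<^sup>2))" by (rule gam)+
  next
    fix z0 :: "('n, 'c) cl_state" and d dc z y and t :: real
    assume "z0 \<in> cl_space" "generalized_solution S G \<infinity> z d dc y \<and> cl_eq (z 0) z0" "0 < t"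
    then show "norm_cl S G (z t) \<le> g (3 * b powr (t / 1) * \<phi>2 (norm_cl S G z0))
        + g (3 * (2 * C) * (L2_norm_on {0..t} d)\<^sup>2) + g (3 * (2 * C) * (L2_norm_on {0..t} dc)\<^sup>2)"
      by (elim conjE) (rule main)
  qed
qed

end
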